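(* Let $K$ be an infinite field. If $K$ is large and stable, then $K$ is separably closed.
   Context: $K$ is large if every smooth $K$-curve with a $K$-point has infinitely many $K$-points. $K$ is stable if its complete first-order theory in the language of rings is stable in the sense of model theory. *)

theory Defs
  imports
    "HOL-Algebra.Algebraic_Closure_Type"
    "HOL-Library.Poly_Mapping"
    "HOL-Library.Function_Algebras"
begin

text \<open>
  The field \<open>K\<close> is the type \<open>'a :: field\<close>, embedded by \<^const>\<open>to_ac\<close> into its algebraic closure
  \<open>'a alg_closure\<close>.  Smooth \<open>K\<close>-schemes are reduced, so it suffices to have a language for reduced
  separated \<open>K\<close>-schemes of finite type.  These are described as abstract varieties in the style of
  Weil and Serre: a set of geometric points (points over the algebraic closure) together with a
  finite atlas of affine charts, where all equations, open sets and transition functions are over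
  \<open>K\<close>.  Nothing is assumed to be affine, quasi-projective or irreducible.
\<close>

section \<open>Affine algebraic sets over \<open>K\<close>\<close>

type_synonym 'a mpoly = "(nat \<Rightarrow>\<^sub>0 nat) \<Rightarrow>\<^sub>0 'a"

definition poly_ring :: "nat \<Rightarrow> 'a::field mpoly set" where
  "poly_ring n = {p. \<forall>m\<in>Poly_Mapping.keys p. Poly_Mapping.keys m \<subseteq> {..<n}}"

definition eval_ac :: "'a::field mpoly \<Rightarrow> (nat \<Rightarrow> 'a alg_closure) \<Rightarrow> 'a alg_closure" where
  "eval_ac p x =
     (\<Sum>m\<in>Poly_Mapping.keys p. to_ac (Poly_Mapping.lookup p m) *
        (\<Prod>i\<in>Poly_Mapping.keys m. x i ^ Poly_Mapping.lookup m i))"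

definition partial_deriv :: "nat \<Rightarrow> 'a::field mpoly \<Rightarrow> 'a mpoly" where
  "partial_deriv i p =
     (\<Sum>m\<in>Poly_Mapping.keys p. Poly_Mapping.single (m - Poly_Mapping.single i 1)
        (of_nat (Poly_Mapping.lookup m i) * Poly_Mapping.lookup p m))"

text \<open>Points of affine \<open>n\<close>-space are sequences padded with zeros.\<close>

definition affine_space :: "nat \<Rightarrow> (nat \<Rightarrow> 'a::field alg_closure) set" where
  "affine_space n = {x. \<forall>i\<ge>n. x i = 0}"

definition zero_locus :: "nat \<Rightarrow> 'a::field mpoly set \<Rightarrow> (nat \<Rightarrow> 'a alg_closure) set" where
  "zero_locus n F = {x \<in> affine_space n. \<forall>f\<in>F. eval_ac f x = 0}"

definition vanishing_ideal :: "nat \<Rightarrow> (nat \<Rightarrow> 'a::field alg_closure) set \<Rightarrow> 'a mpoly set" where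
  "vanishing_ideal n V = {f \<in> poly_ring n. \<forall>x\<in>V. eval_ac f x = 0}"

definition K_closed :: "nat \<Rightarrow> (nat \<Rightarrow> 'a::field alg_closure) set \<Rightarrow> bool" where
  "K_closed n V \<longleftrightarrow> (\<exists>F \<subseteq> poly_ring n. V = zero_locus n F)"

definition K_open_in ::
  "nat \<Rightarrow> (nat \<Rightarrow> 'a::field alg_closure) set \<Rightarrow> (nat \<Rightarrow> 'a alg_closure) set \<Rightarrow> bool" where
  "K_open_in n V W \<longleftrightarrow> (\<exists>C. K_closed n C \<and> W = V - C)"

definition regular_function ::
  "nat \<Rightarrow> (nat \<Rightarrow> 'a::field alg_closure) set \<Rightarrow> ((nat \<Rightarrow> 'a alg_closure) \<Rightarrow> 'a alg_closure) \<Rightarrow> bool" where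
  "regular_function n W h \<longleftrightarrow>
     (\<forall>x\<in>W. \<exists>f\<in>poly_ring n. \<exists>g\<in>poly_ring n. eval_ac g x \<noteq> 0 \<and>
        (\<forall>y\<in>W. eval_ac g y \<noteq> 0 \<longrightarrow> h y = eval_ac f y / eval_ac g y))"

definition join :: "nat \<Rightarrow> (nat \<Rightarrow> 'b) \<Rightarrow> (nat \<Rightarrow> 'b) \<Rightarrow> nat \<Rightarrow> 'b" where
  "join n x y = (\<lambda>i. if i < n then x i else y (i - n))"


section \<open>Abstract varieties over \<open>K\<close>\<close>

record ('k, 'p) chart =
  edim :: nat
  cdom :: "'p set"
  cmap :: "'p \<Rightarrow> nat \<Rightarrow> 'k"

definition affine_chart :: "('a::field alg_closure, 'p) chart \<Rightarrow> bool" where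
  "affine_chart c \<longleftrightarrow> inj_on (cmap c) (cdom c) \<and> K_closed (edim c) (cmap c ` cdom c)"

definition compatible_charts :: "('a::field alg_closure, 'p) chart \<Rightarrow> ('a alg_closure, 'p) chart \<Rightarrow> bool" where
  "compatible_charts c d \<longleftrightarrow>
     K_open_in (edim c) (cmap c ` cdom c) (cmap c ` (cdom c \<inter> cdom d)) \<and>
     (\<forall>j<edim d. regular_function (edim c) (cmap c ` (cdom c \<inter> cdom d))
        (\<lambda>y. cmap d (inv_into (cdom c) (cmap c) y) j))"

text \<open>The diagonal is closed in the product of the two charts.\<close>

definition separated_charts :: "('a::field alg_closure, 'p) chart \<Rightarrow> ('a alg_closure, 'p) chart \<Rightarrow> bool" where
  "separated_charts c d \<longleftrightarrow>
     K_closed (edim c + edim d) ((\<lambda>x. join (edim c) (cmap c x) (cmap d x)) ` (cdom c \<inter> cdom d))"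

definition K_variety :: "('a::field alg_closure, 'p) chart set \<Rightarrow> bool" where
  "K_variety A \<longleftrightarrow> finite A \<and> (\<forall>c\<in>A. affine_chart c) \<and>
     (\<forall>c\<in>A. \<forall>d\<in>A. compatible_charts c d \<and> separated_charts c d)"

definition geom_points :: "('a::field alg_closure, 'p) chart set \<Rightarrow> 'p set" where
  "geom_points A = (\<Union>c\<in>A. cdom c)"

definition K_points :: "('a::field alg_closure, 'p) chart set \<Rightarrow> 'p set" where
  "K_points A = {x. \<exists>c\<in>A. x \<in> cdom c \<and> (\<forall>i<edim c. cmap c x i \<in> range to_ac)}"


section \<open>Dimension\<close>

text \<open>
  The Zariski topology over \<open>K\<close>.  Its irreducible closed subsets correspond to those of the
  associated \<open>K\<close>-scheme.
\<close>

definition closed_subset :: "('a::field alg_closure, 'p) chart set \<Rightarrow> 'p set \<Rightarrow> bool" where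
  "closed_subset A Z \<longleftrightarrow>
     Z \<subseteq> geom_points A \<and> (\<forall>c\<in>A. K_closed (edim c) (cmap c ` (Z \<inter> cdom c)))"

definition irreducible_closed :: "('a::field alg_closure, 'p) chart set \<Rightarrow> 'p set \<Rightarrow> bool" where
  "irreducible_closed A Z \<longleftrightarrow> closed_subset A Z \<and> Z \<noteq> {} \<and>
     (\<forall>Y Y'. closed_subset A Y \<longrightarrow> closed_subset A Y' \<longrightarrow> Z \<subseteq> Y \<union> Y' \<longrightarrow> Z \<subseteq> Y \<or> Z \<subseteq> Y')"

definition irreducible_component :: "('a::field alg_closure, 'p) chart set \<Rightarrow> 'p set \<Rightarrow> bool" where
  "irreducible_component A Z \<longleftrightarrow> irreducible_closed A Z \<and>
     (\<forall>Y. irreducible_closed A Y \<longrightarrow> Z \<subseteq> Y \<longrightarrow> Y = Z)"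

definition has_chain :: "('a::field alg_closure, 'p) chart set \<Rightarrow> 'p set \<Rightarrow> nat \<Rightarrow> bool" where
  "has_chain A Z d \<longleftrightarrow> (\<exists>C :: nat \<Rightarrow> 'p set.
     (\<forall>i\<le>d. irreducible_closed A (C i) \<and> C i \<subseteq> Z) \<and> (\<forall>i<d. C i \<subset> C (Suc i)))"

definition has_Krull_dim :: "('a::field alg_closure, 'p) chart set \<Rightarrow> 'p set \<Rightarrow> nat \<Rightarrow> bool" where
  "has_Krull_dim A Z d \<longleftrightarrow> has_chain A Z d \<and> \<not> has_chain A Z (Suc d)"

definition pure_dim :: "('a::field alg_closure, 'p) chart set \<Rightarrow> nat \<Rightarrow> bool" where
  "pure_dim A d \<longleftrightarrow> (\<forall>Z. irreducible_component A Z \<longrightarrow> has_Krull_dim A Z d)"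


section \<open>Smooth curves and large fields\<close>

definition gradient :: "nat \<Rightarrow> 'a::field mpoly \<Rightarrow> (nat \<Rightarrow> 'a alg_closure) \<Rightarrow> nat \<Rightarrow> 'a alg_closure" where
  "gradient n f x = (\<lambda>i. if i < n then eval_ac (partial_deriv i f) x else 0)"

text \<open>
  The rank over the algebraic closure of the Jacobian matrix of (generators of) the ideal of all
  polynomials over \<open>K\<close> that vanish on \<open>V\<close>.  Since this ideal is taken over \<open>K\<close> and the rank is tested
  at all geometric points, the Jacobian criterion below expresses smoothness over \<open>K\<close>, not merely
  regularity, also when \<open>K\<close> is imperfect.
\<close>

definition Jacobian_rank ::
  "nat \<Rightarrow> (nat \<Rightarrow> 'a::field alg_closure) set \<Rightarrow> (nat \<Rightarrow> 'a alg_closure) \<Rightarrow> nat" where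
  "Jacobian_rank n V x =
     vector_space.dim (\<lambda>c v i. c * v i) ((\<lambda>f. gradient n f x) ` vanishing_ideal n V)"

definition smooth_of_dim :: "('a::field alg_closure, 'p) chart set \<Rightarrow> nat \<Rightarrow> bool" where
  "smooth_of_dim A d \<longleftrightarrow> pure_dim A d \<and>
     (\<forall>c\<in>A. \<forall>x\<in>cdom c. Jacobian_rank (edim c) (cmap c ` cdom c) (cmap c x) + d = edim c)"

text \<open>
  Curves are pure of dimension one: an isolated \<open>K\<close>-point next to a one-dimensional component
  is not admitted.
\<close>

definition smooth_K_curve :: "('a::field alg_closure, 'p) chart set \<Rightarrow> bool" where
  "smooth_K_curve A \<longleftrightarrow> K_variety A \<and> smooth_of_dim A 1"

text \<open>
  Up to isomorphism the geometric points can be taken in any type with at least as many elements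
  as \<open>'a alg_closure\<close>, so the type of points chosen here is no restriction.
\<close>

definition large_field :: "'a::field itself \<Rightarrow> bool" where
  "large_field _ \<longleftrightarrow> (\<forall>A :: ('a alg_closure, nat \<Rightarrow> 'a alg_closure) chart set.
     smooth_K_curve A \<and> K_points A \<noteq> {} \<longrightarrow> infinite (K_points A))"


section \<open>First-order logic in the language of rings\<close>

datatype rterm =
    RVar nat
  | RZero
  | ROne
  | RNeg rterm
  | RAdd rterm rterm
  | RMult rterm rterm

datatype rformula =
    REq rterm rterm
  | RNot rformula
  | RAnd rformula rformula
  | REx nat rformula

primrec term_vars :: "rterm \<Rightarrow> nat set" where
  "term_vars (RVar v) = {v}"
| "term_vars RZero = {}"
| "term_vars ROne = {}"
| "term_vars (RNeg s) = term_vars s"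
| "term_vars (RAdd s t) = term_vars s \<union> term_vars t"
| "term_vars (RMult s t) = term_vars s \<union> term_vars t"

primrec free_vars :: "rformula \<Rightarrow> nat set" where
  "free_vars (REq s t) = term_vars s \<union> term_vars t"
| "free_vars (RNot \<phi>) = free_vars \<phi>"
| "free_vars (RAnd \<phi> \<psi>) = free_vars \<phi> \<union> free_vars \<psi>"
| "free_vars (REx v \<phi>) = free_vars \<phi> - {v}"

record 'm ring_structure =
  universe :: "'m set"
  szero :: 'm
  sone :: 'm
  sneg :: "'m \<Rightarrow> 'm"
  sadd :: "'m \<Rightarrow> 'm \<Rightarrow> 'm"
  smult :: "'m \<Rightarrow> 'm \<Rightarrow> 'm"

definition is_structure :: "'m ring_structure \<Rightarrow> bool" where
  "is_structure M \<longleftrightarrow> szero M \<in> universe M \<and> sone M \<in> universe M \<and>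
     (\<forall>x\<in>universe M. sneg M x \<in> universe M) \<and>
     (\<forall>x\<in>universe M. \<forall>y\<in>universe M. sadd M x y \<in> universe M \<and> smult M x y \<in> universe M)"

primrec term_val :: "'m ring_structure \<Rightarrow> (nat \<Rightarrow> 'm) \<Rightarrow> rterm \<Rightarrow> 'm" where
  "term_val M e (RVar v) = e v"
| "term_val M e RZero = szero M"
| "term_val M e ROne = sone M"
| "term_val M e (RNeg s) = sneg M (term_val M e s)"
| "term_val M e (RAdd s t) = sadd M (term_val M e s) (term_val M e t)"
| "term_val M e (RMult s t) = smult M (term_val M e s) (term_val M e t)"

primrec holds :: "'m ring_structure \<Rightarrow> (nat \<Rightarrow> 'm) \<Rightarrow> rformula \<Rightarrow> bool" where
  "holds M e (REq s t) \<longleftrightarrow> term_val M e s = term_val M e t"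
| "holds M e (RNot \<phi>) \<longleftrightarrow> \<not> holds M e \<phi>"
| "holds M e (RAnd \<phi> \<psi>) \<longleftrightarrow> holds M e \<phi> \<and> holds M e \<psi>"
| "holds M e (REx v \<phi>) \<longleftrightarrow> (\<exists>x\<in>universe M. holds M (e(v := x)) \<phi>)"

definition true_in :: "'m ring_structure \<Rightarrow> rformula \<Rightarrow> bool" where
  "true_in M \<phi> \<longleftrightarrow> (\<forall>e. range e \<subseteq> universe M \<longrightarrow> holds M e \<phi>)"

definition complete_theory :: "'m ring_structure \<Rightarrow> rformula set" where
  "complete_theory M = {\<phi>. free_vars \<phi> = {} \<and> true_in M \<phi>}"

definition is_model :: "'m ring_structure \<Rightarrow> rformula set \<Rightarrow> bool" where
  "is_model M T \<longleftrightarrow> is_structure M \<and> (\<forall>\<phi>\<in>T. true_in M \<phi>)"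


section \<open>Stability\<close>

text \<open>
  A formula \<open>\<phi>(x; y)\<close> in two tuples of variables is a formula with a cut \<open>m\<close>: the variables below \<open>m\<close>
  form the tuple \<open>x\<close> and the remaining ones the tuple \<open>y\<close>.  Tuples are given as assignments, of which
  only the values at the finitely many free variables of \<open>\<phi>\<close> matter.
\<close>

definition has_ladder :: "'m ring_structure \<Rightarrow> nat \<Rightarrow> rformula \<Rightarrow> nat \<Rightarrow> bool" where
  "has_ladder M m \<phi> k \<longleftrightarrow> (\<exists>a b :: nat \<Rightarrow> nat \<Rightarrow> 'm.
     (\<forall>i<k. range (a i) \<subseteq> universe M \<and> range (b i) \<subseteq> universe M) \<and>
     (\<forall>i<k. \<forall>j<k. holds M (\<lambda>v. if v < m then a i v else b j v) \<phi> \<longleftrightarrow> i < j))"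

text \<open>
  For a complete theory with a model over the type \<open>'m\<close> neither notion depends on the type \<open>'m\<close>,
  nor on the choice of the model: the existence of a ladder of given finite length is expressed
  by a sentence.  By compactness, arbitrarily long finite ladders amount to an infinite one in
  some model.
\<close>

definition order_property :: "'m itself \<Rightarrow> rformula set \<Rightarrow> nat \<Rightarrow> rformula \<Rightarrow> bool" where
  "order_property _ T m \<phi> \<longleftrightarrow> (\<forall>k. \<exists>M :: 'm ring_structure. is_model M T \<and> has_ladder M m \<phi> k)"

definition stable_theory :: "'m itself \<Rightarrow> rformula set \<Rightarrow> bool" where
  "stable_theory TM T \<longleftrightarrow> \<not> (\<exists>m \<phi>. order_property TM T m \<phi>)"

definition field_structure :: "'a::field ring_structure" where
  "field_structure = \<lparr>universe = UNIV, szero = 0, sone = 1, sneg = uminus, sadd = (+), smult = (*)\<rparr>"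

definition stable_field :: "'a::field itself \<Rightarrow> bool" where
  "stable_field TA \<longleftrightarrow> stable_theory TA (complete_theory (field_structure :: 'a ring_structure))"


section \<open>Separably closed fields\<close>

definition separable_element :: "'a::field alg_closure \<Rightarrow> bool" where
  "separable_element x \<longleftrightarrow> (\<exists>p :: 'a poly. irreducible p \<and>
     poly (map_poly to_ac p) x = 0 \<and> rsquarefree (map_poly to_ac p))"

definition separably_closed_field :: "'a::field itself \<Rightarrow> bool" where
  "separably_closed_field _ \<longleftrightarrow> (\<forall>x :: 'a alg_closure. separable_element x \<longrightarrow> x \<in> range to_ac)"

end

theory Submission
  imports Defs
begin

text \<open>
  Let \<open>K\<close> be infinite and large, and suppose that some separable element of its algebraic closure is
  not in \<open>K\<close>.  Its minimal polynomial gives a polynomial \<open>f\<close> of degree \<open>d \<ge> 2\<close> that is coprime to its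
  derivative and has no root in \<open>K\<close>.  The proof exhibits a formula that has ladders of every length in
  \<open>K\<close>, so that \<open>K\<close> is unstable.

  For \<open>t \<in> K\<close> consider \<open>h = f - t X\<close>.  On the one hand, \<open>f\<close> may acquire a root in \<open>K[X]/(h)\<close>, that is,
  \<open>f(u(X)) = h(X) c(X)\<close> for some polynomials \<open>u\<close> and \<open>c\<close>; on the other hand, \<open>h\<close> may have a root \<open>x\<close> in
  \<open>K\<close>.  These are incompatible, because the second turns the first into \<open>f(u(x)) = 0\<close>.  The first is
  to be expected for \<open>t\<close> close to \<open>0\<close>, where \<open>u = X\<close> is a solution at \<open>t = 0\<close> and \<open>f\<close> is separable; the
  second for \<open>t\<close> close to infinity, where the equation reads \<open>x = t\<inverse> f(x)\<close>.  If both hold for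
  \<open>t = s^m\<close> and \<open>t = s^(-m)\<close> respectively, for all \<open>1 \<le> m \<le> 2k\<close>, then the formula in \<open>a\<close> and \<open>b\<close> saying
  that \<open>f\<close> has a root modulo \<open>b f - a X\<close> defines a ladder of length \<open>k\<close> on suitable powers of \<open>s\<close>:
  its truth depends only on the sign of the exponent of \<open>a / b\<close>.

  No topology on \<open>K\<close> is given in which \<open>s\<close> could be chosen small, so it is a variable first.  In
  \<open>K[[s]]\<close> all these equations are solved by successive approximation
  (\<open>series_root_certificate\<close>, \<open>series_fixed_root\<close>), and the coefficients of the solutions are
  algebraic over \<open>K(s)\<close> (\<open>certificate_algebraic\<close>).  Largeness enters in
  \<open>algebraic_series_specialise\<close>: finitely many power series that are algebraic over \<open>K(s)\<close> lie in a
  subring \<open>R\<close> of \<open>K[[s]]\<close> that has a homomorphism to \<open>K\<close>, the identity on \<open>K\<close>, under which \<open>s\<close> does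
  not vanish.  It carries the solutions over \<open>K[[s]]\<close> to solutions over \<open>K\<close>.

  For this last result it has to be seen that \<open>R\<close> can be chosen as the coordinate ring of a smooth
  curve.  An algebraic power series is separable over \<open>K(s)\<close> (\<open>algebraic_fps_separable\<close>), and after
  subtracting a polynomial and dividing by a power of \<open>s\<close> it becomes a simple root modulo \<open>s\<close> of some
  polynomial over \<open>K[s]\<close> (\<open>blow_up\<close>).  Let \<open>R\<close> be generated by \<open>s\<close>, by such simple roots, and by the
  inverse of the product of the derivatives at these roots.  The geometric points of the
  corresponding affine curve are the homomorphisms over \<open>K\<close> from \<open>R\<close> to the algebraic closure.  As
  \<open>R\<close> is a domain, the curve is irreducible; as \<open>R\<close> is algebraic over \<open>K[s]\<close>, it has dimension one; and as \<open>R\<close>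
  is closed under \<open>d/ds\<close>, every point has a tangent vector, from which the rank of the Jacobian can be
  read off.  Reduction modulo \<open>s\<close> is a \<open>K\<close>-point, so there are infinitely many, and only finitely
  many of them lie above \<open>s = 0\<close>.
\<close>

section \<open>Homomorphisms on subrings\<close>

text \<open>
  Rings of power series, of functions on a curve and of algebraic elements all occur as subsets of
  one ambient type, and homomorphisms between them are only meaningful on these subsets.
\<close>
definition subring_set :: "'b::comm_ring_1 set \<Rightarrow> bool" where
  "subring_set S \<longleftrightarrow> 1 \<in> S \<and> (\<forall>x\<in>S. - x \<in> S) \<and> (\<forall>x\<in>S. \<forall>y\<in>S. x + y \<in> S \<and> x * y \<in> S)"

definition hom_on :: "'b::comm_ring_1 set \<Rightarrow> ('b \<Rightarrow> 'c::comm_ring_1) \<Rightarrow> bool" where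
  "hom_on S h \<longleftrightarrow> h 1 = 1 \<and> (\<forall>x\<in>S. \<forall>y\<in>S. h (x + y) = h x + h y \<and> h (x * y) = h x * h y)"

lemma subring_setD:
  assumes "subring_set S"
  shows "0 \<in> S" "1 \<in> S" "x \<in> S \<Longrightarrow> - x \<in> S" "x \<in> S \<Longrightarrow> y \<in> S \<Longrightarrow> x + y \<in> S"
    "x \<in> S \<Longrightarrow> y \<in> S \<Longrightarrow> x * y \<in> S" "x \<in> S \<Longrightarrow> y \<in> S \<Longrightarrow> x - y \<in> S" "x \<in> S \<Longrightarrow> x ^ n \<in> S"
proof -
  show 1: "1 \<in> S" and m: "\<And>x. x \<in> S \<Longrightarrow> - x \<in> S" and a: "\<And>x y. x \<in> S \<Longrightarrow> y \<in> S \<Longrightarrow> x + y \<in> S"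
    and t: "\<And>x y. x \<in> S \<Longrightarrow> y \<in> S \<Longrightarrow> x * y \<in> S"
    using assms by (auto simp: subring_set_def)
  show "0 \<in> S" using a[OF 1 m[OF 1]] by simp
  show "x \<in> S \<Longrightarrow> y \<in> S \<Longrightarrow> x - y \<in> S" using a[of x "- y"] m by simp
  show "x \<in> S \<Longrightarrow> x ^ n \<in> S" by (induction n) (auto intro: 1 t)
qed

lemma subring_set_UNIV [simp]: "subring_set UNIV"
  by (simp add: subring_set_def)

lemma subring_set_sum: "subring_set S \<Longrightarrow> (\<And>a. a \<in> A \<Longrightarrow> f a \<in> S) \<Longrightarrow> (\<Sum>a\<in>A. f a) \<in> S"
  by (induction A rule: infinite_finite_induct) (auto intro: subring_setD)

lemma subring_set_prod: "subring_set S \<Longrightarrow> (\<And>a. a \<in> A \<Longrightarrow> f a \<in> S) \<Longrightarrow> (\<Prod>a\<in>A. f a) \<in> S"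
  by (induction A rule: infinite_finite_induct) (auto intro: subring_setD)

lemma hom_onD:
  assumes "hom_on S h" "subring_set S"
  shows "h 0 = 0" "h 1 = 1" "x \<in> S \<Longrightarrow> y \<in> S \<Longrightarrow> h (x + y) = h x + h y"
    "x \<in> S \<Longrightarrow> y \<in> S \<Longrightarrow> h (x * y) = h x * h y" "x \<in> S \<Longrightarrow> h (- x) = - h x"
    "x \<in> S \<Longrightarrow> y \<in> S \<Longrightarrow> h (x - y) = h x - h y" "x \<in> S \<Longrightarrow> h (x ^ n) = h x ^ n"
proof -
  show 1: "h 1 = 1" and a: "\<And>x y. x \<in> S \<Longrightarrow> y \<in> S \<Longrightarrow> h (x + y) = h x + h y"
    and t: "\<And>x y. x \<in> S \<Longrightarrow> y \<in> S \<Longrightarrow> h (x * y) = h x * h y"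
    using assms by (auto simp: hom_on_def)
  show z: "h 0 = 0" using a[of 0 0] assms(2) by (simp add: subring_setD)
  show m: "\<And>x. x \<in> S \<Longrightarrow> h (- x) = - h x"
    using a z assms(2) by (metis add.right_inverse minus_unique subring_setD(3))
  show "x \<in> S \<Longrightarrow> y \<in> S \<Longrightarrow> h (x - y) = h x - h y"
    using a[of x "- y"] m[of y] assms(2) by (simp add: subring_setD)
  show "x \<in> S \<Longrightarrow> h (x ^ n) = h x ^ n"
    by (induction n) (auto simp: 1 t subring_setD[OF assms(2)])
qed

lemma hom_on_sum: "hom_on S h \<Longrightarrow> subring_set S \<Longrightarrow> (\<And>a. a \<in> A \<Longrightarrow> f a \<in> S) \<Longrightarrow> h (\<Sum>a\<in>A. f a) = (\<Sum>a\<in>A. h (f a))"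
  by (induction A rule: infinite_finite_induct) (auto simp: hom_onD subring_set_sum)

lemma hom_on_prod: "hom_on S h \<Longrightarrow> subring_set S \<Longrightarrow> (\<And>a. a \<in> A \<Longrightarrow> f a \<in> S) \<Longrightarrow> h (\<Prod>a\<in>A. f a) = (\<Prod>a\<in>A. h (f a))"
  by (induction A rule: infinite_finite_induct) (auto simp: hom_onD subring_set_prod)

lemma hom_on_comp: "hom_on S h \<Longrightarrow> (\<And>x. x \<in> S \<Longrightarrow> h x \<in> T) \<Longrightarrow> hom_on T g \<Longrightarrow> hom_on S (\<lambda>x. g (h x))"
  by (simp add: hom_on_def)

lemma poly_in_subring:
  assumes "subring_set S" "\<And>i. coeff p i \<in> S" "u \<in> S"
  shows "poly p u \<in> S"
  unfolding poly_altdef using assms by (intro subring_set_sum subring_setD)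

lemma poly_map_poly_sum:
  fixes u :: "'b::comm_ring_1"
  assumes "h 0 = 0"
  shows "poly (map_poly h p) u = (\<Sum>i\<le>degree p. h (coeff p i) * u ^ i)"
  unfolding poly_altdef using assms map_poly_degree_leq[of h p]
  by (intro sum.mono_neutral_cong_left) (auto intro!: le_degree simp: coeff_map_poly)

lemma hom_on_poly:
  assumes "hom_on S h" "subring_set S" "\<And>i. coeff p i \<in> S" "u \<in> S"
  shows "h (poly p u) = poly (map_poly h p) (h u)"
  unfolding poly_altdef[of p] using assms
  by (subst hom_on_sum[of S]) (auto simp: hom_onD subring_setD poly_map_poly_sum)

section \<open>Evaluation of multivariate polynomials\<close>

text \<open>
  Evaluation along an arbitrary coefficient map: besides points over the algebraic closure, the
  values include power series (arcs) and polynomials in one variable (tangent directions).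
\<close>
definition mpeval :: "('a::field \<Rightarrow> 'b::comm_ring_1) \<Rightarrow> 'a mpoly \<Rightarrow> (nat \<Rightarrow> 'b) \<Rightarrow> 'b" where
  "mpeval h p x = (\<Sum>m\<in>Poly_Mapping.keys p. h (Poly_Mapping.lookup p m) *
        (\<Prod>i\<in>Poly_Mapping.keys m. x i ^ Poly_Mapping.lookup m i))"

lemma eval_ac_mpeval: "eval_ac = mpeval to_ac"
  by (intro ext) (simp add: eval_ac_def mpeval_def)

lemma mpeval_hom:
  assumes "hom_on S g" "subring_set S" "\<And>c. h c \<in> S" "\<And>i. x i \<in> S"
  shows "mpeval h p x \<in> S" "g (mpeval h p x) = mpeval (\<lambda>c. g (h c)) p (\<lambda>i. g (x i))"
  unfolding mpeval_def using assms
  by (auto intro!: subring_set_sum subring_set_prod subring_setD 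
      simp: hom_on_sum[of S g] hom_on_prod[of S g] hom_onD[of S g] subring_setD subring_set_prod)

lemma mpeval_in_subring:
  assumes "subring_set S" "\<And>c. h c \<in> S" "\<And>i. x i \<in> S"
  shows "mpeval h p x \<in> S" 
  by (rule mpeval_hom[of S id]) (use assms in \<open>auto simp: hom_on_def\<close>)

lemma mpeval_superset:
  assumes "finite A" "Poly_Mapping.keys p \<subseteq> A" "h 0 = 0"
  shows "mpeval h p x = (\<Sum>m\<in>A. h (Poly_Mapping.lookup p m) *
        (\<Prod>i\<in>Poly_Mapping.keys m. x i ^ Poly_Mapping.lookup m i))"
  unfolding mpeval_def using assms
  by (intro sum.mono_neutral_left) (auto simp: in_keys_iff)

lemma mpeval_add:
  assumes "hom_on UNIV h"
  shows "mpeval h (p + q) x = mpeval h p x + mpeval h q x"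
proof -
  have h0: "h 0 = 0" using hom_onD[OF assms] by simp
  let ?A = "Poly_Mapping.keys p \<union> Poly_Mapping.keys q"
  have "mpeval h (p + q) x = (\<Sum>m\<in>?A. h (Poly_Mapping.lookup (p + q) m) *
        (\<Prod>i\<in>Poly_Mapping.keys m. x i ^ Poly_Mapping.lookup m i))"
    by (rule mpeval_superset) (use h0 Poly_Mapping.keys_add[of p q] in auto)
  moreover have "mpeval h p x = (\<Sum>m\<in>?A. h (Poly_Mapping.lookup p m) *
        (\<Prod>i\<in>Poly_Mapping.keys m. x i ^ Poly_Mapping.lookup m i))"
    by (rule mpeval_superset) (use h0 in auto)
  moreover have "mpeval h q x = (\<Sum>m\<in>?A. h (Poly_Mapping.lookup q m) *
        (\<Prod>i\<in>Poly_Mapping.keys m. x i ^ Poly_Mapping.lookup m i))"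
    by (rule mpeval_superset) (use h0 in auto)
  ultimately show ?thesis
    using hom_onD[OF assms] by (simp add: lookup_add sum.distrib algebra_simps)
qed

lemma mpeval_0 [simp]: "mpeval h 0 x = 0"
  by (simp add: mpeval_def)

lemma mpeval_sum:
  assumes "hom_on UNIV h"
  shows "mpeval h (\<Sum>a\<in>A. f a) x = (\<Sum>a\<in>A. mpeval h (f a) x)"
  by (induction A rule: infinite_finite_induct) (auto simp: mpeval_add assms)

definition moneval :: "(nat \<Rightarrow> 'b::comm_ring_1) \<Rightarrow> (nat \<Rightarrow>\<^sub>0 nat) \<Rightarrow> 'b" where
  "moneval x m = (\<Prod>i\<in>Poly_Mapping.keys m. x i ^ Poly_Mapping.lookup m i)"

lemma moneval_superset:
  assumes "finite A" "Poly_Mapping.keys m \<subseteq> A"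
  shows "moneval x m = (\<Prod>i\<in>A. x i ^ Poly_Mapping.lookup m i)"
  unfolding moneval_def using assms
  by (intro prod.mono_neutral_left) (auto simp: in_keys_iff)

lemma moneval_add: "moneval x (m + m') = moneval x m * moneval x m'"
proof -
  let ?A = "Poly_Mapping.keys m \<union> Poly_Mapping.keys m'"
  show ?thesis
    using Poly_Mapping.keys_add[of m m']
    by (simp add: moneval_superset[of ?A] lookup_add power_add prod.distrib)
qed

lemma mpeval_single:
  assumes "h 0 = 0"
  shows "mpeval h (Poly_Mapping.single m c) x = h c * moneval x m"
  using assms by (cases "c = 0") (simp_all add: mpeval_def moneval_def)

lemma mpoly_sum_monomials: "p = (\<Sum>m\<in>Poly_Mapping.keys p. Poly_Mapping.single m (Poly_Mapping.lookup p m))"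
  by (rule poly_mapping_eqI)
    (simp add: lookup_sum lookup_single when_def in_keys_iff)

lemma mpeval_mult:
  assumes "hom_on UNIV h"
  shows "mpeval h (p * q) x = mpeval h p x * mpeval h q x"
proof -
  note h = hom_onD[OF assms subring_set_UNIV]
  have "p * q = (\<Sum>m\<in>Poly_Mapping.keys p. \<Sum>m'\<in>Poly_Mapping.keys q.
      Poly_Mapping.single (m + m') (Poly_Mapping.lookup p m * Poly_Mapping.lookup q m'))"
    by (subst mpoly_sum_monomials[of p], subst mpoly_sum_monomials[of q])
      (simp add: sum_product mult_single)
  also have "mpeval h \<dots> x = (\<Sum>m\<in>Poly_Mapping.keys p. \<Sum>m'\<in>Poly_Mapping.keys q.
      h (Poly_Mapping.lookup p m) * moneval x m * (h (Poly_Mapping.lookup q m') * moneval x m'))"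
    by (simp add: mpeval_sum assms mpeval_single h moneval_add mult_ac)
  finally show ?thesis
    by (simp add: mpeval_def moneval_def sum_product)
qed

lemma mpeval_uminus:
  assumes "hom_on UNIV h"
  shows "mpeval h (- p) x = - mpeval h p x"
  using mpeval_add[OF assms, of p "- p"] by (simp add: add_eq_0_iff)

lemma mpeval_diff:
  assumes "hom_on UNIV h"
  shows "mpeval h (p - q) x = mpeval h p x - mpeval h q x"
  using mpeval_add[OF assms, of p "- q"] by (simp add: mpeval_uminus assms)

lemma mpeval_power:
  assumes "hom_on UNIV h"
  shows "mpeval h (p ^ n) x = mpeval h p x ^ n"
proof (induction n)
  case 0
  have "mpeval h (Poly_Mapping.single 0 1) x = 1"
    using assms by (simp add: mpeval_single hom_onD moneval_def del: single_one)
  then show ?case by simp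
qed (simp add: mpeval_mult assms)

definition mconst :: "'a::field \<Rightarrow> 'a mpoly" where "mconst c = Poly_Mapping.single 0 c"
definition mvar :: "nat \<Rightarrow> 'a::field mpoly" where "mvar i = Poly_Mapping.single (Poly_Mapping.single i 1) 1"

lemma mpeval_mconst: "hom_on UNIV h \<Longrightarrow> mpeval h (mconst c) x = h c"
  by (simp add: mconst_def mpeval_single hom_onD moneval_def)

lemma mpeval_mvar: "hom_on UNIV h \<Longrightarrow> mpeval h (mvar i) x = x i"
  by (simp add: mvar_def mpeval_single hom_onD moneval_def)

lemma poly_ring_subring: "subring_set (poly_ring n)"
  unfolding subring_set_def
proof (intro conjI ballI)
  fix p q :: "'a::field mpoly" assume pq: "p \<in> poly_ring n" "q \<in> poly_ring n"
  show "p + q \<in> poly_ring n"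
    using pq Poly_Mapping.keys_add[of p q] unfolding poly_ring_def by blast
  show "p * q \<in> poly_ring n"
    unfolding poly_ring_def
  proof safe
    fix m i assume "m \<in> Poly_Mapping.keys (p * q)" "i \<in> Poly_Mapping.keys m"
    then obtain a b where "m = a + b" "a \<in> Poly_Mapping.keys p" "b \<in> Poly_Mapping.keys q"
      using Poly_Mapping.keys_mult[of p q] by auto
    then show "i < n"
      using pq \<open>i \<in> _\<close> Poly_Mapping.keys_add[of a b] unfolding poly_ring_def by blast
  qed
qed (auto simp: poly_ring_def)

lemma mconst_poly_ring [simp]: "mconst c \<in> poly_ring n"
  by (simp add: poly_ring_def mconst_def)

lemma mvar_poly_ring [simp]: "i < n \<Longrightarrow> mvar i \<in> poly_ring n"
  by (simp add: poly_ring_def mvar_def)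

lemma mpeval_cong:
  assumes "p \<in> poly_ring n" "\<And>i. i < n \<Longrightarrow> x i = y i"
  shows "mpeval h p x = mpeval h p y"
  unfolding mpeval_def
proof (intro sum.cong refl arg_cong2[where f = "(*)"] prod.cong)
  fix m i assume "m \<in> Poly_Mapping.keys p" "i \<in> Poly_Mapping.keys m"
  then have "i < n" using assms(1) by (auto simp: poly_ring_def)
  then show "x i ^ Poly_Mapping.lookup m i = y i ^ Poly_Mapping.lookup m i" using assms(2) by simp
qed

lemma subring_set_mpeval_image:
  assumes "hom_on UNIV h"
  shows "subring_set ((\<lambda>p. mpeval h p x) ` poly_ring n)"
proof -
  note P = subring_setD[OF poly_ring_subring]
  show ?thesis
    unfolding subring_set_def
  proof (intro conjI ballI; (elim imageE)?; hypsubst?)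
    show "1 \<in> (\<lambda>p. mpeval h p x) ` poly_ring n"
      by (rule image_eqI[of _ _ "mconst 1"]) (use assms in \<open>auto simp: mpeval_mconst hom_on_def\<close>)
  qed (auto simp flip: mpeval_uminus[OF assms] mpeval_add[OF assms] mpeval_mult[OF assms] intro!: imageI P)
qed

section \<open>Derivations and the chain rule\<close>

definition derivation :: "('a \<Rightarrow> 'b::comm_ring_1) \<Rightarrow> ('b \<Rightarrow> 'b) \<Rightarrow> bool" where
  "derivation h D \<longleftrightarrow> (\<forall>c. D (h c) = 0) \<and> (\<forall>x y. D (x + y) = D x + D y) \<and> (\<forall>x y. D (x * y) = D x * y + x * D y)"

lemma derivation_sum: "derivation h D \<Longrightarrow> D 0 = 0 \<Longrightarrow> D (\<Sum>a\<in>A. f a) = (\<Sum>a\<in>A. D (f a))"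
  by (induction A rule: infinite_finite_induct) (auto simp: derivation_def)

lemma derivation_power: "derivation h D \<Longrightarrow> D 1 = 0 \<Longrightarrow> D (x ^ n) = of_nat n * x ^ (n - 1) * D x"
proof (induction n)
  case (Suc n)
  then show ?case
    by (cases n) (auto simp: derivation_def algebra_simps)
qed simp

lemma derivation_prod: "derivation h D \<Longrightarrow> D 1 = 0 \<Longrightarrow> finite A \<Longrightarrow>
  D (\<Prod>a\<in>A. f a) = (\<Sum>a\<in>A. D (f a) * (\<Prod>b\<in>A - {a}. f b))"
proof (induction A rule: infinite_finite_induct)
  case (insert a A)
  have "(\<Sum>b\<in>A. D (f b) * prod f (insert a A - {b})) = (\<Sum>b\<in>A. D (f b) * (f a * prod f (A - {b})))"
  proof (intro sum.cong refl)
    fix b assume "b \<in> A"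
    then have "insert a A - {b} = insert a (A - {b})" using insert by auto
    then show "D (f b) * prod f (insert a A - {b}) = D (f b) * (f a * prod f (A - {b}))"
      using insert by simp
  qed
  moreover have "insert a A - {a} = A" using insert by auto
  ultimately show ?case using insert 
    by (simp add: derivation_def sum_distrib_left mult_ac)
qed simp_all

lemma mpeval_partial_deriv:
  assumes "hom_on UNIV h"
  shows "mpeval h (partial_deriv i p) x = (\<Sum>m\<in>Poly_Mapping.keys p. h (of_nat (Poly_Mapping.lookup m i) * Poly_Mapping.lookup p m) *
    moneval x (m - Poly_Mapping.single i 1))"
  using assms by (simp add: partial_deriv_def mpeval_sum mpeval_single hom_onD)

text \<open>
  The chain rule.  It is applied to \<open>d/ds\<close> on power series and to the derivative of polynomials in an
  auxiliary variable; both times it replaces a direct computation with partial derivatives.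
\<close>
lemma derivation_mpeval:
  assumes h: "hom_on UNIV h" and D: "derivation h D" and p: "p \<in> poly_ring n"
  shows "D (mpeval h p x) = (\<Sum>i<n. mpeval h (partial_deriv i p) x * D (x i))"
proof -
  note hh = hom_onD[OF h subring_set_UNIV]
  have D1: "D 1 = 0" using D hh(2) by (metis derivation_def)
  have D0: "D 0 = 0" using D hh(1) by (metis derivation_def)
  have hnat: "h (of_nat k) = of_nat k" for k by (induction k) (auto simp: hh)
  have mon: "D (moneval x m) = (\<Sum>i<n. of_nat (Poly_Mapping.lookup m i) * moneval x (m - Poly_Mapping.single i 1) * D (x i))"
    if "m \<in> Poly_Mapping.keys p" for m
  proof -
    have k: "Poly_Mapping.keys m \<subseteq> {..<n}" using p that by (auto simp: poly_ring_def)
    have k': "Poly_Mapping.keys (m - Poly_Mapping.single i 1) \<subseteq> {..<n}" for i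
    proof
      fix j assume "j \<in> Poly_Mapping.keys (m - Poly_Mapping.single i 1)"
      then have "j \<in> Poly_Mapping.keys m" by (auto simp: in_keys_iff lookup_minus)
      then show "j \<in> {..<n}" using k by auto
    qed
    have "D (moneval x m) = (\<Sum>i<n. D (x i ^ Poly_Mapping.lookup m i) * (\<Prod>j\<in>{..<n}-{i}. x j ^ Poly_Mapping.lookup m j))"
      by (subst moneval_superset[OF _ k], simp, subst derivation_prod[OF D D1], auto)
    also have "\<dots> = (\<Sum>i<n. of_nat (Poly_Mapping.lookup m i) * moneval x (m - Poly_Mapping.single i 1) * D (x i))"
    proof (intro sum.cong refl)
      fix i assume i: "i \<in> {..<n}"
      have "moneval x (m - Poly_Mapping.single i 1) = (\<Prod>j<n. x j ^ Poly_Mapping.lookup (m - Poly_Mapping.single i 1) j)"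
        by (rule moneval_superset[OF _ k']) simp
      also have "\<dots> = x i ^ (Poly_Mapping.lookup m i - 1) * (\<Prod>j\<in>{..<n}-{i}. x j ^ Poly_Mapping.lookup m j)"
        using i by (subst prod.remove[of _ i]) (auto simp: lookup_minus lookup_single when_def intro!: prod.cong)
      finally show "D (x i ^ Poly_Mapping.lookup m i) * (\<Prod>j\<in>{..<n}-{i}. x j ^ Poly_Mapping.lookup m j)
         = of_nat (Poly_Mapping.lookup m i) * moneval x (m - Poly_Mapping.single i 1) * D (x i)"
        by (simp add: derivation_power[OF D D1] mult_ac)
    qed
    finally show ?thesis .
  qed
  have "D (mpeval h p x) = (\<Sum>m\<in>Poly_Mapping.keys p. D (h (Poly_Mapping.lookup p m) * moneval x m))"
    unfolding mpeval_def moneval_def by (rule derivation_sum[OF D D0])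
  also have "\<dots> = (\<Sum>m\<in>Poly_Mapping.keys p. h (Poly_Mapping.lookup p m) * D (moneval x m))"
    using D by (simp add: derivation_def)
  also have "\<dots> = (\<Sum>m\<in>Poly_Mapping.keys p. \<Sum>i<n. h (of_nat (Poly_Mapping.lookup m i) * Poly_Mapping.lookup p m) *
    moneval x (m - Poly_Mapping.single i 1) * D (x i))"
    by (intro sum.cong refl) (simp add: mon sum_distrib_left hh hnat mult_ac)
  also have "\<dots> = (\<Sum>i<n. mpeval h (partial_deriv i p) x * D (x i))"
    by (subst sum.swap) (simp add: mpeval_partial_deriv[OF h] sum_distrib_right)
  finally show ?thesis .
qed

section \<open>Simple algebraic extensions of subrings\<close>

definition coeffs_in :: "'b::comm_ring_1 set \<Rightarrow> 'b poly \<Rightarrow> bool" where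
  "coeffs_in S p \<longleftrightarrow> (\<forall>i. coeff p i \<in> S)"

lemma coeffs_in:
  assumes "subring_set S"
  shows "coeffs_in S 0" "coeffs_in S 1" "coeffs_in S p \<Longrightarrow> coeffs_in S q \<Longrightarrow> coeffs_in S (p + q)"
    "coeffs_in S p \<Longrightarrow> coeffs_in S q \<Longrightarrow> coeffs_in S (p - q)"
    "coeffs_in S p \<Longrightarrow> coeffs_in S (- p)"
    "coeffs_in S p \<Longrightarrow> coeffs_in S q \<Longrightarrow> coeffs_in S (p * q)"
    "c \<in> S \<Longrightarrow> coeffs_in S p \<Longrightarrow> coeffs_in S (Polynomial.smult c p)"
    "c \<in> S \<Longrightarrow> coeffs_in S (monom c n)"
    "coeffs_in S [:c:] \<longleftrightarrow> c \<in> S"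
    "c \<in> S \<Longrightarrow> coeffs_in S p \<Longrightarrow> coeffs_in S (pCons c p)"
  using subring_setD[OF assms]
  by (auto intro!: subring_set_sum[OF assms] simp: coeffs_in_def coeff_mult coeff_pCons Polynomial.coeff_1 split: nat.splits)

lemma coeffs_in_coeff: "coeffs_in S p \<Longrightarrow> coeff p i \<in> S"
  by (simp add: coeffs_in_def)

definition adj :: "'b::comm_ring_1 set \<Rightarrow> 'b \<Rightarrow> 'b set" where
  "adj S u = {poly p u | p. coeffs_in S p}"

definition alg_over :: "'b::comm_ring_1 set \<Rightarrow> 'b \<Rightarrow> bool" where
  "alg_over S u \<longleftrightarrow> (\<exists>p. p \<noteq> 0 \<and> coeffs_in S p \<and> poly p u = 0)"

lemma alg_over_mono: "alg_over S u \<Longrightarrow> S \<subseteq> T \<Longrightarrow> alg_over T u"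
  unfolding alg_over_def coeffs_in_def by blast

lemma subring_adj:
  assumes "subring_set S"
  shows "subring_set (adj S u)"
  unfolding subring_set_def adj_def
proof (intro conjI ballI; (elim CollectE exE conjE)?; hypsubst?)
  show "1 \<in> {poly p u |p. coeffs_in S p}"
    by (rule CollectI, rule exI[of _ 1]) (use coeffs_in[OF assms] in auto)
next
  fix p assume "coeffs_in S p"
  then show "- poly p u \<in> {poly p u |p. coeffs_in S p}"
    by (intro CollectI exI[of _ "- p"]) (use coeffs_in[OF assms] in auto)
next
  fix p q assume "coeffs_in S p" "coeffs_in S q"
  then show "poly p u + poly q u \<in> {poly p u |p. coeffs_in S p}"
    by (intro CollectI exI[of _ "p + q"]) (use coeffs_in[OF assms] in auto)
next
  fix p q assume "coeffs_in S p" "coeffs_in S q"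
  then show "poly p u * poly q u \<in> {poly p u |p. coeffs_in S p}"
    by (intro CollectI exI[of _ "p * q"]) (use coeffs_in[OF assms] in auto)
qed

lemma adj_base: "subring_set S \<Longrightarrow> S \<subseteq> adj S u"
  unfolding adj_def
proof
  fix x assume "subring_set S" "x \<in> S"
  then show "x \<in> {poly p u |p. coeffs_in S p}"
    by (intro CollectI exI[of _ "[:x:]"]) (auto simp: coeffs_in(9))
qed

lemma adj_gen: 
  assumes "subring_set S"
  shows "u \<in> adj S u"
  unfolding adj_def
  by (intro CollectI exI[of _ "[:0, 1:]"])
    (use subring_setD[OF assms] in \<open>auto intro!: coeffs_in[OF assms]\<close>)

lemma adj_least: 
  assumes "subring_set T" "S \<subseteq> T" "u \<in> T"
  shows "adj S u \<subseteq> T"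
  using assms by (auto simp: adj_def coeffs_in_def intro!: poly_in_subring[of T])

text \<open>
  Division with remainder, made fraction-free because the coefficients are confined to a subring.
\<close>
lemma pseudo_division_in:
  fixes A B :: "'b::idom poly"
  assumes S: "subring_set S" and B: "coeffs_in S B" "B \<noteq> 0" and A: "coeffs_in S A"
  shows "\<exists>e Q R. coeffs_in S Q \<and> coeffs_in S R \<and> Polynomial.smult (lead_coeff B ^ e) A = B * Q + R \<and>
    (R = 0 \<or> degree R < degree B)"
  using A
proof (induction "degree A" arbitrary: A rule: less_induct)
  case less
  show ?case
  proof (cases "A = 0 \<or> degree A < degree B")
    case True
    then show ?thesis using less.prems coeffs_in(1)[OF S]
      by (intro exI[of _ 0] exI[of _ A]) auto
  next
    case False
    let ?l = "lead_coeff B"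
    define k where "k = degree A - degree B"
    define C where "C = monom (lead_coeff A) k"
    define A' where "A' = Polynomial.smult ?l A - C * B"
    have l: "?l \<in> S" "?l \<noteq> 0" using B by (auto simp: coeffs_in_def)
    have C: "coeffs_in S C" unfolding C_def using less.prems by (intro coeffs_in(8)[OF S]) (auto simp: coeffs_in_def)
    have A': "coeffs_in S A'" unfolding A'_def using less.prems B l C by (intro coeffs_in(4,6,7)[OF S]) auto
    have deg: "degree (C * B) = degree A" "C \<noteq> 0"
      using False B by (auto simp: C_def k_def degree_mult_eq degree_monom_eq monom_eq_0_iff)
    have "coeff A' (degree A) = 0"
      using False by (simp add: A'_def C_def coeff_monom_mult k_def)
    moreover have "degree A' \<le> degree A"
      unfolding A'_def using deg by (intro degree_diff_le) auto
    ultimately have d: "A' = 0 \<or> degree A' < degree A"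
      by (metis leading_coeff_0_iff le_neq_implies_less)
    have "\<exists>e Q R. coeffs_in S Q \<and> coeffs_in S R \<and> Polynomial.smult (?l ^ e) A' = B * Q + R \<and>
      (R = 0 \<or> degree R < degree B)"
      using d
    proof
      assume "A' = 0"
      then show ?thesis using coeffs_in(1)[OF S] by (intro exI[of _ 0]) auto
    qed (use less.hyps A' in blast)
    then obtain e Q R where Q: "coeffs_in S Q" "coeffs_in S R" "Polynomial.smult (?l ^ e) A' = B * Q + R"
      "R = 0 \<or> degree R < degree B" by blast
    have "Polynomial.smult (?l ^ Suc e) A = B * (Q + Polynomial.smult (?l ^ e) C) + R"
      using Q(3) by (simp add: A'_def algebra_simps smult_diff_right)
    moreover have "coeffs_in S (Q + Polynomial.smult (?l ^ e) C)"
      using Q C l by (intro coeffs_in(3,7)[OF S] subring_setD(7)[OF S]) auto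
    ultimately show ?thesis using Q by blast
  qed
qed

lemma minimal_polynomial_over:
  assumes "alg_over S u"
  obtains P where "P \<noteq> 0" "coeffs_in S P" "poly P u = 0"
    "\<And>Q. Q \<noteq> 0 \<Longrightarrow> coeffs_in S Q \<Longrightarrow> poly Q u = 0 \<Longrightarrow> degree P \<le> degree Q"
proof -
  let ?X = "\<lambda>p. p \<noteq> 0 \<and> coeffs_in S p \<and> poly p u = 0"
  obtain p where "?X p" using assms by (auto simp: alg_over_def)
  from ex_has_least_nat[of ?X, OF this, of degree] show ?thesis
    using that by blast
qed

text \<open>
  In an algebraic extension a nonzero element \<open>D = G(u)\<close> divides a nonzero element of the base: a
  nonzero element of minimal degree in the ideal of \<open>G\<close> and the minimal polynomial divides both up to
  constants, so it cannot vanish at \<open>u\<close>, and by minimality of \<open>P\<close> it is constant.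
\<close>
lemma adj_divides_base:
  fixes u :: "'b::idom"
  assumes S: "subring_set S" and P: "P \<noteq> 0" "coeffs_in S P" "poly P u = 0"
    "\<And>Q. Q \<noteq> 0 \<Longrightarrow> coeffs_in S Q \<Longrightarrow> poly Q u = 0 \<Longrightarrow> degree P \<le> degree Q"
    and D: "D \<in> adj S u" "D \<noteq> 0"
  shows "\<exists>w\<in>adj S u. D * w \<in> S \<and> D * w \<noteq> 0"
proof -
  obtain G where G: "coeffs_in S G" "D = poly G u" using D by (auto simp: adj_def)
  let ?X = "\<lambda>M. M \<noteq> 0 \<and> (\<exists>B A. coeffs_in S B \<and> coeffs_in S A \<and> M = B * G + A * P)"
  note c = coeffs_in[OF S]
  have "G \<noteq> 0" using D G by auto
  then have "?X G" using c(1,2) by (intro conjI exI[of _ 1] exI[of _ 0]) auto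
  from ex_has_least_nat[of ?X, OF this, of degree] obtain M B A where
    M: "M \<noteq> 0" "coeffs_in S B" "coeffs_in S A" "M = B * G + A * P"
    and min: "\<And>N. ?X N \<Longrightarrow> degree M \<le> degree N" by blast
  have cM: "coeffs_in S M" using M(2,3) G(1) P(2) unfolding M(4) by (intro c(3,6))
  have dvd: "\<exists>e Q. coeffs_in S Q \<and> Polynomial.smult (lead_coeff M ^ e) F = M * Q"
    if F: "coeffs_in S F" "\<exists>B A. coeffs_in S B \<and> coeffs_in S A \<and> F = B * G + A * P" for F
  proof -
    obtain e Q R where R: "coeffs_in S Q" "coeffs_in S R" "Polynomial.smult (lead_coeff M ^ e) F = M * Q + R"
      "R = 0 \<or> degree R < degree M"
      using pseudo_division_in[OF S cM M(1) F(1)] by blast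
    obtain B' A' where F': "coeffs_in S B'" "coeffs_in S A'" "F = B' * G + A' * P" using F by blast
    let ?l = "lead_coeff M ^ e"
    have "R = (Polynomial.smult ?l B' - B * Q) * G + (Polynomial.smult ?l A' - A * Q) * P"
      using R(3) F'(3) M(4) by (simp add: algebra_simps smult_add_right)
    moreover have "?l \<in> S" using cM by (intro subring_setD(7)[OF S] coeffs_in_coeff)
    then have "coeffs_in S (Polynomial.smult ?l B' - B * Q)" "coeffs_in S (Polynomial.smult ?l A' - A * Q)"
      using F' M(2,3) R(1) by (auto intro: c(4,6,7))
    ultimately have "\<exists>B A. coeffs_in S B \<and> coeffs_in S A \<and> R = B * G + A * P"
      by (intro exI conjI)
    then have "R \<noteq> 0 \<Longrightarrow> ?X R" by (rule conjI[rotated])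
    then have "R = 0" using R(4) min[of R] by (cases "R = 0") force+
    then show ?thesis using R by auto
  qed
  have "\<exists>B A. coeffs_in S B \<and> coeffs_in S A \<and> P = B * G + A * P"
    by (rule exI[of _ 0], rule exI[of _ 1]) (simp add: c(1,2))
  from dvd[OF P(2) this]
  obtain e Q where Q: "coeffs_in S Q" "Polynomial.smult (lead_coeff M ^ e) P = M * Q"
    by blast
  have "\<exists>B A. coeffs_in S B \<and> coeffs_in S A \<and> G = B * G + A * P"
    by (rule exI[of _ 1], rule exI[of _ 0]) (simp add: c(1,2))
  from dvd[OF G(1) this]
  obtain e' Q' where Q': "coeffs_in S Q'" "Polynomial.smult (lead_coeff M ^ e') G = M * Q'"
    by blast
  have "poly M u \<noteq> 0"
  proof
    assume "poly M u = 0"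
    then have "lead_coeff M ^ e' * poly G u = 0"
      using arg_cong[OF Q'(2), of "\<lambda>q. poly q u"] by simp
    then show False using M(1) G D by (metis leading_coeff_0_iff mult_eq_0_iff power_not_zero)
  qed
  moreover have "poly M u * poly Q u = 0"
    using arg_cong[OF Q(2), of "\<lambda>q. poly q u"] P by simp
  ultimately have "poly Q u = 0" by simp
  have "Polynomial.smult (lead_coeff M ^ e) P \<noteq> 0" using M(1) P(1)
    by (metis leading_coeff_0_iff power_not_zero smult_eq_0_iff)
  then have "Q \<noteq> 0" using Q(2) by auto
  have "degree P = degree M + degree Q"
    using arg_cong[OF Q(2), of degree] M(1) \<open>Q \<noteq> 0\<close> by (simp add: degree_mult_eq)
  with P(4)[OF \<open>Q \<noteq> 0\<close> Q(1) \<open>poly Q u = 0\<close>] have "degree M = 0" by simp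
  then obtain m where m: "M = [:m:]" by (rule degree_eq_zeroE)
  have "m \<in> S" "m \<noteq> 0" using cM M(1) unfolding m c(9) by auto
  moreover have "D * poly B u = m"
    using arg_cong[OF M(4), of "\<lambda>q. poly q u"] P(3) unfolding m G(2) by (simp add: mult.commute)
  moreover have "poly B u \<in> adj S u" using M(2) unfolding adj_def by blast
  ultimately show ?thesis by (intro bexI[of _ "poly B u"]) auto
qed

lemma hom_on_map_poly:
  assumes "hom_on S h" "subring_set S" 
  shows "coeffs_in S p \<Longrightarrow> coeffs_in S q \<Longrightarrow> map_poly h (p + q) = map_poly h p + map_poly h q"
    "coeffs_in S p \<Longrightarrow> coeffs_in S q \<Longrightarrow> map_poly h (p - q) = map_poly h p - map_poly h q"
    "coeffs_in S p \<Longrightarrow> coeffs_in S q \<Longrightarrow> map_poly h (p * q) = map_poly h p * map_poly h q"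
    "c \<in> S \<Longrightarrow> coeffs_in S q \<Longrightarrow> map_poly h (Polynomial.smult c q) = Polynomial.smult (h c) (map_poly h q)"
  using hom_onD[OF assms] coeffs_in_coeff[of S] 
  by (auto intro!: poly_eqI simp: coeff_map_poly coeff_mult hom_on_sum[OF assms] subring_setD[OF assms(2)])

text \<open>
  A homomorphism into an algebraically closed field extends by sending \<open>u\<close> to a root of the image of
  its minimal polynomial.  If the leading coefficient survives, that root exists and the extension is
  well defined, since every relation satisfied by \<open>u\<close> is a multiple of \<open>P\<close> up to a power of the
  leading coefficient.
\<close>
lemma hom_extends_to_adj:
  fixes u :: "'b::idom" and h :: "'b \<Rightarrow> 'f::alg_closed_field"
  assumes S: "subring_set S" and P: "P \<noteq> 0" "coeffs_in S P" "poly P u = 0"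
    "\<And>Q. Q \<noteq> 0 \<Longrightarrow> coeffs_in S Q \<Longrightarrow> poly Q u = 0 \<Longrightarrow> degree P \<le> degree Q"
    and h: "hom_on S h" "h (lead_coeff P) \<noteq> 0"
  shows "\<exists>h'. hom_on (adj S u) h' \<and> (\<forall>x\<in>S. h' x = h x)"
proof -
  note c = coeffs_in[OF S] and hh = hom_onD[OF h(1) S] and hm = hom_on_map_poly[OF h(1) S]
  have h0: "h 0 = 0" by (rule hh)
  have "degree P \<noteq> 0"
  proof
    assume "degree P = 0"
    then show False by (rule degree_eq_zeroE) (use P(1,3) in auto)
  qed
  moreover have "degree (map_poly h P) = degree P"
    using h by (intro map_poly_degree_eq) auto
  ultimately obtain y where y: "poly (map_poly h P) y = 0"
    using alg_closed_imp_poly_has_root[of "map_poly h P"] by auto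
  have zero: "poly (map_poly h G) y = 0" if G: "coeffs_in S G" "poly G u = 0" for G
  proof -
    obtain e Q R where R: "coeffs_in S Q" "coeffs_in S R" "Polynomial.smult (lead_coeff P ^ e) G = P * Q + R"
      "R = 0 \<or> degree R < degree P"
      using pseudo_division_in[OF S P(2,1) G(1)] by blast
    have "poly R u = 0" using arg_cong[OF R(3), of "\<lambda>q. poly q u"] P G by simp
    then have "R = 0" using R P(4)[of R] by force
    have l: "lead_coeff P \<in> S" using P by (simp add: coeffs_in_def)
    have "Polynomial.smult (h (lead_coeff P) ^ e) (map_poly h G) = map_poly h P * map_poly h Q"
      using arg_cong[OF R(3)[unfolded \<open>R = 0\<close> add_0_right], of "map_poly h"] G P R(1) l by (simp add: hm hh subring_setD[OF S] del: )
    from arg_cong[OF this, of "\<lambda>q. poly q y"] y h show ?thesis by simp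
  qed
  define g where "g v = poly (map_poly h (SOME G. coeffs_in S G \<and> poly G u = v)) y" for v
  have g: "g (poly G u) = poly (map_poly h G) y" if G: "coeffs_in S G" for G
  proof -
    let ?F = "SOME F. coeffs_in S F \<and> poly F u = poly G u"
    have F: "coeffs_in S ?F \<and> poly ?F u = poly G u" by (rule someI[of _ G]) (use G in simp)
    have "poly (map_poly h (?F - G)) y = 0" by (rule zero) (use F G c in auto)
    then show ?thesis using F G by (simp add: hm g_def)
  qed
  have gS: "g x = h x" if "x \<in> S" for x
    using g[of "[:x:]"] that by (simp add: c map_poly_pCons h0)
  have "hom_on (adj S u) g"
    unfolding hom_on_def
  proof (intro conjI ballI)
    show "g 1 = 1" using gS[of 1] subring_setD[OF S] hh by simp
    fix x x' assume "x \<in> adj S u" "x' \<in> adj S u"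
    then obtain G G' where G: "coeffs_in S G" "coeffs_in S G'" "x = poly G u" "x' = poly G' u"
      by (auto simp: adj_def)
    show "g (x + x') = g x + g x'" using g[of "G + G'"] G by (simp add: c g hm)
    show "g (x * x') = g x * g x'" using g[of "G * G'"] G by (simp add: c g hm)
  qed
  then show ?thesis using gS by blast
qed

text \<open>
  A form of Chevalley's theorem that can be iterated along a tower: every nonzero \<open>D\<close> in \<open>T\<close> is
  controlled by a nonzero \<open>E\<close> in \<open>S\<close>.  A homomorphism on \<open>S\<close> that does not kill \<open>E\<close> extends to \<open>T\<close>, and
  since \<open>D\<close> divides \<open>E\<close> the extension does not kill \<open>D\<close>.  The first argument only fixes the target
  field.
\<close>
definition specializes :: "'f::alg_closed_field itself \<Rightarrow> 'b::idom set \<Rightarrow> 'b set \<Rightarrow> bool" where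
  "specializes TF S T \<longleftrightarrow> (\<forall>D\<in>T. D \<noteq> 0 \<longrightarrow> (\<exists>E\<in>S. E \<noteq> 0 \<and> (\<exists>w\<in>T. D * w = E) \<and>
    (\<forall>h :: 'b \<Rightarrow> 'f. hom_on S h \<longrightarrow> h E \<noteq> 0 \<longrightarrow> (\<exists>h'. hom_on T h' \<and> (\<forall>x\<in>S. h' x = h x)))))"

lemma specializesE:
  assumes "specializes TYPE('f::alg_closed_field) S T" "D \<in> T" "D \<noteq> 0"
  obtains E w where "E \<in> S" "E \<noteq> 0" "w \<in> T" "D * w = E"
    "\<And>h :: 'b::idom \<Rightarrow> 'f. hom_on S h \<Longrightarrow> h E \<noteq> 0 \<Longrightarrow> \<exists>h'. hom_on T h' \<and> (\<forall>x\<in>S. h' x = h x)"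
proof -
  from bspec[OF assms(1)[unfolded specializes_def] assms(2)] assms(3)
  obtain E w where "E \<in> S" "E \<noteq> 0" "w \<in> T" "D * w = E" "\<forall>h :: 'b \<Rightarrow> 'f. hom_on S h \<longrightarrow> h E \<noteq> 0 \<longrightarrow> (\<exists>h'. hom_on T h' \<and> (\<forall>x\<in>S. h' x = h x))"
    by (elim impE bexE conjE)
  then show ?thesis using that by simp
qed

lemma specializes_adj:
  fixes u :: "'b::idom"
  assumes S: "subring_set S" and u: "alg_over S u"
  shows "specializes TYPE('f::alg_closed_field) S (adj S u)"
  unfolding specializes_def
proof (intro ballI impI)
  fix D assume D: "D \<in> adj S u" "D \<noteq> 0"
  obtain P where P: "P \<noteq> 0" "coeffs_in S P" "poly P u = 0"
    "\<And>Q. Q \<noteq> 0 \<Longrightarrow> coeffs_in S Q \<Longrightarrow> poly Q u = 0 \<Longrightarrow> degree P \<le> degree Q"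
    using minimal_polynomial_over[OF u] by blast
  let ?l = "lead_coeff P"
  have l: "?l \<in> S" "?l \<noteq> 0" using P by (auto simp: coeffs_in_def)
  obtain w where w: "w \<in> adj S u" "D * w \<in> S" "D * w \<noteq> 0" using adj_divides_base[OF S P D] by blast
  show "\<exists>E\<in>S. E \<noteq> 0 \<and> (\<exists>w\<in>adj S u. D * w = E) \<and>
    (\<forall>h :: 'b \<Rightarrow> 'f. hom_on S h \<longrightarrow> h E \<noteq> 0 \<longrightarrow> (\<exists>h'. hom_on (adj S u) h' \<and> (\<forall>x\<in>S. h' x = h x)))"
  proof (rule bexI[of _ "D * w * ?l"], intro conjI allI impI)
    show "D * w * ?l \<in> S" using subring_setD(5)[OF S] w l by simp
    have "w * ?l \<in> adj S u" using subring_setD(5)[OF subring_adj[OF S] w(1)] l adj_base[OF S] by blast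
    then show "\<exists>w'\<in>adj S u. D * w' = D * w * ?l" by (intro bexI[of _ "w * ?l"]) simp_all
    show "D * w * ?l \<noteq> 0" using w l by simp
    fix h :: "'b \<Rightarrow> 'f" assume h: "hom_on S h" "h (D * w * ?l) \<noteq> 0"
    then have "h ?l \<noteq> 0" using hom_onD[OF h(1) S] w l by auto
    then show "\<exists>h'. hom_on (adj S u) h' \<and> (\<forall>x\<in>S. h' x = h x)"
      using hom_extends_to_adj[OF S P h(1)] by blast
  qed
qed

lemma specializes_trans:
  assumes "specializes TYPE('f::alg_closed_field) S T" "specializes TYPE('f) T U" "S \<subseteq> T" "T \<subseteq> U"
    and T: "subring_set T" and U: "subring_set U"
  shows "specializes TYPE('f) S U"
  unfolding specializes_def
proof (intro ballI impI)
  fix D assume D: "D \<in> U" "D \<noteq> 0"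
  obtain E1 w1 where E1: "E1 \<in> T" "E1 \<noteq> 0" "w1 \<in> U" "D * w1 = E1"
    and h1: "\<And>h. hom_on T (h :: 'a \<Rightarrow> 'f) \<Longrightarrow> h E1 \<noteq> 0 \<Longrightarrow> (\<exists>h'. hom_on U h' \<and> (\<forall>x\<in>T. h' x = h x))"
    by (rule specializesE[OF assms(2) D]) (rule that)
  obtain E w where E: "E \<in> S" "E \<noteq> 0" "w \<in> T" "E1 * w = E"
    and h: "\<And>h. hom_on S (h :: 'a \<Rightarrow> 'f) \<Longrightarrow> h E \<noteq> 0 \<Longrightarrow> (\<exists>h'. hom_on T h' \<and> (\<forall>x\<in>S. h' x = h x))"
    by (rule specializesE[OF assms(1) E1(1,2)]) (rule that)
  show "\<exists>E\<in>S. E \<noteq> 0 \<and> (\<exists>w\<in>U. D * w = E) \<and>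
    (\<forall>h :: 'a \<Rightarrow> 'f. hom_on S h \<longrightarrow> h E \<noteq> 0 \<longrightarrow> (\<exists>h'. hom_on U h' \<and> (\<forall>x\<in>S. h' x = h x)))"
  proof (rule bexI[of _ E], intro conjI allI impI)
    have "w1 * w \<in> U" using subring_setD(5)[OF U E1(3)] E(3) assms(4) by blast
    moreover have "D * (w1 * w) = E" using E(4) E1(4) by (metis mult.assoc)
    ultimately show "\<exists>w\<in>U. D * w = E" by (intro bexI[of _ "w1 * w"])
    fix g :: "'a \<Rightarrow> 'f" assume g: "hom_on S g" "g E \<noteq> 0"
    from h[OF this] obtain g' where g': "hom_on T g'" "\<forall>x\<in>S. g' x = g x" by blast
    have "g' E1 * g' w = g' E" using hom_onD(4)[OF g'(1) T, of E1 w] E E1 by simp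
    then have "g' E1 \<noteq> 0" using g g' E by auto
    then obtain h' where "hom_on U h'" "\<forall>x\<in>T. h' x = g' x" using h1[OF g'(1)] by blast
    then show "\<exists>h'. hom_on U h' \<and> (\<forall>x\<in>S. h' x = g x)"
      using g'(2) assms(3) by (intro exI[of _ h']) auto
  qed (use E in auto)
qed

lemma specializes_refl: "subring_set S \<Longrightarrow> specializes TYPE('f::alg_closed_field) (S :: 'b::idom set) S"
  unfolding specializes_def
proof (intro ballI impI)
  fix D assume D: "subring_set S" "D \<in> S" "D \<noteq> 0"
  have "\<exists>w\<in>S. D * w = D" using subring_setD(2)[OF D(1)] by (intro rev_bexI[of 1]) simp_all
  with D show "\<exists>E\<in>S. E \<noteq> 0 \<and> (\<exists>w\<in>S. D * w = E) \<and>
    (\<forall>h :: 'b \<Rightarrow> 'f. hom_on S h \<longrightarrow> h E \<noteq> 0 \<longrightarrow> (\<exists>h'. hom_on S h' \<and> (\<forall>x\<in>S. h' x = h x)))"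
    by (intro rev_bexI[of D S]) blast+
qed

primrec tower :: "'b::comm_ring_1 set \<Rightarrow> (nat \<Rightarrow> 'b) \<Rightarrow> nat \<Rightarrow> 'b set" where
  "tower S u 0 = S"
| "tower S u (Suc n) = adj (tower S u n) (u n)"

lemma tower_props:
  assumes S: "subring_set S"
  shows "subring_set (tower S u n)" "S \<subseteq> tower S u n" "i < n \<Longrightarrow> u i \<in> tower S u n"
    "subring_set T \<Longrightarrow> S \<subseteq> T \<Longrightarrow> (\<And>i. i < n \<Longrightarrow> u i \<in> T) \<Longrightarrow> tower S u n \<subseteq> T"
proof -
  show 1: "subring_set (tower S u n)" for n by (induction n) (auto simp: S subring_adj)
  show "S \<subseteq> tower S u n" by (induction n) (use adj_base[OF 1] in auto)
  show "i < n \<Longrightarrow> u i \<in> tower S u n" 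
    by (induction n) (auto simp: less_Suc_eq intro: adj_gen[OF 1] subsetD[OF adj_base[OF 1]])
  show "subring_set T \<Longrightarrow> S \<subseteq> T \<Longrightarrow> (\<And>i. i < n \<Longrightarrow> u i \<in> T) \<Longrightarrow> tower S u n \<subseteq> T"
    by (induction n) (simp_all add: adj_least)
qed

lemma specializes_tower:
  assumes S: "subring_set S" and "\<And>i. i < n \<Longrightarrow> alg_over (tower S u i) (u i :: 'b::idom)"
  shows "specializes TYPE('f::alg_closed_field) S (tower S u n)"
  using assms(2)
proof (induction n)
  case (Suc n)
  note t = tower_props[OF S]
  have "specializes TYPE('f) (tower S u n) (adj (tower S u n) (u n))"
    by (rule specializes_adj[OF t(1)]) (use Suc.prems in simp)
  with Suc show ?case
    using specializes_trans[OF _ _ t(2) adj_base[OF t(1)] t(1) subring_adj[OF t(1)]] by simp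
qed (simp add: specializes_refl S)

section \<open>Evaluation of bivariate polynomials\<close>

text \<open>
  A polynomial over \<open>K[t]\<close>, with the value \<open>s\<close> for \<open>t\<close> and the value \<open>y\<close> for the outer variable.
\<close>
definition ev2 :: "('a::field \<Rightarrow> 'b::comm_ring_1) \<Rightarrow> 'a poly poly \<Rightarrow> 'b \<Rightarrow> 'b \<Rightarrow> 'b" where
  "ev2 h P s y = poly (map_poly (\<lambda>q. poly (map_poly h q) s) P) y"

lemma ev2_hom:
  assumes h: "hom_on UNIV h" and g: "hom_on S g" "subring_set S" "\<And>c. h c \<in> S" "s \<in> S" "y \<in> S"
  shows "ev2 h P s y \<in> S" "g (ev2 h P s y) = ev2 (\<lambda>c. g (h c)) P (g s) (g y)"
proof -
  have h0: "h 0 = 0" using hom_onD[OF h] by simp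
  have g0: "g 0 = 0" using hom_onD[OF g(1,2)] by simp
  have 1: "poly (map_poly h q) s \<in> S" for q
    using g by (intro poly_in_subring) (auto simp: coeff_map_poly h0)
  have 2: "g (poly (map_poly h q) s) = poly (map_poly (\<lambda>c. g (h c)) q) (g s)" for q
    using g by (subst hom_on_poly[OF g(1,2)]) (auto simp: coeff_map_poly map_poly_map_poly h0 g0 o_def)
  show "ev2 h P s y \<in> S"
    unfolding ev2_def using g 1 by (intro poly_in_subring) (auto simp: coeff_map_poly)
  show "g (ev2 h P s y) = ev2 (\<lambda>c. g (h c)) P (g s) (g y)"
    unfolding ev2_def using g 1
    by (subst hom_on_poly[OF g(1,2)]) (auto simp: coeff_map_poly map_poly_map_poly g0 o_def 2)
qed

lemma ev2_sum:
  assumes "h 0 = 0"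
  shows "ev2 h P s y = (\<Sum>b\<le>degree P. (\<Sum>a\<le>degree (coeff P b).
     h (coeff (coeff P b) a) * s ^ a) * y ^ b)"
  using assms by (simp add: ev2_def poly_map_poly_sum)

definition mpoly_of_ev2 :: "'a::field poly poly \<Rightarrow> nat \<Rightarrow> 'a mpoly" where
  "mpoly_of_ev2 P i = (\<Sum>b\<le>degree P. (\<Sum>a\<le>degree (coeff P b).
     mconst (coeff (coeff P b) a) * mvar 0 ^ a) * mvar i ^ b)"

lemma mpeval_mpoly_of_ev2: "hom_on UNIV h \<Longrightarrow> mpeval h (mpoly_of_ev2 P i) y = ev2 h P (y 0) (y i)"
  by (simp add: mpoly_of_ev2_def ev2_sum hom_onD mpeval_sum mpeval_mult mpeval_power mpeval_mconst mpeval_mvar)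

lemma mpoly_of_ev2_poly_ring: "0 < n \<Longrightarrow> i < n \<Longrightarrow> mpoly_of_ev2 P i \<in> poly_ring n"
  unfolding mpoly_of_ev2_def
  by (intro subring_set_sum subring_setD poly_ring_subring mconst_poly_ring mvar_poly_ring)

lemma derivation_poly:
  assumes "derivation h D" "D 0 = 0"
  shows "D (poly q y) = poly (map_poly D q) y + poly (pderiv q) y * D y"
proof (induction q)
  case (pCons a q)
  then show ?case using assms
    by (simp add: map_poly_pCons pderiv_pCons derivation_def algebra_simps)
qed (simp add: assms)

lemma pderiv_map_poly_hom:
  assumes "hom_on UNIV (h :: 'a::idom \<Rightarrow> 'b::idom)"
  shows "pderiv (map_poly h p) = map_poly h (pderiv p)"
proof (rule poly_eqI)
  fix n
  note hh = hom_onD[OF assms subring_set_UNIV]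
  have "h (of_nat k) = of_nat k" for k by (induction k) (auto simp: hh)
  then show "coeff (pderiv (map_poly h p)) n = coeff (map_poly h (pderiv p)) n"
    using hh(4)[of "of_nat (Suc n)"] by (simp add: coeff_pderiv coeff_map_poly hh del: of_nat_Suc)
qed

lemma hom_on_poly_eval: "hom_on UNIV h \<Longrightarrow> hom_on UNIV (\<lambda>q. poly (map_poly h q) s)"
proof -
  assume h: "hom_on UNIV h"
  have c: "coeffs_in UNIV q" for q by (simp add: coeffs_in_def)
  show ?thesis
    using hom_onD(1,2)[OF h subring_set_UNIV] hom_on_map_poly(1,3)[OF h subring_set_UNIV c c]
    by (simp add: hom_on_def map_poly_1)
qed

lemma ev2_derivation:
  fixes y :: "'b::idom"
  assumes h: "hom_on UNIV h" and D: "derivation h D"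
  shows "D (ev2 h P s y) = ev2 h (pderiv P) s y * D y + ev2 h (map_poly pderiv P) s y * D s"
proof -
  note hh = hom_onD[OF h subring_set_UNIV]
  have D0: "D 0 = 0" using D hh(1) by (metis derivation_def)
  let ?e = "\<lambda>q. poly (map_poly h q) s"
  have e: "hom_on UNIV ?e" by (rule hom_on_poly_eval[OF h])
  have De: "D (?e q) = ?e (pderiv q) * D s" for q
  proof -
    have "map_poly D (map_poly h q) = 0"
      using D by (intro poly_eqI) (simp add: coeff_map_poly hh D0 derivation_def)
    then show ?thesis
      by (subst derivation_poly[OF D D0]) (simp add: pderiv_map_poly_hom[OF h])
  qed
  have "map_poly D (map_poly ?e P) = Polynomial.smult (D s) (map_poly ?e (map_poly pderiv P))"
    by (intro poly_eqI) (simp add: coeff_map_poly D0 hom_onD[OF e] De mult.commute)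
  then show ?thesis
    unfolding ev2_def
    by (subst derivation_poly[OF D D0]) (simp add: pderiv_map_poly_hom[OF e] mult.commute)
qed

text \<open>
  The partial derivative in direction \<open>j\<close> is the linear coefficient after moving the point along the
  \<open>j\<close>-th coordinate axis.  So a gradient is determined by the values of the polynomial function.
\<close>
lemma gradient_perturb:
  fixes g :: "'a::field mpoly" and p :: "nat \<Rightarrow> 'a alg_closure"
  assumes g: "g \<in> poly_ring n" and j: "j < n"
  defines "Y \<equiv> \<lambda>i. (if i = j then [:p i, 1:] else [:p i:] :: 'a alg_closure poly)"
  shows "gradient n g p j = poly (pderiv (mpeval (\<lambda>c. [:to_ac c:]) g Y)) 0"
proof -
  have h: "hom_on UNIV (\<lambda>c::'a. [:to_ac c:])" by (simp add: hom_on_def one_pCons)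
  have D: "derivation (\<lambda>c::'a. [:to_ac c:]) pderiv"
    by (simp add: derivation_def pderiv_add pderiv_mult pderiv_pCons algebra_simps)
  have p0: "hom_on UNIV (\<lambda>q :: 'a alg_closure poly. poly q 0)" by (simp add: hom_on_def)
  have "pderiv (mpeval (\<lambda>c. [:to_ac c:]) g Y) = (\<Sum>i<n. mpeval (\<lambda>c. [:to_ac c:]) (partial_deriv i g) Y * pderiv (Y i))"
    by (rule derivation_mpeval[OF h D g])
  also have "\<dots> = (\<Sum>i<n. if i = j then mpeval (\<lambda>c. [:to_ac c:]) (partial_deriv i g) Y else 0)"
    by (intro sum.cong refl) (simp add: Y_def pderiv_pCons)
  also have "\<dots> = mpeval (\<lambda>c. [:to_ac c:]) (partial_deriv j g) Y" using j by simp
  also have "poly \<dots> 0 = mpeval to_ac (partial_deriv j g) p"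
    by (subst mpeval_hom(2)[OF p0]) (auto simp: Y_def intro!: arg_cong2[where f = "mpeval _"])
  finally show ?thesis using j by (simp add: gradient_def eval_ac_mpeval)
qed

lemma hom_to_ac: "hom_on UNIV to_ac" by (simp add: hom_on_def)
lemma hom_fps_const: "hom_on UNIV fps_const" 
  by (simp add: hom_on_def)

lemma gradient_mpoly_of_ev2:
  assumes "0 < n" "i < n" "j < n" "0 < j"
  shows "gradient n (mpoly_of_ev2 P i) p j = (if i = j then ev2 to_ac (pderiv P) (p 0) (p j) else 0)"
proof -
  let ?H = "\<lambda>c::'a. [:to_ac c:]"
  have h: "hom_on UNIV ?H" by (simp add: hom_on_def one_pCons)
  have D: "derivation ?H pderiv"
    by (simp add: derivation_def pderiv_add pderiv_mult pderiv_pCons algebra_simps)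
  have p0: "hom_on UNIV (\<lambda>q :: 'a alg_closure poly. poly q 0)" by (simp add: hom_on_def)
  have "gradient n (mpoly_of_ev2 P i) p j = poly (pderiv (ev2 ?H P [:p 0:] (if i = j then [:p i, 1:] else [:p i:]))) 0"
    using assms by (subst gradient_perturb[OF mpoly_of_ev2_poly_ring]) (auto simp: mpeval_mpoly_of_ev2[OF h])
  also have "\<dots> = (if i = j then poly (ev2 ?H (pderiv P) [:p 0:] [:p i, 1:]) 0 else 0)"
    by (subst ev2_derivation[OF h D]) (auto simp: pderiv_pCons)
  also have "poly (ev2 ?H (pderiv P) [:p 0:] [:p i, 1:]) 0 = ev2 to_ac (pderiv P) (p 0) (p i)"
    by (subst ev2_hom(2)[OF h p0]) auto
  finally show ?thesis by simp
qed

abbreviation polys_in_fps :: "'a::field fps set" where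
  "polys_in_fps \<equiv> range fps_of_poly"

lemma subring_polys: "subring_set (polys_in_fps :: 'a::field fps set)"
  unfolding subring_set_def
  by (auto simp flip: fps_of_poly_add fps_of_poly_mult fps_of_poly_uminus intro: range_eqI[of _ _ 1])

lemma hom_fps_of_poly: "hom_on UNIV (fps_of_poly :: 'a::field poly \<Rightarrow> _)"
  by (simp add: hom_on_def fps_of_poly_add fps_of_poly_mult)

lemma fps_of_poly_eval: "fps_of_poly (q :: 'a::field poly) = poly (map_poly fps_const q) fps_X"
  by (induction q) (simp_all add: fps_of_poly_pCons map_poly_pCons mult.commute)

lemma ev2_fps: "ev2 fps_const P fps_X y = poly (map_poly fps_of_poly P) y"
  unfolding ev2_def by (intro arg_cong2[where f = poly] map_poly_cong) (auto simp: fps_of_poly_eval)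

section \<open>The affine curve of an arc\<close>

text \<open>
  A formal arc \<open>x\<close> parametrised by \<open>s = x 0\<close>.  The coordinates \<open>x 1\<close>, \<open>\<dots>\<close>, \<open>x M\<close> are roots of
  polynomials over \<open>K[s]\<close>, and the last coordinate inverts the product of the derivatives at these
  roots.  Thus each coordinate is etale over the \<open>s\<close>-line along the arc, and by the presence of the
  last coordinate also at every other point that satisfies all relations between the coordinates.
\<close>
locale etale_arc =
  fixes x :: "nat \<Rightarrow> 'a::field fps" and M :: nat and P :: "nat \<Rightarrow> 'a poly poly"
  assumes x_0: "x 0 = fps_X"
    and x_root: "\<And>i. 0 < i \<Longrightarrow> i \<le> M \<Longrightarrow> ev2 fps_const (P i) fps_X (x i) = 0"
    and x_last: "x (Suc M) * (\<Prod>i\<in>{1..M}. ev2 fps_const (pderiv (P i)) fps_X (x i)) = 1"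
begin

abbreviation "N \<equiv> Suc (Suc M)"
abbreviation "ev \<equiv> \<lambda>g. mpeval fps_const g x"
text \<open>
  \<open>I\<close> is the ideal of all relations between the coordinates of the arc, \<open>R\<close> is the quotient by it,
  realised inside the power series, and \<open>C\<close> is the curve of its geometric points.  As the arc is a
  generic point of \<open>C\<close>, irreducibility does not have to be arranged by decomposing a given variety.
\<close>
definition "R = ev ` poly_ring N"
definition "I = {g \<in> poly_ring N. ev g = 0}"
definition "C = zero_locus N I"

lemma subring_R: "subring_set R"
  unfolding R_def by (rule subring_set_mpeval_image[OF hom_fps_const])

lemma const_R: "fps_const c \<in> R"
  unfolding R_def by (rule image_eqI[of _ _ "mconst c"]) (simp_all add: mpeval_mconst[OF hom_fps_const])

lemma x_R: "i < N \<Longrightarrow> x i \<in> R"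
  unfolding R_def by (rule image_eqI[of _ _ "mvar i"]) (simp_all add: mpeval_mvar[OF hom_fps_const])

lemma fps_X_R: "fps_X \<in> R" using x_R[of 0] x_0 by simp

lemma ev2_R: "i < N \<Longrightarrow> ev2 fps_const Q fps_X (x i) \<in> R"
  by (rule ev2_hom(1)[OF hom_fps_const, of R id])
    (use subring_R const_R x_R fps_X_R in \<open>auto simp: hom_on_def\<close>)

lemma fps_of_poly_R: "fps_of_poly q \<in> R"
  unfolding fps_of_poly_eval 
  by (rule poly_in_subring[OF subring_R]) (auto simp: coeff_map_poly const_R fps_X_R)

subsection \<open>Points are homomorphisms\<close>

text \<open>
  The homomorphism from \<open>R\<close> that corresponds to a point of \<open>C\<close>.  A relation between the coordinates
  holds at each point of \<open>C\<close>, so the choice of the representing polynomial is immaterial.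
\<close>
definition point_hom :: "(nat \<Rightarrow> 'a alg_closure) \<Rightarrow> 'a fps \<Rightarrow> 'a alg_closure" where
  "point_hom p v = eval_ac (SOME g. g \<in> poly_ring N \<and> ev g = v) p"

lemma point_hom_ev:
  assumes p: "p \<in> C" and g: "g \<in> poly_ring N"
  shows "point_hom p (ev g) = eval_ac g p"
proof -
  let ?f = "SOME f. f \<in> poly_ring N \<and> ev f = ev g"
  have f: "?f \<in> poly_ring N \<and> ev ?f = ev g" by (rule someI[of _ g]) (use g in simp)
  then have "?f - g \<in> I" using g by (simp add: I_def mpeval_diff[OF hom_fps_const] subring_setD[OF poly_ring_subring])
  then have "eval_ac (?f - g) p = 0" using p by (simp add: C_def zero_locus_def)
  then show ?thesis by (simp add: point_hom_def eval_ac_mpeval mpeval_diff[OF hom_to_ac])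
qed

lemma hom_point_hom: "p \<in> C \<Longrightarrow> hom_on R (point_hom p)"
  unfolding hom_on_def R_def
proof (intro conjI ballI; (elim imageE)?; hypsubst?)
  note P = subring_setD[OF poly_ring_subring]
  assume p: "p \<in> C"
  show "point_hom p 1 = 1"
    using point_hom_ev[OF p, of "mconst 1"] by (simp add: mpeval_mconst[OF hom_fps_const] mpeval_mconst[OF hom_to_ac] eval_ac_mpeval)
  fix g g' :: "'a mpoly" assume g: "g \<in> poly_ring N" "g' \<in> poly_ring N"
  show "point_hom p (ev g + ev g') = point_hom p (ev g) + point_hom p (ev g')"
    using point_hom_ev[OF p P(4)[OF g]] point_hom_ev[OF p g(1)] point_hom_ev[OF p g(2)]
    by (simp add: mpeval_add[OF hom_fps_const] mpeval_add[OF hom_to_ac] eval_ac_mpeval)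
  show "point_hom p (ev g * ev g') = point_hom p (ev g) * point_hom p (ev g')"
    using point_hom_ev[OF p P(5)[OF g]] point_hom_ev[OF p g(1)] point_hom_ev[OF p g(2)]
    by (simp add: mpeval_mult[OF hom_fps_const] mpeval_mult[OF hom_to_ac] eval_ac_mpeval)
qed

lemma point_hom_const: "p \<in> C \<Longrightarrow> point_hom p (fps_const c) = to_ac c"
  using point_hom_ev[of p "mconst c"] by (simp add: mpeval_mconst[OF hom_fps_const] mpeval_mconst[OF hom_to_ac] eval_ac_mpeval)

lemma point_hom_x: "p \<in> C \<Longrightarrow> i < N \<Longrightarrow> point_hom p (x i) = p i"
  using point_hom_ev[of p "mvar i"] by (simp add: mpeval_mvar[OF hom_fps_const] mpeval_mvar[OF hom_to_ac] eval_ac_mpeval)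

lemma point_hom_X: "p \<in> C \<Longrightarrow> point_hom p fps_X = p 0"
  using point_hom_x[of p 0] x_0 by simp

lemma point_hom_ev2: "p \<in> C \<Longrightarrow> i < N \<Longrightarrow> point_hom p (ev2 fps_const Q fps_X (x i)) = ev2 to_ac Q (p 0) (p i)"
  by (subst ev2_hom(2)[OF hom_fps_const hom_point_hom subring_R])
    (simp_all add: const_R fps_X_R x_R point_hom_const point_hom_x point_hom_X)

lemma point_hom_fps_of_poly: "p \<in> C \<Longrightarrow> point_hom p (fps_of_poly q) = poly (map_poly to_ac q) (p 0)"
  unfolding fps_of_poly_eval using hom_onD(1)[OF hom_point_hom subring_R]
  by (subst hom_on_poly[OF hom_point_hom subring_R])
    (auto simp: coeff_map_poly const_R fps_X_R point_hom_X map_poly_map_poly o_def point_hom_const)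

lemma point_of_hom:
  assumes h: "hom_on R h" "\<And>c. h (fps_const c) = to_ac c"
  shows "(\<lambda>i. if i < N then h (x i) else 0) \<in> C"
  unfolding C_def zero_locus_def
proof (safe)
  let ?p = "\<lambda>i. if i < N then h (x i) else 0"
  show "?p \<in> affine_space N" by (simp add: affine_space_def)
  fix g assume g: "g \<in> I"
  then have gN: "g \<in> poly_ring N" and g0: "ev g = 0" by (auto simp: I_def)
  let ?x = "\<lambda>i. if i < N then x i else 0"
  have ge: "ev g = mpeval fps_const g ?x" by (rule mpeval_cong[OF gN]) simp
  have "h (mpeval fps_const g ?x) = mpeval (\<lambda>c. h (fps_const c)) g (\<lambda>i. h (?x i))"
    by (rule mpeval_hom(2)[OF h(1) subring_R]) (use const_R x_R subring_setD[OF subring_R] in auto)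
  also have "\<dots> = eval_ac g ?p"
    unfolding eval_ac_mpeval h(2) using hom_onD(1)[OF h(1) subring_R]
    by (intro arg_cong2[where f = "mpeval _"]) auto
  finally show "eval_ac g ?p = 0" using g0 ge hom_onD(1)[OF h(1) subring_R] by simp
qed

lemma point_ev2: "p \<in> C \<Longrightarrow> 0 < i \<Longrightarrow> i \<le> M \<Longrightarrow> ev2 to_ac (P i) (p 0) (p i) = 0"
  using point_hom_ev2[of p i "P i"] x_root[of i] hom_onD(1)[OF hom_point_hom subring_R] by simp

lemma point_last: "p \<in> C \<Longrightarrow> p (Suc M) * (\<Prod>i\<in>{1..M}. ev2 to_ac (pderiv (P i)) (p 0) (p i)) = 1"
proof -
  assume p: "p \<in> C"
  note h = hom_onD[OF hom_point_hom[OF p] subring_R]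
  have "point_hom p (\<Prod>i\<in>{1..M}. ev2 fps_const (pderiv (P i)) fps_X (x i)) = (\<Prod>i\<in>{1..M}. ev2 to_ac (pderiv (P i)) (p 0) (p i))"
    by (subst hom_on_prod[OF hom_point_hom[OF p] subring_R]) (auto simp: ev2_R point_hom_ev2 p)
  moreover have "(\<Prod>i\<in>{1..M}. ev2 fps_const (pderiv (P i)) fps_X (x i)) \<in> R"
    by (rule subring_set_prod[OF subring_R]) (simp add: ev2_R)
  ultimately show ?thesis
    using arg_cong[OF x_last, of "point_hom p"] h(2) h(4)[OF x_R] by (simp add: point_hom_x p)
qed

lemma point_pderiv: "p \<in> C \<Longrightarrow> 0 < i \<Longrightarrow> i \<le> M \<Longrightarrow> ev2 to_ac (pderiv (P i)) (p 0) (p i) \<noteq> 0"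
proof
  assume *: "p \<in> C" "0 < i" "i \<le> M" "ev2 to_ac (pderiv (P i)) (p 0) (p i) = 0"
  then have "(\<Prod>i\<in>{1..M}. ev2 to_ac (pderiv (P i)) (p 0) (p i)) = 0"
    by (intro prod_zero) auto
  then show False using point_last[OF *(1)] by (metis mult_zero_right zero_neq_one)
qed

text \<open>
  Above a fixed \<open>t\<close> each coordinate is a root of a polynomial that has a simple root, and hence is
  not zero; the last coordinate is determined by the others.
\<close>
lemma finite_fibre: "finite {p \<in> C. p 0 = t}"
proof -
  define Q where "Q i = map_poly (\<lambda>q. poly (map_poly to_ac q) t) (P i)" for i
  define B where "B i = {y. Q i \<noteq> 0 \<and> poly (Q i) y = 0}" for i
  have fin: "finite (B i)" for i
    by (cases "Q i = 0") (auto simp: B_def poly_roots_finite)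
  let ?F = "PiE {1..M} B"
  have "finite ?F" by (intro finite_PiE) (auto simp: fin)
  moreover have "{p \<in> C. p 0 = t} \<subseteq> (\<lambda>f i. if i = 0 then t else if i \<le> M then f i else
     if i = Suc M then 1 / (\<Prod>i\<in>{1..M}. ev2 to_ac (pderiv (P i)) t (f i)) else 0) ` ?F"
  proof safe
    fix p assume p: "p \<in> C" "t = p 0"
    show "p \<in> (\<lambda>f i. if i = 0 then p 0 else if i \<le> M then f i else
     if i = Suc M then 1 / (\<Prod>i\<in>{1..M}. ev2 to_ac (pderiv (P i)) (p 0) (f i)) else 0) ` ?F"
    proof (rule image_eqI[of _ _ "restrict p {1..M}"])
      have "p i \<in> B i" if "0 < i" "i \<le> M" for i
      proof -
        have "pderiv (Q i) \<noteq> 0"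
          using point_pderiv[OF p(1) that] pderiv_map_poly_hom[OF hom_on_poly_eval[OF hom_to_ac], of t "P i"]
          unfolding ev2_def Q_def p(2) by auto
        then have "Q i \<noteq> 0" by auto
        then show ?thesis using point_ev2[OF p(1) that] by (simp add: B_def Q_def p(2) ev2_def)
      qed
      then show "restrict p {1..M} \<in> ?F" by auto
      have z: "p i = 0" if "i \<ge> N" for i using p(1) that by (simp add: C_def zero_locus_def affine_space_def)
      have last: "p (Suc M) = 1 / (\<Prod>i\<in>{1..M}. ev2 to_ac (pderiv (P i)) (p 0) (p i))"
        using point_last[OF p(1)] by (metis mult_zero_right nonzero_eq_divide_eq zero_neq_one)
      show "p = (\<lambda>i. if i = 0 then p 0 else if i \<le> M then restrict p {1..M} i else
        if i = Suc M then 1 / (\<Prod>i\<in>{1..M}. ev2 to_ac (pderiv (P i)) (p 0) (restrict p {1..M} i)) else 0)"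
        using last z by (auto simp: fun_eq_iff)
    qed
  qed
  ultimately show ?thesis using finite_surj by blast
qed

subsection \<open>Zeros and points\<close>

lemma x_algebraic: "i < Suc M \<Longrightarrow> alg_over (tower polys_in_fps (\<lambda>i. x (Suc i)) i) (x (Suc i))"
proof -
  note t = tower_props[OF subring_polys, where u = "\<lambda>i. x (Suc i)"]
  assume i: "i < Suc M"
  have *: "alg_over polys_in_fps (x i)" if "0 < i" "i \<le> M" for i
    unfolding alg_over_def
  proof (intro exI conjI)
    let ?Q = "map_poly fps_of_poly (P i)"
    note e = ev2_fps[symmetric]
    show "poly ?Q (x i) = 0" using x_root[OF that] by (simp add: e)
    show "coeffs_in polys_in_fps ?Q" by (simp add: coeffs_in_def coeff_map_poly)
    have "ev2 fps_const (pderiv (P i)) fps_X (x i) \<noteq> 0"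
    proof
      assume "ev2 fps_const (pderiv (P i)) fps_X (x i) = 0"
      then have "(\<Prod>i\<in>{1..M}. ev2 fps_const (pderiv (P i)) fps_X (x i)) = 0"
        using that by (intro prod_zero) auto
      then show False using x_last by (metis mult_zero_right zero_neq_one)
    qed
    then have "pderiv ?Q \<noteq> 0" by (auto simp: ev2_fps pderiv_map_poly_hom[OF hom_fps_of_poly])
    then show "?Q \<noteq> 0" by auto
  qed
  show ?thesis
  proof (cases "i < M")
    case True
    then show ?thesis using *[of "Suc i"] t(2) by (auto intro: alg_over_mono)
  next
    case False
    then have i: "i = M" using i by simp
    define T where "T = tower polys_in_fps (\<lambda>i. x (Suc i)) M"
    note t = t[where n = M, folded T_def]
    let ?H = "\<Prod>i\<in>{1..M}. ev2 fps_const (pderiv (P i)) fps_X (x i)"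
    have cT: "fps_const c \<in> T" for c
      using t(2) by (auto intro!: range_eqI[of _ _ "[:c:]"] elim!: subsetD)
    have XT: "fps_X \<in> T"
      using t(2) by (auto intro!: range_eqI[of _ _ "[:0,1:]"] simp: fps_of_poly_pCons elim!: subsetD)
    have xT: "x i \<in> T" if "i \<in> {1..M}" for i
      using t(3)[where i = "i - 1"] that by auto
    have "?H \<in> T"
    proof (rule subring_set_prod[OF t(1)])
      fix i assume i: "i \<in> {1..M}"
      show "ev2 fps_const (pderiv (P i)) fps_X (x i) \<in> T"
        by (rule ev2_hom(1)[OF hom_fps_const _ t(1), of id]) (use cT XT xT[OF i] in \<open>auto simp: hom_on_def\<close>)
    qed
    moreover have "- 1 \<in> T" using subring_setD[OF t(1)] by simp
    ultimately have "coeffs_in T [:-1, ?H:]"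
      by (simp add: coeffs_in_def coeff_pCons subring_setD(1)[OF t(1)] split: nat.split)
    moreover have "poly [:-1, ?H:] (x (Suc M)) = 0" using x_last by simp
    moreover have "[:-1, ?H:] \<noteq> 0" by simp
    ultimately show ?thesis
      unfolding alg_over_def i T_def[symmetric] by (intro exI[of _ "[:-1, ?H:]"] conjI)
  qed
qed

lemma specializes_R: "specializes TYPE('a alg_closure) polys_in_fps R"
proof -
  note t = tower_props[OF subring_polys, where u = "\<lambda>i. x (Suc i)"]
  define T where "T = tower polys_in_fps (\<lambda>i. x (Suc i)) (Suc M)"
  note t = t[where n = "Suc M", folded T_def]
  have "T \<subseteq> R"
    by (rule t(4)[OF subring_R]) (auto simp: fps_of_poly_R x_R)
  moreover have "R \<subseteq> T"
  proof
    fix v assume "v \<in> R"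
    then obtain g where g: "g \<in> poly_ring N" "v = ev g" by (auto simp: R_def)
    let ?x = "\<lambda>i. if i < N then x i else 0"
    have ge: "ev g = mpeval fps_const g ?x" by (rule mpeval_cong[OF g(1)]) simp
    have cT: "fps_of_poly q \<in> T" for q
      using t(2) by auto
    have xT: "x i \<in> T" if "i < N" for i
      using t(3)[where i = "i - 1"] that cT[of "[:0,1:]"] by (cases i) (auto simp: x_0 fps_of_poly_pCons)
    have "fps_const c \<in> T" for c using cT[of "[:c:]"] by (simp add: fps_of_poly_const)
    then have "mpeval fps_const g ?x \<in> T"
      by (rule mpeval_in_subring[OF t(1)]) (use xT subring_setD(1)[OF t(1)] in auto)
    then show "v \<in> T" using ge g by simp
  qed
  ultimately have "R = T" by blast
  with specializes_tower[OF subring_polys x_algebraic, of "Suc M"] show ?thesis unfolding T_def by simp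
qed

text \<open>
  A nonzero \<open>v\<close> in \<open>R\<close> divides a nonzero polynomial in \<open>s\<close>, so that its zeros lie above the finitely many
  roots of that polynomial.
\<close>
lemma finite_zeros: "finite {p \<in> C. point_hom p v = 0}" if v: "v \<in> R" "v \<noteq> 0"
proof -
  obtain E w where E: "E \<in> polys_in_fps" "E \<noteq> 0" "w \<in> R" "v * w = E"
    by (rule specializesE[OF specializes_R v]) (rule that)
  obtain q where q: "E = fps_of_poly q" using E by auto
  let ?Q = "map_poly to_ac q"
  have Q: "?Q \<noteq> 0" using E q by (auto simp: map_poly_eq_0_iff)
  have "{p \<in> C. point_hom p v = 0} \<subseteq> (\<Union>t\<in>{t. poly ?Q t = 0}. {p \<in> C. p 0 = t})"
  proof safe
    fix p assume p: "p \<in> C" "point_hom p v = 0"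
    have "point_hom p E = 0" using hom_onD(4)[OF hom_point_hom[OF p(1)] subring_R v(1) E(3)] p E by simp
    then show "p \<in> (\<Union>t\<in>{t. poly ?Q t = 0}. {p \<in> C. p 0 = t})"
      using point_hom_fps_of_poly[OF p(1), of q] p by (auto simp: q)
  qed
  moreover have "finite (\<Union>t\<in>{t. poly ?Q t = 0}. {p \<in> C. p 0 = t})"
    using poly_roots_finite[OF Q] finite_fibre by auto
  ultimately show ?thesis by (rule finite_subset)
qed

text \<open>
  All but finitely many specialisations of \<open>s\<close> extend to \<open>R\<close> and thus give points of \<open>C\<close>.
\<close>
lemma infinite_C:
  assumes "infinite (UNIV :: 'a set)"
  shows "infinite C"
proof
  assume fin: "finite C"
  obtain E w where E: "E \<in> polys_in_fps" "E \<noteq> 0" "w \<in> R" "1 * w = E" and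
    ex: "\<And>h :: 'a fps \<Rightarrow> 'a alg_closure. hom_on polys_in_fps h \<Longrightarrow> h E \<noteq> 0 \<Longrightarrow> \<exists>h'. hom_on R h' \<and> (\<forall>x\<in>polys_in_fps. h' x = h x)"
    by (rule specializesE[OF specializes_R subring_setD(2)[OF subring_R] one_neq_zero]) (rule that)
  obtain q where q: "E = fps_of_poly q" using E by auto
  let ?Q = "map_poly to_ac q"
  have Q: "?Q \<noteq> 0" using E q by (auto simp: map_poly_eq_0_iff)
  have "t \<in> (\<lambda>p. p 0) ` C" if t: "poly ?Q t \<noteq> 0" for t
  proof -
    define h where "h v = poly (map_poly to_ac (inv_into UNIV fps_of_poly v)) t" for v
    have inj: "inj (fps_of_poly :: 'a poly \<Rightarrow> _)" by (simp add: inj_def)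
    have hq: "h (fps_of_poly q) = poly (map_poly to_ac q) t" for q
      unfolding h_def by (simp add: inv_f_f[OF inj])
    have e: "hom_on UNIV (\<lambda>q. poly (map_poly to_ac q) t)" by (rule hom_on_poly_eval[OF hom_to_ac])
    have "hom_on polys_in_fps h"
      unfolding hom_on_def
    proof (intro conjI ballI)
      show "h 1 = 1" using hq[of 1] hom_onD[OF e] by simp
      fix u v :: "'a fps" assume "u \<in> polys_in_fps" "v \<in> polys_in_fps"
      then obtain a b where "u = fps_of_poly a" "v = fps_of_poly b" by auto
      then show "h (u + v) = h u + h v" "h (u * v) = h u * h v"
        using hq[of "a + b"] hq[of "a * b"] by (simp_all add: hq hom_onD[OF e] fps_of_poly_add fps_of_poly_mult)
    qed
    moreover have "h E \<noteq> 0" using t by (simp add: q hq)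
    ultimately obtain h' where h': "hom_on R h'" "\<forall>v\<in>polys_in_fps. h' v = h v" using ex by blast
    have hc: "h' (fps_of_poly q) = poly (map_poly to_ac q) t" for q
      using h'(2) by (simp add: hq)
    have "h' (fps_const c) = to_ac c" for c
      using hc[of "[:c:]"] by (simp add: fps_of_poly_const map_poly_pCons)
    then have "(\<lambda>i. if i < N then h' (x i) else 0) \<in> C"
      by (rule point_of_hom[OF h'(1)])
    moreover have "h' (x 0) = t" using hc[of "[:0,1:]"] by (simp add: x_0 fps_of_poly_pCons map_poly_pCons)
    ultimately show ?thesis by (intro image_eqI[of _ _ "\<lambda>i. if i < N then h' (x i) else 0"]) auto
  qed
  then have "UNIV \<subseteq> {t. poly ?Q t = 0} \<union> (\<lambda>p. p 0) ` C" by auto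
  moreover have "finite ({t. poly ?Q t = 0} \<union> (\<lambda>p. p 0) ` C)"
    using poly_roots_finite[OF Q] fin by auto
  ultimately have "finite (UNIV :: 'a alg_closure set)" by (rule finite_subset)
  then have "finite (range (to_ac :: 'a \<Rightarrow> _))" by (rule rev_finite_subset) simp
  then have "finite (UNIV :: 'a set)" by (rule finite_imageD[OF _ inj_to_ac])
  with assms show False by simp
qed

end

section \<open>Smoothness of the curve\<close>

lemma zero_locus_insert: "zero_locus n (insert g F) = {p \<in> zero_locus n F. eval_ac g p = 0}"
  by (auto simp: zero_locus_def)

lemma partial_deriv_poly_ring:
  assumes "g \<in> poly_ring n"
  shows "partial_deriv i g \<in> poly_ring n"
  unfolding partial_deriv_def
proof (rule subring_set_sum[OF poly_ring_subring])
  fix m assume m: "m \<in> Poly_Mapping.keys g"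
  have "Poly_Mapping.keys (m - Poly_Mapping.single i 1) \<subseteq> Poly_Mapping.keys m"
    by (auto simp: in_keys_iff lookup_minus)
  also have "\<dots> \<subseteq> {..<n}" using assms m by (auto simp: poly_ring_def)
  finally show "Poly_Mapping.single (m - Poly_Mapping.single i 1) (of_nat (Poly_Mapping.lookup m i) * Poly_Mapping.lookup g m) \<in> poly_ring n"
    by (simp add: poly_ring_def)
qed

text \<open>
  Remove the factors \<open>X\<close> from any nonzero polynomial that vanishes at \<open>v\<close>.
\<close>
lemma algebraic_unit_constant:
  fixes v :: "'a::field alg_closure"
  assumes "v \<noteq> 0"
  shows "\<exists>q :: 'a poly. poly q 0 \<noteq> 0 \<and> poly (map_poly to_ac q) v = 0"
proof -
  obtain p :: "'a poly" where p: "p \<noteq> 0" "poly (map_poly to_ac p) v = 0"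
    by (rule alg_closure_algebraic)
  have "p \<noteq> 0 \<Longrightarrow> poly (map_poly to_ac p) v = 0 \<Longrightarrow> ?thesis" for p :: "'a poly"
  proof (induction p)
    case (pCons a p)
    show ?case
    proof (cases "a = 0")
      case True
      then show ?thesis using pCons assms by (simp add: map_poly_pCons)
    next
      case False
      then show ?thesis using pCons.prems by (intro exI[of _ "pCons a p"]) simp
    qed
  qed simp
  then show ?thesis using p by blast
qed

definition mcomp :: "'a::field poly \<Rightarrow> 'a mpoly \<Rightarrow> 'a mpoly" where
  "mcomp q g = (\<Sum>i\<le>degree q. mconst (coeff q i) * g ^ i)"

lemma mcomp_poly_ring: "g \<in> poly_ring n \<Longrightarrow> mcomp q g \<in> poly_ring n"
  unfolding mcomp_def by (intro subring_set_sum subring_setD poly_ring_subring mconst_poly_ring)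

lemma eval_mcomp: "eval_ac (mcomp q g) p = poly (map_poly to_ac q) (eval_ac g p)"
  by (simp add: mcomp_def eval_ac_mpeval mpeval_sum mpeval_mult mpeval_power mpeval_mconst hom_to_ac poly_map_poly_sum)

interpretation vs: vector_space "\<lambda>(c :: 'k::field) v (i::nat). c * v i"
  by unfold_locales (auto simp: fun_eq_iff algebra_simps)

lemma sum_fun_apply: "(\<Sum>i\<in>A. (f i :: 'i \<Rightarrow> 'b::comm_monoid_add)) j = (\<Sum>i\<in>A. f i j)"
  by (induction A rule: infinite_finite_induct) auto

context etale_arc
begin

text \<open>
  Reduction of the arc modulo \<open>s\<close>.
\<close>
definition base_point :: "nat \<Rightarrow> 'a alg_closure" where
  "base_point = (\<lambda>i. if i < N then to_ac (fps_nth (x i) 0) else 0)"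

lemma base_point_C: "base_point \<in> C"
  unfolding base_point_def
  by (rule point_of_hom) (auto simp: hom_on_def)

lemma C_zero: "p \<in> C \<Longrightarrow> i \<ge> N \<Longrightarrow> p i = 0"
  by (simp add: C_def zero_locus_def affine_space_def)

lemma I_poly_ring: "I \<subseteq> poly_ring N" by (auto simp: I_def)

lemma K_closed_C: "K_closed N C"
  unfolding K_closed_def C_def using I_poly_ring by blast

lemma K_closed_C_zeros: "g \<in> poly_ring N \<Longrightarrow> K_closed N {p \<in> C. eval_ac g p = 0}"
  unfolding K_closed_def C_def using I_poly_ring zero_locus_insert[of N g I]
  by (intro exI[of _ "insert g I"]) auto

lemma proper_closed_finite:
  assumes Y: "K_closed N Y" and "\<not> C \<subseteq> Y"
  shows "finite (C \<inter> Y)"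
proof -
  obtain F where F: "F \<subseteq> poly_ring N" "Y = zero_locus N F" using Y by (auto simp: K_closed_def)
  obtain p where p: "p \<in> C" "p \<notin> Y" using assms by blast
  then obtain f where f: "f \<in> F" "eval_ac f p \<noteq> 0"
    using F by (auto simp: zero_locus_def C_def)
  have fN: "f \<in> poly_ring N" using f F by blast
  have "ev f \<noteq> 0" using point_hom_ev[OF p(1) fN] f hom_onD(1)[OF hom_point_hom[OF p(1)] subring_R] by auto
  then have "finite {p \<in> C. point_hom p (ev f) = 0}" using fN by (intro finite_zeros) (auto simp: R_def)
  moreover have "C \<inter> Y \<subseteq> {p \<in> C. point_hom p (ev f) = 0}"
    using f F point_hom_ev fN by (auto simp: zero_locus_def)
  ultimately show ?thesis by (rule rev_finite_subset)
qed

text \<open>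
  A polynomial that vanishes on all of the infinite set \<open>C\<close> must be a relation of the arc, because
  other polynomials have only finitely many zeros on \<open>C\<close>.  This plays the part of the Nullstellensatz.
\<close>
lemma vanishing_ideal_C:
  assumes inf: "infinite (UNIV :: 'a set)" and g: "g \<in> vanishing_ideal N C"
  shows "g \<in> I"
proof (rule ccontr)
  assume "g \<notin> I"
  have gN: "g \<in> poly_ring N" and g0: "\<And>p. p \<in> C \<Longrightarrow> eval_ac g p = 0" using g by (auto simp: vanishing_ideal_def)
  then have "ev g \<noteq> 0" using \<open>g \<notin> I\<close> by (auto simp: I_def)
  then have "finite {p \<in> C. point_hom p (ev g) = 0}" using gN by (intro finite_zeros) (auto simp: R_def)
  moreover have "{p \<in> C. point_hom p (ev g) = 0} = C" using g0 point_hom_ev gN by auto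
  ultimately show False using infinite_C[OF inf] by simp
qed

abbreviation curve :: "('a alg_closure, nat \<Rightarrow> 'a alg_closure) chart set" where
  "curve \<equiv> {\<lparr>edim = N, cdom = C, cmap = (\<lambda>p. p)\<rparr>}"

lemma closed_subset_curve: "closed_subset curve Z \<longleftrightarrow> Z \<subseteq> C \<and> K_closed N Z"
  by (auto simp: closed_subset_def geom_points_def Int_absorb2)

lemma K_variety_curve: "K_variety curve"
proof -
  have "K_open_in N C C"
    unfolding K_open_in_def K_closed_def
    by (rule exI[of _ "{}"], intro conjI, rule exI[of _ "{mconst 1}"])
      (auto simp: zero_locus_def eval_ac_mpeval mpeval_mconst[OF hom_to_ac])
  moreover have "regular_function N C (\<lambda>y. inv_into C (\<lambda>p. p) y j)" if "j < N" for j
    unfolding regular_function_def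
  proof
    have i: "inv_into C (\<lambda>p. p) y = y" if "y \<in> C" for y
      using f_inv_into_f[of y "\<lambda>p. p" C] that by auto
    fix p assume p: "p \<in> C"
    show "\<exists>f\<in>poly_ring N. \<exists>g\<in>poly_ring N. eval_ac g p \<noteq> 0 \<and>
      (\<forall>y\<in>C. eval_ac g y \<noteq> 0 \<longrightarrow> inv_into C (\<lambda>p. p) y j = eval_ac f y / eval_ac g y)"
      by (rule bexI[of _ "mvar j"], rule bexI[of _ "mconst 1"])
        (auto simp: i eval_ac_mpeval mpeval_mconst[OF hom_to_ac] mpeval_mvar[OF hom_to_ac] \<open>j < N\<close>)
  qed
  moreover have "K_closed (N + N) ((\<lambda>x. join N x x) ` C)"
    unfolding K_closed_def
  proof (intro exI conjI)
    let ?F = "I \<union> (\<lambda>i. mvar i - mvar (N + i)) ` {..<N}"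
    note P = subring_setD[OF poly_ring_subring]
    have mono: "poly_ring N \<subseteq> poly_ring (N + N)" by (fastforce simp: poly_ring_def)
    show "?F \<subseteq> poly_ring (N + N)"
      using I_poly_ring mono by (auto intro!: P(6))
    show "(\<lambda>x. join N x x) ` C = zero_locus (N + N) ?F"
    proof (intro equalityI subsetI)
      fix q assume "q \<in> (\<lambda>x. join N x x) ` C"
      then obtain p where p: "p \<in> C" "q = join N p p" by blast
      have "eval_ac g q = 0" if "g \<in> I" for g
      proof -
        have "eval_ac g q = eval_ac g p"
          unfolding eval_ac_mpeval using that I_poly_ring p by (intro mpeval_cong[of g N]) (auto simp: join_def)
        then show ?thesis using p that by (simp add: C_def zero_locus_def)
      qed
      moreover have "q i = 0" if "i \<ge> N + N" for i
        using p that C_zero[OF p(1), of "i - N"] by (simp add: join_def)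
      ultimately show "q \<in> zero_locus (N + N) ?F"
        using p by (auto simp: zero_locus_def affine_space_def eval_ac_mpeval mpeval_diff mpeval_mvar hom_to_ac join_def)
    next
      fix q assume q: "q \<in> zero_locus (N + N) ?F"
      define p where "p i = (if i < N then q i else 0)" for i
      have "eval_ac g p = 0" if "g \<in> I" for g
      proof -
        have "eval_ac g q = eval_ac g p"
          unfolding eval_ac_mpeval using that I_poly_ring by (intro mpeval_cong[of g N]) (auto simp: p_def)
        then show ?thesis using q that by (auto simp: zero_locus_def)
      qed
      then have "p \<in> C" by (simp add: C_def zero_locus_def affine_space_def p_def)
      moreover have "q = join N p p"
      proof
        fix i
        have e: "q i = q (N + i)" if "i < N" for i
        proof -
          have "eval_ac (mvar i - mvar (N + i)) q = 0" using q that by (auto simp: zero_locus_def)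
          then show ?thesis by (simp add: eval_ac_mpeval mpeval_diff mpeval_mvar hom_to_ac)
        qed
        show "q i = join N p p i"
        proof (cases "i < N")
          case False
          then obtain k where k: "i = N + k" using le_Suc_ex not_less by blast
          have "q i = 0" if "k \<ge> N" using q that by (simp add: k zero_locus_def affine_space_def)
          then show ?thesis using e[of k] k by (simp add: join_def p_def)
        qed (simp add: join_def p_def)
      qed
      ultimately show "q \<in> (\<lambda>x. join N x x) ` C" by blast
    qed
  qed
  ultimately show ?thesis
    using K_closed_C
    by (simp add: K_variety_def affine_chart_def compatible_charts_def separated_charts_def)
qed

subsection \<open>Dimension\<close>

lemma irreducible_C:
  assumes inf: "infinite (UNIV :: 'a set)"
  shows "irreducible_closed curve C"
  unfolding irreducible_closed_def closed_subset_curve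
proof (intro conjI allI impI)
  show "C \<noteq> {}" using base_point_C by blast
  fix Y Y' assume Y: "Y \<subseteq> C \<and> K_closed N Y" "Y' \<subseteq> C \<and> K_closed N Y'" "C \<subseteq> Y \<union> Y'"
  show "C \<subseteq> Y \<or> C \<subseteq> Y'"
  proof (rule ccontr)
    assume "\<not> (C \<subseteq> Y \<or> C \<subseteq> Y')"
    then have "finite (C \<inter> Y)" "finite (C \<inter> Y')" using Y proper_closed_finite by auto
    then have "finite C" using Y by (metis Int_absorb1 finite_UnI finite_subset)
    then show False using infinite_C[OF inf] by simp
  qed
qed (use K_closed_C in auto)

text \<open>
  On a finite set each \<open>K\<close>-closed subset has a \<open>K\<close>-closed complement: a polynomial \<open>g\<close> takes finitely
  many values on the set, all algebraic over \<open>K\<close>, so there is a polynomial \<open>m\<close> over \<open>K\<close> with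
  \<open>m(0) \<noteq> 0\<close> that vanishes at the nonzero values, and \<open>m(g)\<close> is zero exactly where \<open>g\<close> is not.
\<close>
lemma finite_irreducible_minimal:
  assumes Z: "irreducible_closed curve Z" "finite Z" and Y: "irreducible_closed curve Y"
  shows "\<not> Y \<subset> Z"
proof
  assume YZ: "Y \<subset> Z"
  have YC: "K_closed N Y" "Y \<noteq> {}" and ZC: "Z \<subseteq> C"
    and irr: "\<And>A B. A \<subseteq> C \<Longrightarrow> K_closed N A \<Longrightarrow> B \<subseteq> C \<Longrightarrow> K_closed N B \<Longrightarrow> Z \<subseteq> A \<union> B \<Longrightarrow> Z \<subseteq> A \<or> Z \<subseteq> B"
    using Y Z by (auto simp: irreducible_closed_def closed_subset_curve)
  obtain F where F: "F \<subseteq> poly_ring N" "Y = zero_locus N F" using YC by (auto simp: K_closed_def)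
  obtain y where y: "y \<in> Z" "y \<notin> Y" using YZ by blast
  then obtain g where g: "g \<in> F" "eval_ac g y \<noteq> 0"
    using F ZC by (auto simp: zero_locus_def C_def)
  have gN: "g \<in> poly_ring N" using g F by blast
  obtain p where p: "p \<in> Y" using YC by blast
  have gp: "eval_ac g p = 0" using p F g by (auto simp: zero_locus_def)
  define V where "V = (eval_ac g ` Z) - {0}"
  have "\<exists>q. \<forall>v\<in>V. poly (q v) 0 \<noteq> 0 \<and> poly (map_poly to_ac (q v)) v = 0"
    by (rule bchoice) (use algebraic_unit_constant in \<open>auto simp: V_def\<close>)
  then obtain q :: "'a alg_closure \<Rightarrow> 'a poly" where q: "\<And>v. v \<in> V \<Longrightarrow> poly (q v) 0 \<noteq> 0 \<and> poly (map_poly to_ac (q v)) v = 0" by blast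
  define m where "m = (\<Prod>v\<in>V. q v)"
  have fV: "finite V" using Z by (simp add: V_def)
  have hp: "hom_on UNIV (\<lambda>q. poly (map_poly to_ac q) v)" for v by (rule hom_on_poly_eval[OF hom_to_ac])
  have m0: "poly m 0 \<noteq> 0" using q fV by (simp add: m_def poly_prod)
  have mv: "poly (map_poly to_ac m) v = 0" if "v \<in> V" for v
    unfolding m_def using q[OF that] fV that by (subst hom_on_prod[OF hp]) (auto intro!: prod_zero)
  let ?A = "{p \<in> C. eval_ac g p = 0}" and ?B = "{p \<in> C. eval_ac (mcomp m g) p = 0}"
  have "Z \<subseteq> ?A \<union> ?B" using ZC mv by (auto simp: eval_mcomp V_def)
  then have "Z \<subseteq> ?A \<or> Z \<subseteq> ?B"
    by (intro irr K_closed_C_zeros gN mcomp_poly_ring) auto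
  moreover have "\<not> Z \<subseteq> ?A" using y g by auto
  moreover have "poly (map_poly to_ac m) 0 = to_ac (poly m 0)"
    by (simp add: poly_0_coeff_0 coeff_map_poly)
  then have "\<not> Z \<subseteq> ?B" using p YZ gp m0 by (auto simp: eval_mcomp)
  ultimately show False by blast
qed

lemma irreducible_base_point: "irreducible_closed curve {base_point}"
  unfolding irreducible_closed_def closed_subset_curve
proof (intro conjI allI impI)
  let ?F = "(\<lambda>i. mvar i - mconst (fps_nth (x i) 0)) ` {..<N}"
  show "K_closed N {base_point}"
    unfolding K_closed_def
  proof (intro exI[of _ ?F] conjI equalityI subsetI)
    fix p assume "p \<in> {base_point}"
    then show "p \<in> zero_locus N ?F"
      by (auto simp: zero_locus_def affine_space_def base_point_def eval_ac_mpeval mpeval_diff mpeval_mvar mpeval_mconst hom_to_ac)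
  next
    fix p assume p: "p \<in> zero_locus N ?F"
    have "p i = base_point i" for i
    proof (cases "i < N")
      case True
      then have "eval_ac (mvar i - mconst (fps_nth (x i) 0)) p = 0" using p by (auto simp: zero_locus_def)
      then show ?thesis using True
        by (simp add: base_point_def eval_ac_mpeval mpeval_diff mpeval_mvar mpeval_mconst hom_to_ac)
    qed (use p in \<open>auto simp: base_point_def zero_locus_def affine_space_def\<close>)
    then show "p \<in> {base_point}" by auto
  qed (auto intro!: subring_setD(6)[OF poly_ring_subring])
qed (use base_point_C in auto)

text \<open>
  The only component is \<open>C\<close>.  A chain of length one starts at the base point.  In a longer chain the
  middle term would be a proper closed subset of \<open>C\<close>, hence finite, hence without smaller irreducible
  subsets.
\<close>
lemma pure_dim_curve:
  assumes inf: "infinite (UNIV :: 'a set)"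
  shows "pure_dim curve 1"
  unfolding pure_dim_def
proof (intro allI impI)
  note irr = irreducible_C[OF inf]
  fix Z assume Z: "irreducible_component curve Z"
  then have "Z \<subseteq> C" by (auto simp: irreducible_component_def irreducible_closed_def closed_subset_curve)
  then have Z: "Z = C" using Z irr by (auto simp: irreducible_component_def)
  have "has_chain curve C 1"
    unfolding has_chain_def
  proof (intro exI[of _ "\<lambda>i. if i = 0 then {base_point} else C"] conjI allI impI)
    fix i :: nat assume "i < 1"
    moreover have "{base_point} \<noteq> C" using infinite_C[OF inf] by (metis finite.emptyI finite_insert)
    ultimately show "(if i = 0 then {base_point} else C) \<subset> (if Suc i = 0 then {base_point} else C)"
      using base_point_C by auto
  qed (use irr irreducible_base_point base_point_C in auto)
  moreover have "\<not> has_chain curve C (Suc 1)"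
  proof
    assume "has_chain curve C (Suc 1)"
    then obtain D where D: "\<And>i. i \<le> Suc 1 \<Longrightarrow> irreducible_closed curve (D i) \<and> D i \<subseteq> C"
      "\<And>i. i < Suc 1 \<Longrightarrow> D i \<subset> D (Suc i)" by (auto simp: has_chain_def)
    have 1: "D 0 \<subset> D 1" "D 1 \<subset> D 2" "D 2 \<subseteq> C" using D(2)[of 0] D(2)[of 1] D(1)[of 2] by (simp_all add: numeral_2_eq_2)
    have i: "irreducible_closed curve (D 0)" "irreducible_closed curve (D 1)" using D(1)[of 0] D(1)[of 1] by auto
    then have "K_closed N (D 1)" by (simp add: irreducible_closed_def closed_subset_curve)
    moreover have "\<not> C \<subseteq> D 1" "C \<inter> D 1 = D 1" using 1 by auto
    ultimately have "finite (D 1)" using proper_closed_finite[of "D 1"] by simp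
    then show False using finite_irreducible_minimal[OF i(2) _ i(1)] 1 by blast
  qed
  ultimately show "has_Krull_dim curve Z 1" by (simp add: has_Krull_dim_def Z)
qed

subsection \<open>Tangent vectors and the Jacobian\<close>

lemma derivation_fps_deriv: "derivation fps_const (fps_deriv :: 'a fps \<Rightarrow> _)"
  by (simp add: derivation_def algebra_simps)

lemma unit_R: "0 < i \<Longrightarrow> i \<le> M \<Longrightarrow> \<exists>w\<in>R. w * ev2 fps_const (pderiv (P i)) fps_X (x i) = 1"
proof -
  assume i: "0 < i" "i \<le> M"
  let ?w = "x (Suc M) * (\<Prod>j\<in>{1..M} - {i}. ev2 fps_const (pderiv (P j)) fps_X (x j))"
  have "?w \<in> R"
    by (intro subring_setD(5)[OF subring_R] subring_set_prod[OF subring_R] x_R ev2_R) auto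
  moreover have "(\<Prod>j\<in>{1..M}. ev2 fps_const (pderiv (P j)) fps_X (x j)) = 
    ev2 fps_const (pderiv (P i)) fps_X (x i) * (\<Prod>j\<in>{1..M} - {i}. ev2 fps_const (pderiv (P j)) fps_X (x j))"
    using i by (intro prod.remove) auto
  then have "?w * ev2 fps_const (pderiv (P i)) fps_X (x i) = 1"
    using x_last by (simp only: mult_ac)
  ultimately show ?thesis by blast
qed

text \<open>
  Implicit differentiation; the denominators are derivatives \<open>pderiv (P i)\<close> at \<open>x i\<close>, which are units
  of \<open>R\<close>.
\<close>
lemma fps_deriv_x_R: "i < N \<Longrightarrow> fps_deriv (x i) \<in> R"
proof -
  note r = subring_setD[OF subring_R]
  have 1: "fps_deriv (x i) \<in> R" if i: "0 < i" "i \<le> M" for i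
  proof -
    obtain w where w: "w \<in> R" "w * ev2 fps_const (pderiv (P i)) fps_X (x i) = 1" using unit_R[OF i] by blast
    have "fps_deriv (ev2 fps_const (P i) fps_X (x i)) = ev2 fps_const (pderiv (P i)) fps_X (x i) * fps_deriv (x i)
        + ev2 fps_const (map_poly pderiv (P i)) fps_X (x i) * fps_deriv fps_X"
      by (rule ev2_derivation[OF hom_fps_const derivation_fps_deriv])
    then have "ev2 fps_const (pderiv (P i)) fps_X (x i) * fps_deriv (x i) = - ev2 fps_const (map_poly pderiv (P i)) fps_X (x i)"
      using x_root[OF i] by (simp add: add_eq_0_iff2)
    then have "w * (ev2 fps_const (pderiv (P i)) fps_X (x i) * fps_deriv (x i)) = w * (- ev2 fps_const (map_poly pderiv (P i)) fps_X (x i))"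
      by simp
    then have "fps_deriv (x i) = w * (- ev2 fps_const (map_poly pderiv (P i)) fps_X (x i))"
      using w(2) by (simp add: mult.assoc[symmetric])
    then show ?thesis using w i by (simp only: r(3,5) ev2_R less_Suc_eq_le le_SucI)
  qed
  assume i: "i < N"
  consider "i = 0" | "0 < i" "i \<le> M" | "i = Suc M" using i by linarith
  then show ?thesis
  proof cases
    case 1
    then show ?thesis by (simp add: x_0 r)
  next
    case 3
    let ?h = "\<lambda>j. ev2 fps_const (pderiv (P j)) fps_X (x j)"
    let ?H = "prod ?h {1..M}"
    have HR: "prod ?h J \<in> R" if "J \<subseteq> {1..M}" for J
      using that by (intro subring_set_prod[OF subring_R] ev2_R) auto
    have "fps_deriv (?h j) \<in> R" if "j \<in> {1..M}" for j
      using that 1[of j] by (subst ev2_derivation[OF hom_fps_const derivation_fps_deriv])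
        (auto intro!: r(4,5) ev2_R r(2))
    then have dH: "fps_deriv ?H \<in> R"
      by (subst derivation_prod[OF derivation_fps_deriv])
        (auto intro!: subring_set_sum[OF subring_R] r(5) HR)
    have "fps_deriv (x (Suc M) * ?H) = 0" using x_last by simp
    then have "fps_deriv (x (Suc M)) * ?H = - (x (Suc M) * fps_deriv ?H)"
      by (simp add: add_eq_0_iff2 add.commute)
    then have "fps_deriv (x (Suc M)) * ?H * x (Suc M) = - (x (Suc M) * fps_deriv ?H) * x (Suc M)" by simp
    moreover have "fps_deriv (x (Suc M)) * ?H * x (Suc M) = fps_deriv (x (Suc M)) * (x (Suc M) * ?H)" by (simp only: mult_ac)
    ultimately have "fps_deriv (x (Suc M)) = - (x (Suc M) * fps_deriv ?H) * x (Suc M)"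
      unfolding x_last by simp
    then show ?thesis using dH 3 by (simp only: r(3,5) x_R lessI)
  qed (rule 1)
qed

text \<open>
  Differentiating \<open>g(x) = 0\<close> with respect to \<open>s\<close> gives a relation that again lies in \<open>R\<close>, and so may
  be evaluated at every point of \<open>C\<close>: the velocity of the arc provides a tangent vector at each point.
\<close>
lemma gradient_orthogonal:
  assumes "g \<in> I" "p \<in> C"
  shows "(\<Sum>i<N. gradient N g p i * point_hom p (fps_deriv (x i))) = 0"
proof -
  have gN: "g \<in> poly_ring N" and g0: "ev g = 0" using assms by (auto simp: I_def)
  note h = hom_onD[OF hom_point_hom[OF assms(2)] subring_R]
  have pR: "ev (partial_deriv i g) \<in> R" for i
    using partial_deriv_poly_ring[OF gN] by (auto simp: R_def)
  have "(\<Sum>i<N. ev (partial_deriv i g) * fps_deriv (x i)) = 0"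
    using derivation_mpeval[OF hom_fps_const derivation_fps_deriv gN, of x] g0 by simp
  then have "point_hom p (\<Sum>i<N. ev (partial_deriv i g) * fps_deriv (x i)) = 0" using h(1) by simp
  moreover have "point_hom p (\<Sum>i<N. ev (partial_deriv i g) * fps_deriv (x i)) = (\<Sum>i<N. point_hom p (ev (partial_deriv i g) * fps_deriv (x i)))"
    by (rule hom_on_sum[OF hom_point_hom[OF assms(2)] subring_R]) (auto intro!: subring_setD(5)[OF subring_R] pR fps_deriv_x_R)
  moreover have "\<dots> = (\<Sum>i<N. gradient N g p i * point_hom p (fps_deriv (x i)))"
    by (intro sum.cong refl, subst h(4)[OF pR fps_deriv_x_R])
      (auto simp: gradient_def point_hom_ev[OF assms(2) partial_deriv_poly_ring[OF gN]])
  ultimately show ?thesis by simp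
qed

text \<open>
  The velocity vector \<open>v\<close> has \<open>v 0 = 1\<close>, so the gradients, being orthogonal to it, lie in the span of
  the vectors \<open>e i - v i e 0\<close> for \<open>i \<ge> 1\<close>.  Conversely these vectors are obtained from the gradients of
  the defining equations of the single coordinates.
\<close>
lemma Jacobian_rank_C:
  assumes inf: "infinite (UNIV :: 'a set)" and p: "p \<in> C"
  shows "Jacobian_rank N C p + 1 = N"
proof -
  define v where "v i = point_hom p (fps_deriv (x i))" for i
  define b where "b i = (\<lambda>j::nat. if j = i then 1 else if j = 0 then - v i else 0)" for i
  let ?G = "(\<lambda>f. gradient N f p) ` vanishing_ideal N C"
  let ?B = "b ` {1..Suc M}"
  have v0: "v 0 = 1" using hom_onD(2)[OF hom_point_hom[OF p] subring_R] by (simp add: v_def x_0)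
  have I_van: "g \<in> vanishing_ideal N C" if "g \<in> I" for g
    using that I_poly_ring by (auto simp: vanishing_ideal_def C_def zero_locus_def)
  have expand: "gradient N g p = (\<Sum>i\<in>{1..Suc M}. (\<lambda>j. gradient N g p i * b i j))" if g: "g \<in> I" for g
  proof
    fix j
    have s: "{..<N} = insert 0 {1..Suc M}" by auto
    have o: "gradient N g p 0 + (\<Sum>i\<in>{1..Suc M}. gradient N g p i * v i) = 0"
      using gradient_orthogonal[OF g p] unfolding s v_def[symmetric] by (simp add: v0)
    have e: "(\<Sum>i\<in>{1..Suc M}. (\<lambda>j. gradient N g p i * b i j)) j = (\<Sum>i\<in>{1..Suc M}. gradient N g p i * b i j)"
      by (rule sum_fun_apply)
    show "gradient N g p j = (\<Sum>i\<in>{1..Suc M}. (\<lambda>j. gradient N g p i * b i j)) j"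
    proof (cases "j \<in> {1..Suc M}")
      case True
      then have "(\<Sum>i\<in>{1..Suc M}. gradient N g p i * b i j) = (\<Sum>i\<in>{1..Suc M}. if i = j then gradient N g p i else 0)"
        by (intro sum.cong) (auto simp: b_def)
      then show ?thesis using e True by simp
    next
      case False
      show ?thesis
      proof (cases "j = 0")
        case True
        then have "(\<Sum>i\<in>{1..Suc M}. gradient N g p i * b i j) = (\<Sum>i\<in>{1..Suc M}. - (gradient N g p i * v i))"
          by (intro sum.cong) (auto simp: b_def)
        then show ?thesis using o e True by (simp add: sum_negf add_eq_0_iff2)
      next
        case False
        then have "j \<ge> N" using \<open>j \<notin> _\<close> by auto
        then have "(\<Sum>i\<in>{1..Suc M}. gradient N g p i * b i j) = 0"
          by (intro sum.neutral) (auto simp: b_def)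
        then show ?thesis using e \<open>j \<ge> N\<close> by (simp add: gradient_def)
      qed
    qed
  qed
  have "vs.span ?G = vs.span ?B"
  proof (rule vs.span_eq[THEN iffD2], intro conjI)
    show "?G \<subseteq> vs.span ?B"
    proof
      fix w assume "w \<in> ?G"
      then obtain g where g: "g \<in> I" "w = gradient N g p" using vanishing_ideal_C[OF inf] by blast
      show "w \<in> vs.span ?B"
        unfolding g(2) by (subst expand[OF g(1)], intro vs.span_sum vs.span_scale vs.span_base imageI)
    qed
    have bi: "b i \<in> vs.span ?G" if i: "0 < i" "i \<le> M" for i
    proof -
      let ?c = "ev2 to_ac (pderiv (P i)) (p 0) (p i)"
      have gI: "mpoly_of_ev2 (P i) i \<in> I"
        using i x_root[OF i] by (simp add: I_def mpeval_mpoly_of_ev2[OF hom_fps_const] mpoly_of_ev2_poly_ring x_0)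
      have gr: "gradient N (mpoly_of_ev2 (P i) i) p j = (if i = j then ?c else 0)" if "j \<in> {1..Suc M}" for j
        using i that by (subst gradient_mpoly_of_ev2) auto
      have "gradient N (mpoly_of_ev2 (P i) i) p = (\<Sum>k\<in>{1..Suc M}. if k = i then (\<lambda>j. ?c * b i j) else 0)"
        by (subst expand[OF gI], intro sum.cong refl) (auto simp: gr fun_eq_iff)
      also have "\<dots> = (\<lambda>j. ?c * b i j)" using i by simp
      finally have "b i = (\<lambda>j. (1 / ?c) * gradient N (mpoly_of_ev2 (P i) i) p j)"
        using point_pderiv[OF p i] by (simp add: fun_eq_iff)
      also have "\<dots> \<in> vs.span ?G" by (intro vs.span_scale vs.span_base imageI I_van gI)
      finally show ?thesis .
    qed
    have b_last: "b (Suc M) \<in> vs.span ?G"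
    proof -
      define g where "g = mvar (Suc M) * (\<Prod>i\<in>{1..M}. mpoly_of_ev2 (pderiv (P i)) i) - mconst 1"
      have mp: "mpeval h g y = y (Suc M) * (\<Prod>i\<in>{1..M}. ev2 h (pderiv (P i)) (y 0) (y i)) - h 1"
        if h: "hom_on UNIV h" for h :: "'a \<Rightarrow> 'c::idom" and y
      proof -
        have "mpeval h (\<Prod>i\<in>J. mpoly_of_ev2 (pderiv (P i)) i) y = (\<Prod>i\<in>J. ev2 h (pderiv (P i)) (y 0) (y i))" for J
        proof (induction J rule: infinite_finite_induct)
          case empty
          show ?case using mpeval_power[OF h, of 0 0 y] by simp
        next
          case (infinite A)
          then show ?case using mpeval_power[OF h, of 0 0 y] by simp
        qed (simp add: mpeval_mult[OF h] mpeval_mpoly_of_ev2[OF h])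
        then show ?thesis by (simp add: g_def mpeval_diff[OF h] mpeval_mult[OF h] mpeval_mvar[OF h] mpeval_mconst[OF h])
      qed
      have gN: "g \<in> poly_ring N"
        unfolding g_def by (intro subring_setD(5,6)[OF poly_ring_subring] subring_set_prod[OF poly_ring_subring] mpoly_of_ev2_poly_ring) auto
      have gI: "g \<in> I" using gN x_last by (simp add: I_def mp[OF hom_fps_const] x_0)
      let ?H = "\<Prod>i\<in>{1..M}. ev2 to_ac (pderiv (P i)) (p 0) (p i)"
      have "gradient N g p (Suc M) = ?H"
      proof -
        let ?h = "\<lambda>c::'a. [:to_ac c:]"
        have h: "hom_on UNIV ?h" by (simp add: hom_on_def one_pCons)
        have c: "hom_on UNIV (\<lambda>c::'a alg_closure. [:c:])" by (simp add: hom_on_def one_pCons)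
        have e: "ev2 ?h Q [:p 0:] [:p i:] = [:ev2 to_ac Q (p 0) (p i):]" for Q i
          by (subst ev2_hom(2)[OF hom_to_ac c]) auto
        have "(\<Prod>i\<in>{1..M}. ev2 ?h (pderiv (P i)) [:p 0:] (if i = Suc M then [:p i, 1:] else [:p i:])) = (\<Prod>i\<in>{1..M}. [:ev2 to_ac (pderiv (P i)) (p 0) (p i):])"
          by (intro prod.cong) (auto simp: e)
        also have "\<dots> = [:?H:]" by (rule hom_on_prod[OF c, symmetric]) auto
        finally show ?thesis
          by (subst gradient_perturb[OF gN]) (auto simp: mp[OF h] pderiv_diff pderiv_mult pderiv_pCons)
      qed
      have H: "?H \<noteq> 0" using point_last[OF p] by (metis mult_zero_right zero_neq_one)
      let ?w = "\<Sum>i\<in>{1..M}. (\<lambda>j. gradient N g p i * b i j)"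
      have "gradient N g p = ?w + (\<lambda>j. ?H * b (Suc M) j)"
        using expand[OF gI] \<open>gradient N g p (Suc M) = ?H\<close> by simp
      then have d: "gradient N g p - ?w = (\<lambda>j. ?H * b (Suc M) j)"
        by (rule diff_eq_eq[THEN iffD2, OF trans[OF _ add.commute]])
      have "b (Suc M) = (\<lambda>j. (1 / ?H) * (gradient N g p - ?w) j)"
        unfolding d using H by simp
      also have "\<dots> \<in> vs.span ?G"
        by (intro vs.span_scale vs.span_diff vs.span_sum bi) (auto intro!: vs.span_base I_van gI)
      finally show ?thesis .
    qed
    show "?B \<subseteq> vs.span ?G"
    proof
      fix w assume "w \<in> ?B"
      then obtain i where i: "1 \<le> i" "i \<le> Suc M" "w = b i" by auto
      then show "w \<in> vs.span ?G" using bi[of i] b_last by (cases "i = Suc M") auto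
    qed
  qed
  then have "vs.dim ?G = vs.dim ?B" by (metis vs.dim_span)
  have inj: "inj_on b {1..Suc M}"
  proof (rule inj_onI)
    fix i j assume ij: "i \<in> {1..Suc M}" "j \<in> {1..Suc M}" "b i = b j"
    have "b j i = 1" using ij(3) by (metis b_def)
    then show "i = j" using ij(1,2) by (auto simp: b_def split: if_splits)
  qed
  have "vs.independent ?B"
  proof
    assume "vs.dependent ?B"
    then obtain u where u: "\<exists>w\<in>?B. u w \<noteq> 0" "(\<Sum>w\<in>?B. (\<lambda>i. u w * w i)) = 0"
      by (subst (asm) vs.dependent_finite) auto
    then obtain i where i: "i \<in> {1..Suc M}" "u (b i) \<noteq> 0" by blast
    have "(\<Sum>k\<in>{1..Suc M}. (\<lambda>j. u (b k) * b k j)) = 0"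
      using u(2) by (subst (asm) sum.reindex[OF inj]) simp
    then have "(\<Sum>k\<in>{1..Suc M}. (\<lambda>j. u (b k) * b k j)) i = 0" by simp
    then have "(\<Sum>k\<in>{1..Suc M}. u (b k) * b k i) = 0" by (simp add: sum_fun_apply)
    moreover have "(\<Sum>k\<in>{1..Suc M}. u (b k) * b k i) = (\<Sum>k\<in>{1..Suc M}. if k = i then u (b k) else 0)"
      using i by (intro sum.cong) (auto simp: b_def)
    moreover have "\<dots> = u (b i)" using i(1) by (subst sum.delta) auto
    ultimately show False using i(2) by simp
  qed
  then have "vs.dim ?B = card ?B" by (rule vs.dim_eq_card_independent)
  also have "\<dots> = Suc M" using card_image[OF inj] by simp
  finally show ?thesis using \<open>vs.dim ?G = vs.dim ?B\<close> by (simp add: Jacobian_rank_def)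
qed

theorem smooth_curve: "infinite (UNIV :: 'a set) \<Longrightarrow> smooth_K_curve curve"
  using K_variety_curve pure_dim_curve Jacobian_rank_C
  by (simp add: smooth_K_curve_def smooth_of_dim_def)

text \<open>
  Only finitely many points lie above \<open>s = 0\<close>, so among the infinitely many \<open>K\<close>-points there is one
  with \<open>s \<noteq> 0\<close>.
\<close>
theorem large_imp_hom:
  assumes inf: "infinite (UNIV :: 'a set)" and large: "large_field TYPE('a)"
  shows "\<exists>\<phi> :: 'a fps \<Rightarrow> 'a. hom_on R \<phi> \<and> (\<forall>c. \<phi> (fps_const c) = c) \<and> \<phi> fps_X \<noteq> 0"
proof -
  have "base_point \<in> K_points curve"
    using base_point_C by (auto simp: K_points_def base_point_def)
  then have "infinite (K_points curve)"
    using large smooth_curve[OF inf] unfolding large_field_def by blast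
  then obtain p where p: "p \<in> K_points curve" "p \<notin> {p \<in> C. p 0 = 0}"
    using finite_fibre[of 0] by (meson finite_subset subsetI)
  then have pC: "p \<in> C" "p 0 \<noteq> 0" and pK: "\<And>i. i < N \<Longrightarrow> p i \<in> range to_ac" by (auto simp: K_points_def)
  have "subring_set (range (to_ac :: 'a \<Rightarrow> _))"
    unfolding subring_set_def
    by (auto simp flip: to_ac_add to_ac_mult to_ac_minus intro: range_eqI[of _ _ 1])
  then have "mpeval to_ac g (\<lambda>i. if i < N then p i else 0) \<in> range to_ac" for g
    by (rule mpeval_in_subring) (use pK in \<open>auto intro: range_eqI[of _ _ 0]\<close>)
  moreover have "mpeval to_ac g (\<lambda>i. if i < N then p i else 0) = eval_ac g p" if "g \<in> poly_ring N" for g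
    unfolding eval_ac_mpeval by (rule mpeval_cong[OF that]) simp
  ultimately have "eval_ac g p \<in> range to_ac" if "g \<in> poly_ring N" for g using that by metis
  then have point_hom_K: "point_hom p v \<in> range to_ac" if "v \<in> R" for v
    using that point_hom_ev[OF pC(1)] by (auto simp: R_def)
  let ?f = "\<lambda>v. of_ac (point_hom p v)"
  note h = hom_onD[OF hom_point_hom[OF pC(1)] subring_R]
  have "hom_on R ?f"
    unfolding hom_on_def
  proof (intro conjI ballI)
    show "?f 1 = 1" by (rule of_ac_eqI) (simp add: h)
    fix u v assume "u \<in> R" "v \<in> R"
    then show "?f (u + v) = ?f u + ?f v" "?f (u * v) = ?f u * ?f v"
      by (auto intro!: of_ac_eqI simp: h to_ac_of_ac point_hom_K)
  qed
  moreover have "?f (fps_const c) = c" for c by (simp add: point_hom_const[OF pC(1)])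
  moreover have "?f fps_X \<noteq> 0"
    using pC(2) point_hom_K[OF fps_X_R] point_hom_X[OF pC(1)] by (metis to_ac_0 to_ac_of_ac)
  ultimately show ?thesis by blast
qed

end

section \<open>Algebraic power series are separable\<close>

lemma power_prime_add:
  fixes a b :: "'b::comm_ring_1"
  assumes p: "prime p" "of_nat p = (0 :: 'b)"
  shows "(a + b) ^ p = a ^ p + b ^ p"
proof -
  have p0: "p > 0" using p prime_gt_0_nat by blast
  have "(a + b) ^ p = (\<Sum>k\<le>p. of_nat (p choose k) * a ^ k * b ^ (p - k))" by (rule binomial_ring)
  also have "\<dots> = (\<Sum>k\<in>{0, p}. of_nat (p choose k) * a ^ k * b ^ (p - k))"
  proof (intro sum.mono_neutral_right ballI)
    fix k assume k: "k \<in> {..p} - {0, p}"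
    then have "p dvd (p choose k)" using p by (intro dvd_choose_prime) auto
    then obtain c where "p choose k = p * c" by (elim dvdE)
    then show "of_nat (p choose k) * a ^ k * b ^ (p - k) = 0" using p(2) by simp
  qed auto
  also have "\<dots> = a ^ p + b ^ p" using p0 by simp
  finally show ?thesis .
qed

lemma fps_split_low: "f = fps_of_poly (truncate_fps n f) + fps_X ^ n * fps_shift n f"
  by (rule fps_ext) (simp add: coeff_truncate_fps fps_X_power_mult_nth)

lemma fps_power_prime_nth:
  fixes v :: "'a::field fps"
  assumes p: "prime p" "of_nat p = (0 :: 'a)"
  shows "fps_nth (v ^ p) m = (if p dvd m then fps_nth v (m div p) ^ p else 0)"
proof (induction m arbitrary: v rule: less_induct)
  case (less m)
  have p': "of_nat p = (0 :: 'a fps)" using p(2) by (metis fps_of_nat fps_const_0_eq_0)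
  have p0: "p > 0" using p prime_gt_0_nat by blast
  let ?w = "fps_shift 1 v"
  have "v = fps_const (fps_nth v 0) + fps_X * ?w"
    by (rule fps_ext) (simp add: fps_X_mult_nth)
  then have "v ^ p = fps_const (fps_nth v 0 ^ p) + fps_X ^ p * ?w ^ p"
    by (metis power_prime_add[OF p(1) p'] fps_const_power power_mult_distrib)
  then have e: "fps_nth (v ^ p) m = fps_nth (fps_const (fps_nth v 0 ^ p)) m + (if m < p then 0 else fps_nth (?w ^ p) (m - p))"
    by (simp add: fps_X_power_mult_nth)
  show ?case
  proof (cases "m < p")
    case True
    then show ?thesis using e p0 by (auto simp: dvd_imp_le)
  next
    case False
    then have "m - p < m" "m > 0" using p0 by auto
    have "p dvd (m - p) \<longleftrightarrow> p dvd m" using False by (metis dvd_minus_self not_less)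
    moreover have "(m - p) div p + 1 = m div p" using False p0 by (simp add: div_if[of m p])
    ultimately show ?thesis using False e less.IH[OF \<open>m - p < m\<close>, of ?w] \<open>m > 0\<close> by (simp add: fps_nth_fps_const)
  qed
qed

text \<open>
  Multiplication twisted by the Frobenius, \<open>(a, b) \<mapsto> a^p b\<close>, makes \<open>K\<close> a vector space over itself; take
  a linear functional that does not vanish at \<open>c\<close>.  It serves as a substitute for \<open>p\<close>-th roots when \<open>K\<close>
  is not perfect.
\<close>
lemma frobenius_functional:
  fixes c :: "'a::field"
  assumes p: "prime p" "of_nat p = (0 :: 'a)" and c: "c \<noteq> 0"
  obtains l where "\<And>a b. l (a + b) = l a + l b" "\<And>a b. l (a ^ p * b) = a * l b" "l c = 1"
proof -
  interpret f1: vector_space "\<lambda>a b :: 'a. a ^ p * b"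
    by unfold_locales (simp_all add: power_prime_add[OF p] power_mult_distrib algebra_simps)
  interpret f2: vector_space "\<lambda>a b :: 'a. a * b"
    by unfold_locales (simp_all add: algebra_simps)
  interpret fp: vector_space_pair "\<lambda>a b :: 'a. a ^ p * b" "\<lambda>a b :: 'a. a * b" ..
  have "f1.independent {c}" using c by (simp add: f1.independent_insert f1.span_empty)
  then obtain g where g: "Vector_Spaces.linear (\<lambda>a b. a ^ p * b) (*) g" "g c = 1"
    using fp.linear_independent_extend[of "{c}" "\<lambda>_. 1"] by auto
  interpret g: Vector_Spaces.linear "\<lambda>a b. a ^ p * b" "(*)" g by (rule g)
  show ?thesis by (rule that[of g]) (use g(2) in \<open>auto simp: g.add g.scale\<close>)
qed

text \<open>
  The Cartier operator: only the terms with an exponent \<open>p n + r\<close> survive, the exponent becomes \<open>n\<close>, and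
  the functional \<open>l\<close> is applied to the coefficient.
\<close>
definition cartier :: "nat \<Rightarrow> nat \<Rightarrow> ('a \<Rightarrow> 'a) \<Rightarrow> 'a::field fps \<Rightarrow> 'a fps" where
  "cartier p r l v = Abs_fps (\<lambda>n. l (fps_nth v (p * n + r)))"

lemma cartier_add: "(\<And>a b. l (a + b) = l a + l b) \<Longrightarrow> cartier p r l (v + w) = cartier p r l v + cartier p r l w"
  by (rule fps_ext) (simp add: cartier_def)

lemma cartier_power_mult:
  fixes v w :: "'a::field fps"
  assumes p: "prime p" "of_nat p = (0 :: 'a)" and r: "r < p"
    and ll: "\<And>a b. l (a + b) = l a + l b" "\<And>a b. l (a ^ p * b) = a * l b"
  shows "cartier p r l (v ^ p * w) = v * cartier p r l w"
proof (rule fps_ext)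
  fix n
  have p0: "p > 0" using p prime_gt_0_nat by blast
  have l0: "l 0 = 0" using ll(1)[of 0 0] by (metis add.right_neutral add_left_cancel)
  have lsum: "l (\<Sum>i\<in>A. f i) = (\<Sum>i\<in>A. l (f i))" for A and f :: "nat \<Rightarrow> 'a"
    by (induction A rule: infinite_finite_induct) (auto simp: l0 ll(1))
  have "fps_nth (v ^ p * w) (p * n + r) = (\<Sum>i\<le>p * n + r. fps_nth (v ^ p) i * fps_nth w (p * n + r - i))"
    by (simp add: fps_mult_nth atLeast0AtMost)
  also have "\<dots> = (\<Sum>i\<in>(\<lambda>j. p * j) ` {..n}. fps_nth (v ^ p) i * fps_nth w (p * n + r - i))"
  proof (intro sum.mono_neutral_right ballI)
    show "(\<lambda>j. p * j) ` {..n} \<subseteq> {..p * n + r}" by (auto intro!: trans_le_add1)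
    fix i assume i: "i \<in> {..p * n + r} - (\<lambda>j. p * j) ` {..n}"
    have "\<not> p dvd i"
    proof
      assume "p dvd i"
      then obtain j where j: "i = p * j" by (elim dvdE)
      then have "p * j < p * Suc n" using i r by auto
      then have "j < Suc n" unfolding mult_less_cancel1 by blast
      then have "j \<le> n" by simp
      then show False using i j by auto
    qed
    then show "fps_nth (v ^ p) i * fps_nth w (p * n + r - i) = 0" by (simp add: fps_power_prime_nth[OF p])
  qed simp
  also have "\<dots> = (\<Sum>j\<le>n. fps_nth (v ^ p) (p * j) * fps_nth w (p * n + r - p * j))"
    using p0 by (subst sum.reindex) (auto simp: inj_on_def)
  also have "\<dots> = (\<Sum>j\<le>n. fps_nth v j ^ p * fps_nth w (p * (n - j) + r))"
    using p0 by (intro sum.cong refl arg_cong2[where f = "(*)"] arg_cong2[where f = fps_nth])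
      (auto simp: fps_power_prime_nth[OF p] diff_mult_distrib2)
  finally have "l (fps_nth (v ^ p * w) (p * n + r)) = (\<Sum>j\<le>n. fps_nth v j * l (fps_nth w (p * (n - j) + r)))"
    by (simp only: lsum ll(2))
  then show "fps_nth (cartier p r l (v ^ p * w)) n = fps_nth (v * cartier p r l w) n"
    by (simp only: cartier_def fps_nth_Abs_fps fps_mult_nth[of v] atLeast0AtMost)
qed

lemma cartier_polys:
  assumes "w \<in> polys_in_fps" "l 0 = 0" "p > 0"
  shows "cartier p r l w \<in> polys_in_fps"
proof -
  obtain q where q: "w = fps_of_poly q" using assms by blast
  have "cartier p r l w = fps_of_poly (truncate_fps (Suc (degree q)) (cartier p r l w))"
  proof (rule fps_ext)
    fix n
    have "coeff q (p * n + r) = 0" if "Suc (degree q) \<le> n"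
    proof (rule coeff_eq_0)
      have "n \<le> p * n" using assms(3) by simp
      then show "degree q < p * n + r" using that by linarith
    qed
    then show "fps_nth (cartier p r l w) n = fps_nth (fps_of_poly (truncate_fps (Suc (degree q)) (cartier p r l w))) n"
      by (simp add: coeff_truncate_fps cartier_def q assms(2))
  qed
  then show ?thesis by blast
qed

text \<open>
  If the minimal relation of \<open>u\<close> involved only powers \<open>u^(p k)\<close>, the Cartier operator, applied to it with
  a functional that keeps the leading coefficient alive, would produce a nonzero relation of degree
  smaller by the factor \<open>p\<close>.
\<close>
lemma algebraic_fps_separable:
  fixes u :: "'a::field fps"
  assumes "alg_over polys_in_fps u"
  shows "\<exists>P. coeffs_in polys_in_fps P \<and> poly P u = 0 \<and> poly (pderiv P) u \<noteq> 0"
proof -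
  note S = subring_polys
  obtain P where P: "P \<noteq> 0" "coeffs_in polys_in_fps P" "poly P u = 0"
    "\<And>Q. Q \<noteq> 0 \<Longrightarrow> coeffs_in polys_in_fps Q \<Longrightarrow> poly Q u = 0 \<Longrightarrow> degree P \<le> degree Q"
    using minimal_polynomial_over[OF assms] by blast
  have deg: "degree P > 0"
  proof (rule ccontr)
    assume "\<not> degree P > 0"
    then have "degree P = 0" by simp
    then show False by (rule degree_eq_zeroE) (use P(1,3) in auto)
  qed
  have "poly (pderiv P) u \<noteq> 0"
  proof
    assume pd: "poly (pderiv P) u = 0"
    have "of_nat k \<in> (polys_in_fps :: 'a fps set)" for k
      by (induction k) (use subring_setD[OF S] in auto)
    then have "coeffs_in polys_in_fps (pderiv P)"
      unfolding coeffs_in_def coeff_pderiv using P(2)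
      by (intro allI subring_setD(5)[OF S]) (simp_all add: coeffs_in_def del: of_nat_Suc)
    moreover have "degree (pderiv P) \<le> degree P - 1"
      by (rule degree_le) (auto simp: coeff_pderiv coeff_eq_0 simp del: of_nat_Suc)
    ultimately have "pderiv P = 0" using P(4)[of "pderiv P"] pd deg by (cases "pderiv P = 0") auto
    have co: "of_nat k = (0 :: 'a)" if "coeff P k \<noteq> 0" for k
    proof (cases k)
      case (Suc n)
      have "coeff (pderiv P) n = 0" using \<open>pderiv P = 0\<close> by simp
      then have "of_nat k = (0 :: 'a fps)" using that Suc by (simp add: coeff_pderiv del: of_nat_Suc)
      then show ?thesis by (metis fps_const_eq_0_iff fps_of_nat)
    qed simp
    define p where "p = CHAR('a)"
    define d where "d = degree P"
    have pd: "p dvd k" if "coeff P k \<noteq> 0" for k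
      using co[OF that] by (simp add: of_nat_eq_0_iff_char_dvd p_def)
    have "p dvd d" using pd[of d] P(1) by (simp add: d_def)
    then have "p > 0" using deg by (auto simp: d_def intro: Nat.gr0I)
    then have p: "prime p" "of_nat p = (0 :: 'a)" using prime_CHAR_semidom[where ?'a = 'a] by (auto simp: p_def)
    obtain d' where d': "d = p * d'" using \<open>p dvd d\<close> by (elim dvdE)
    have "coeff P d \<noteq> 0" using P(1) by (simp add: d_def)
    then obtain m where m: "fps_nth (coeff P d) m \<noteq> 0" by (metis fps_nonzero_nth)
    obtain l where l: "\<And>a b. l (a + b) = l a + l b" "\<And>a b. l (a ^ p * b) = a * l b" "l (fps_nth (coeff P d) m) = 1"
      using frobenius_functional[OF p m] by blast
    have l0: "l 0 = 0" using l(1)[of 0 0] by (metis add.right_neutral add_left_cancel)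
    \<comment> \<open>For this residue the Cartier operator does not kill the leading coefficient of \<open>P\<close>, which has a nonzero term of exponent \<open>m\<close>.\<close>
    define r where "r = m mod p"
    have r: "r < p" using \<open>p > 0\<close> by (simp add: r_def)
    let ?L = "cartier p r l"
    have L0: "?L 0 = 0" by (rule fps_ext) (simp add: cartier_def l0)
    have Lsum: "?L (\<Sum>i\<in>A. f i) = (\<Sum>i\<in>A. ?L (f i))" for A and f :: "nat \<Rightarrow> 'a fps"
      by (induction A rule: infinite_finite_induct) (auto simp: L0 cartier_add l(1))
    define Q where "Q = (\<Sum>k\<le>d'. monom (?L (coeff P (p * k))) k)"
    have cQ: "coeff Q k = (if k \<le> d' then ?L (coeff P (p * k)) else 0)" for k
      by (simp add: Q_def coeff_sum)
    have "0 = poly P u" using P by simp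
    also have "\<dots> = (\<Sum>k\<le>d. coeff P k * u ^ k)" by (simp add: poly_altdef d_def)
    also have "\<dots> = (\<Sum>k\<in>(\<lambda>k. p * k) ` {..d'}. coeff P k * u ^ k)"
    proof (intro sum.mono_neutral_right ballI)
      show "(\<lambda>k. p * k) ` {..d'} \<subseteq> {..d}" by (auto simp: d')
      fix k assume k: "k \<in> {..d} - (\<lambda>k. p * k) ` {..d'}"
      have "coeff P k = 0"
      proof (rule ccontr)
        assume "coeff P k \<noteq> 0"
        then obtain j where "k = p * j" using pd by (metis dvdE)
        then show False using k d' \<open>p > 0\<close> by auto
      qed
      then show "coeff P k * u ^ k = 0" by simp
    qed simp
    also have "\<dots> = (\<Sum>k\<le>d'. (u ^ k) ^ p * coeff P (p * k))"
      using \<open>p > 0\<close> by (subst sum.reindex) (auto simp: inj_on_def power_mult[symmetric] mult.commute intro!: sum.cong)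
    finally have "?L (\<Sum>k\<le>d'. (u ^ k) ^ p * coeff P (p * k)) = 0" using L0 by simp
    then have "(\<Sum>k\<le>d'. u ^ k * ?L (coeff P (p * k))) = 0"
      by (simp add: Lsum cartier_power_mult[OF p r l(1,2)])
    moreover have "poly Q u = (\<Sum>k\<le>d'. u ^ k * ?L (coeff P (p * k)))"
      by (simp add: Q_def poly_sum poly_monom mult.commute)
    ultimately have "poly Q u = 0" by simp
    moreover have "coeffs_in polys_in_fps Q"
      unfolding coeffs_in_def cQ using P(2) cartier_polys[of _ l p r, OF _ l0 \<open>p > 0\<close>] subring_setD(1)[OF S]
      by (auto simp: coeffs_in_def)
    moreover have "p * (m div p) + r = m" by (simp add: r_def)
    then have "fps_nth (?L (coeff P (p * d'))) (m div p) = 1"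
      using l(3) by (simp add: cartier_def d')
    then have "coeff Q d' \<noteq> 0" by (auto simp: cQ)
    then have "Q \<noteq> 0" by auto
    moreover have "degree Q \<le> d'" by (rule degree_le) (simp add: cQ)
    moreover have "d' < d" using deg d' prime_gt_1_nat[OF p(1)] by (simp add: d_def[symmetric])
    ultimately show False using P(4)[of Q] by (simp add: d_def)
  qed
  then show ?thesis using P by blast
qed

section \<open>Blowing up to a simple root\<close>

lemma lift_coeffs:
  assumes "coeffs_in polys_in_fps P"
  obtains Q :: "'a::field poly poly" where "P = map_poly fps_of_poly Q"
proof
  have inj: "inj (fps_of_poly :: 'a poly \<Rightarrow> _)" by (simp add: inj_def)
  have "inv_into UNIV fps_of_poly 0 = (0 :: 'a poly)" using inv_f_f[OF inj, of 0] by simp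
  then show "P = map_poly fps_of_poly (map_poly (inv_into UNIV fps_of_poly) P)"
    using assms by (intro poly_eqI) (auto simp: coeff_map_poly coeffs_in_def f_inv_into_f)
qed

lemma pcompose_linear_taylor:
  fixes P :: "'b::idom poly"
  shows "\<exists>H. pcompose P [:t, m:] = [:poly P t, m * poly (pderiv P) t:] + Polynomial.smult (m\<^sup>2) (monom 1 2 * H)"
proof (induction P)
  case 0
  show ?case by (intro exI[of _ 0]) simp
next
  case (pCons a P)
  then obtain H where H: "pcompose P [:t, m:] = [:poly P t, m * poly (pderiv P) t:] + Polynomial.smult (m\<^sup>2) (monom 1 2 * H)"
    by blast
  let ?H = "[:poly (pderiv P) t:] + [:t, m:] * H"
  have M: "monom 1 2 = [:0, 0, 1 :: 'b:]" by (simp add: monom_altdef power2_eq_square)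
  have "pcompose (pCons a P) [:t, m:] = [:a:] + [:t, m:] * pcompose P [:t, m:]" by (simp add: pcompose_pCons)
  also have "\<dots> = [:poly (pCons a P) t, m * poly (pderiv (pCons a P)) t:] + Polynomial.smult (m\<^sup>2) (monom 1 2 * ?H)"
    unfolding H M by (simp add: pderiv_pCons algebra_simps power2_eq_square smult_add_right)
  finally show ?case by blast
qed

lemma fps_X_power_dvd_poly:
  assumes "fps_X ^ k dvd fps_of_poly (q :: 'a::field poly)"
  shows "monom 1 k dvd q"
proof -
  obtain w where w: "fps_of_poly q = fps_X ^ k * w" using assms by (elim dvdE)
  have "coeff q i = 0" if "i < k" for i
    using arg_cong[OF w, of "\<lambda>f. fps_nth f i"] that by (simp add: fps_X_power_mult_nth)
  then show ?thesis by (simp add: monom_1_dvd_iff')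
qed

lemma poly_diff_dvd: "u - t dvd poly R u - poly R (t :: 'b::comm_ring_1)"
proof (induction R)
  case (pCons a R)
  have "poly (pCons a R) u - poly (pCons a R) t = u * (poly R u - poly R t) + (u - t) * poly R t"
    by (simp add: algebra_simps)
  also have "u - t dvd \<dots>" using pCons by simp
  finally show ?case .
qed simp

text \<open>
  Let \<open>e\<close> be the order of vanishing of the derivative at \<open>u\<close>, and write \<open>u = T + s^(e + 1) w\<close> with \<open>T\<close> a
  truncation of \<open>u\<close>.  By Taylor expansion \<open>P (T + s^(e + 1) Y)\<close> is divisible by \<open>s^(2 e + 1)\<close>, and in the
  quotient the linear coefficient is a unit at \<open>s = 0\<close>.
\<close>
lemma blow_up:
  fixes u :: "'a::field fps"
  assumes P: "ev2 fps_const P fps_X u = 0" "ev2 fps_const (pderiv P) fps_X u \<noteq> 0"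
  obtains T k w Q where "u = fps_of_poly T + fps_X ^ k * w" "ev2 fps_const Q fps_X w = 0"
    "fps_nth (ev2 fps_const (pderiv Q) fps_X w) 0 \<noteq> 0"
proof -
  define e where "e = subdegree (ev2 fps_const (pderiv P) fps_X u)"
  define T where "T = truncate_fps (Suc e) u"
  define w where "w = fps_shift (Suc e) u"
  define m :: "'a poly" where "m = monom 1 (Suc e)"
  let ?X = "fps_X :: 'a fps" and ?i = "fps_of_poly :: 'a poly \<Rightarrow> _" and ?I = "map_poly (fps_of_poly :: 'a poly \<Rightarrow> _)"
  note hi = hom_onD[OF hom_fps_of_poly subring_set_UNIV]
  have c: "coeffs_in UNIV q" for q :: "'a poly poly" by (simp add: coeffs_in_def)
  note hI = hom_on_map_poly[OF hom_fps_of_poly subring_set_UNIV]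
  have u: "u = ?i T + ?X ^ Suc e * w" unfolding T_def w_def by (rule fps_split_low)
  have mX: "?i m = ?X ^ Suc e" by (simp add: m_def fps_of_poly_monom)
  have iP: "?i (poly Q t) = poly (?I Q) (?i t)" for Q t
    by (subst hom_on_poly[OF hom_fps_of_poly subring_set_UNIV]) auto
  define G where "G = pcompose P [:T, m:]"
  have IG: "?I G = pcompose (?I P) [:?i T, ?i m:]"
  proof -
    have "?I (pcompose R [:T, m:]) = pcompose (?I R) [:?i T, ?i m:]" for R
      by (induction R) (simp_all add: pcompose_pCons map_poly_pCons hI c)
    then show ?thesis by (simp add: G_def)
  qed
  have Gw: "poly (?I G) w = 0" using P(1) unfolding IG ev2_fps mX u by (simp add: poly_pcompose mult.commute)
  have dG: "poly (pderiv (?I G)) w = ?X ^ Suc e * poly (pderiv (?I P)) u"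
    unfolding IG mX u by (simp add: pderiv_pcompose poly_pcompose pderiv_pCons mult.commute)
  have dP: "ev2 fps_const (pderiv P) fps_X u = poly (pderiv (?I P)) u"
    by (simp add: ev2_fps pderiv_map_poly_hom[OF hom_fps_of_poly])
  have se: "subdegree (poly (pderiv (?I P)) u) = e" "poly (pderiv (?I P)) u \<noteq> 0" using P(2) by (simp_all add: e_def dP)
  obtain H where H: "G = [:poly P T, m * poly (pderiv P) T:] + Polynomial.smult (m\<^sup>2) (monom 1 2 * H)"
    unfolding G_def using pcompose_linear_taylor by blast
  have "?X ^ e dvd poly (pderiv (?I P)) u"
    using se by (metis fps_dvd_iff fps_X_power_subdegree fps_X_neq_zero order_refl power_not_zero)
  moreover have "?X ^ Suc e dvd poly (pderiv (?I P)) u - poly (pderiv (?I P)) (?i T)"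
  proof -
    have "u - ?i T dvd poly R u - poly R (?i T)" for R :: "'a fps poly"
      by (rule poly_diff_dvd)
    moreover have "?X ^ Suc e dvd u - ?i T" by (subst u) simp
    ultimately show ?thesis by (meson dvd_trans)
  qed
  then have "?X ^ e dvd poly (pderiv (?I P)) u - poly (pderiv (?I P)) (?i T)"
    by (rule dvd_trans[rotated]) simp
  ultimately have d1: "?X ^ e dvd poly (pderiv (?I P)) (?i T)"
    using dvd_diff[of "?X ^ e" "poly (pderiv (?I P)) u" "poly (pderiv (?I P)) u - poly (pderiv (?I P)) (?i T)"] by simp
  have "poly (?I G) w = ?i (poly P T) + ?X ^ Suc e * poly (pderiv (?I P)) (?i T) * w + (?X ^ Suc e)\<^sup>2 * (w\<^sup>2 * poly (?I H) w)"
    unfolding H by (simp add: hI c hi iP pderiv_map_poly_hom[OF hom_fps_of_poly, symmetric] map_poly_pCons mX map_poly_monom poly_monom algebra_simps)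
  then have "?i (poly P T) = - (?X ^ Suc e * poly (pderiv (?I P)) (?i T) * w) - (?X ^ Suc e)\<^sup>2 * (w\<^sup>2 * poly (?I H) w)"
    using Gw by (simp add: eq_neg_iff_add_eq_0 algebra_simps)
  moreover have pw: "?X ^ (2 * e + 1) dvd ?X ^ Suc e * z" if "?X ^ e dvd z" for z
  proof -
    have *: "?X ^ (2 * e + 1) = ?X ^ Suc e * ?X ^ e" by (simp only: power_add[symmetric]) simp
    show ?thesis unfolding * by (intro mult_dvd_mono dvd_refl that)
  qed
  have "?X ^ (2 * e + 1) dvd ?X ^ Suc e * (poly (pderiv (?I P)) (?i T) * w)" by (rule pw) (use d1 in simp)
  moreover have "?X ^ (2 * e + 1) dvd ?X ^ Suc e * (?X ^ Suc e * (w\<^sup>2 * poly (?I H) w))"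
    by (rule pw) (simp add: power_Suc2 dvd_mult2 mult.assoc del: power_Suc)
  ultimately have d0: "?X ^ (2 * e + 1) dvd ?i (poly P T)"
    by (simp only: dvd_diff dvd_minus_iff mult.assoc power2_eq_square)
  let ?M = "monom 1 (2 * e + 1) :: 'a poly"
  have "?M dvd poly P T" by (rule fps_X_power_dvd_poly[OF d0])
  moreover have "?M dvd m * poly (pderiv P) T"
    by (rule fps_X_power_dvd_poly)
      (use pw[OF d1] in \<open>simp add: hi(4) mX iP pderiv_map_poly_hom[OF hom_fps_of_poly]\<close>)
  moreover have "?M dvd m\<^sup>2"
    by (rule fps_X_power_dvd_poly) (use pw[of "?X ^ Suc e"] in \<open>simp add: hi(4) mX power2_eq_square\<close>)
  ultimately have "?M dvd coeff G i" for i
    unfolding H by (auto simp: coeff_pCons split: nat.split)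
  then have "[:?M:] dvd G" by (simp add: const_poly_dvd_iff)
  then obtain Q where Q: "G = [:?M:] * Q" by (elim dvdE)
  have IQ: "?I G = Polynomial.smult (?X ^ (2 * e + 1)) (?I Q)"
    unfolding Q by (simp add: hI c map_poly_pCons fps_of_poly_monom)
  have "ev2 fps_const Q fps_X w = 0" using Gw unfolding IQ by (simp add: ev2_fps)
  moreover have "fps_nth (ev2 fps_const (pderiv Q) fps_X w) 0 \<noteq> 0"
  proof -
    let ?d = "poly (pderiv (?I Q)) w"
    have *: "?X ^ (2 * e + 1) * ?d = ?X ^ Suc e * poly (pderiv (?I P)) u"
      using dG unfolding IQ by (simp add: pderiv_smult)
    then have "?d \<noteq> 0" using se by auto
    moreover have "subdegree (?X ^ (2 * e + 1) * ?d) = 2 * e + 1"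
      unfolding * using se by simp
    ultimately have "subdegree ?d = 0" by simp
    then have "fps_nth ?d 0 \<noteq> 0" using \<open>?d \<noteq> 0\<close> by (metis nth_subdegree_nonzero)
    then show ?thesis by (simp add: ev2_fps pderiv_map_poly_hom[OF hom_fps_of_poly])
  qed
  ultimately show ?thesis using that u by blast
qed

section \<open>Specialising algebraic power series\<close>

text \<open>
  The consequence of largeness on which the proof rests.  The arc consists of the series \<open>w\<close>
  that the blow-ups attach to the elements of \<open>U\<close>.
\<close>
theorem algebraic_series_specialise:
  fixes U :: "'a::field fps set"
  assumes inf: "infinite (UNIV :: 'a set)" and large: "large_field TYPE('a)"
    and U: "finite U" "\<And>u. u \<in> U \<Longrightarrow> alg_over polys_in_fps u"
  obtains R :: "'a fps set" and \<phi> :: "'a fps \<Rightarrow> 'a" where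
    "subring_set R" "U \<subseteq> R" "\<And>c. fps_const c \<in> R" "fps_X \<in> R" "hom_on R \<phi>"
    "\<And>c. \<phi> (fps_const c) = c" "\<phi> fps_X \<noteq> 0"
proof -
  have "\<exists>w. \<forall>u\<in>U. (\<exists>T k. u = fps_of_poly T + fps_X ^ k * w u) \<and>
     (\<exists>Q. ev2 fps_const Q fps_X (w u) = 0 \<and> fps_nth (ev2 fps_const (pderiv Q) fps_X (w u)) 0 \<noteq> 0)"
  proof (rule bchoice, rule ballI)
    fix u assume "u \<in> U"
    then obtain P where P: "coeffs_in polys_in_fps P" "poly P u = 0" "poly (pderiv P) u \<noteq> 0"
      using algebraic_fps_separable U by blast
    obtain P' where P': "P = map_poly fps_of_poly P'" by (rule lift_coeffs[OF P(1)])
    have "ev2 fps_const P' fps_X u = 0" "ev2 fps_const (pderiv P') fps_X u \<noteq> 0"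
      using P unfolding P' by (simp_all add: ev2_fps pderiv_map_poly_hom[OF hom_fps_of_poly])
    then obtain T k w Q where "u = fps_of_poly T + fps_X ^ k * w" "ev2 fps_const Q fps_X w = 0"
      "fps_nth (ev2 fps_const (pderiv Q) fps_X w) 0 \<noteq> 0" by (rule blow_up)
    then show "\<exists>w. (\<exists>T k. u = fps_of_poly T + fps_X ^ k * w) \<and>
      (\<exists>Q. ev2 fps_const Q fps_X w = 0 \<and> fps_nth (ev2 fps_const (pderiv Q) fps_X w) 0 \<noteq> 0)" by blast
  qed
  then obtain w where w1: "\<And>u. u \<in> U \<Longrightarrow> \<exists>T k. u = fps_of_poly T + fps_X ^ k * w u"
    and w2: "\<And>u. u \<in> U \<Longrightarrow> \<exists>Q. ev2 fps_const Q fps_X (w u) = 0 \<and> fps_nth (ev2 fps_const (pderiv Q) fps_X (w u)) 0 \<noteq> 0"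
    by blast
  from w2 obtain Q where Q: "\<And>u. u \<in> U \<Longrightarrow> ev2 fps_const (Q u) fps_X (w u) = 0"
    "\<And>u. u \<in> U \<Longrightarrow> fps_nth (ev2 fps_const (pderiv (Q u)) fps_X (w u)) 0 \<noteq> 0" by metis
  obtain us where us: "set us = U" using U(1) finite_list by blast
  define M where "M = length us"
  define P where "P i = Q (us ! (i - 1))" for i
  define H where "H = (\<Prod>i\<in>{1..M}. ev2 fps_const (pderiv (P i)) fps_X (w (us ! (i - 1))))"
  define x where "x i = (if i = 0 then fps_X else if i \<le> M then w (us ! (i - 1)) else inverse H)" for i
  have usU: "us ! (i - 1) \<in> U" if "0 < i" "i \<le> M" for i
    using that us by (auto simp: M_def)
  have "fps_nth H 0 = (\<Prod>i\<in>{1..M}. fps_nth (ev2 fps_const (pderiv (P i)) fps_X (w (us ! (i - 1)))) 0)"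
    unfolding H_def by (rule hom_on_prod[of UNIV "\<lambda>f. fps_nth f 0"]) (auto simp: hom_on_def)
  also have "\<dots> \<noteq> 0" using Q(2) usU by (auto simp: P_def)
  finally have H0: "fps_nth H 0 \<noteq> 0" .
  have HH: "(\<Prod>i\<in>{1..M}. ev2 fps_const (pderiv (P i)) fps_X (x i)) = H"
    unfolding H_def by (intro prod.cong) (auto simp: x_def)
  interpret etale_arc x M P
  proof
    show "x 0 = fps_X" by (simp add: x_def)
    show "ev2 fps_const (P i) fps_X (x i) = 0" if "0 < i" "i \<le> M" for i
      using Q(1)[OF usU[OF that]] that by (simp add: x_def P_def)
    show "x (Suc M) * (\<Prod>i\<in>{1..M}. ev2 fps_const (pderiv (P i)) fps_X (x i)) = 1"
      unfolding HH using inverse_mult_eq_1[OF H0] by (simp add: x_def)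
  qed
  obtain \<phi> :: "'a fps \<Rightarrow> 'a" where phi: "hom_on R \<phi>" "\<And>c. \<phi> (fps_const c) = c" "\<phi> fps_X \<noteq> 0"
    using large_imp_hom[OF inf large] by blast
  have "U \<subseteq> R"
  proof
    fix u assume u: "u \<in> U"
    then obtain j where j: "j < M" "us ! j = u" using us by (auto simp: M_def in_set_conv_nth)
    have "w u \<in> R" using x_R[of "Suc j"] j by (simp add: x_def)
    moreover obtain T k where "u = fps_of_poly T + fps_X ^ k * w u" using w1[OF u] by blast
    moreover have "fps_of_poly T + fps_X ^ k * w u \<in> R"
      by (intro subring_setD(4,5,7)[OF subring_R] fps_of_poly_R fps_X_R \<open>w u \<in> R\<close>)
    ultimately show "u \<in> R" by metis
  qed
  then show ?thesis using that subring_R const_R fps_X_R phi by blast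
qed

section \<open>Algebraic elements and interpolation\<close>

text \<open>
  Through this translation the closure properties of algebraic elements follow from the theory of
  field extensions.
\<close>
lemma alg_over_iff_algebraic:
  fixes k :: "'b::field set"
  assumes k: "subring_set k" 
  defines "F \<equiv> (ring_of_type_algebra :: 'b ring)"
  shows "alg_over k z \<longleftrightarrow> (ring.algebraic F over k) z"
proof -
  interpret field F unfolding F_def by (rule field_from_type_algebra)
  have F: "carrier F = UNIV" "monoid.mult F = (*)" "add F = (+)" "\<zero>\<^bsub>F\<^esub> = 0" "\<one>\<^bsub>F\<^esub> = 1"
    by (simp_all add: F_def ring_of_type_algebra_def fun_eq_iff)
  have pow: "x [^]\<^bsub>F\<^esub> (n::nat) = x ^ n" for x :: 'b and n
    by (induction n) (simp_all add: F power_Suc2 del: power_Suc)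
  have ev: "eval q x = poly (Poly (rev q)) x" for q x
    by (induction q) (simp_all add: F pow Poly_append poly_monom add.commute mult.commute)
  have neg: "\<ominus>\<^bsub>F\<^esub> x = - x" for x
    by (rule sum_zero_eq_neg[symmetric]) (simp_all add: F)
  have sr: "subring k F"
    by (rule subringI) (use subring_setD[OF k] in \<open>auto simp: F neg\<close>)
  show ?thesis
  proof
    assume "alg_over k z"
    then obtain p where p: "p \<noteq> 0" "coeffs_in k p" "poly p z = 0" by (auto simp: alg_over_def)
    have "set (coeffs p) \<subseteq> k" using p(2) by (auto simp: coeffs_in_def coeffs_def)
    moreover have "hd (rev (coeffs p)) \<noteq> 0" using p(1) by (simp add: hd_rev last_coeffs_eq_coeff_degree)
    ultimately have "polynomial\<^bsub>F\<^esub> k (rev (coeffs p))" by (simp add: polynomial_def F)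
    then have "rev (coeffs p) \<in> carrier (k[X]\<^bsub>F\<^esub>)" by (simp add: univ_poly_carrier)
    then show "(algebraic over k) z"
      by (rule algebraicI) (use p in \<open>auto simp: ev F\<close>)
  next
    assume "(algebraic over k) z"
    then obtain p where p: "p \<in> carrier (k[X]\<^bsub>F\<^esub>)" "p \<noteq> []" "eval p z = \<zero>\<^bsub>F\<^esub>"
      using algebraicE[OF sr, of z] by (auto simp: F)
    then have pp: "set p \<subseteq> k" "hd p \<noteq> 0" by (auto simp: univ_poly_carrier[symmetric] polynomial_def F)
    have "Polynomial.coeff (Poly (rev p)) i \<in> k" for i
      using pp(1) subring_setD(1)[OF k] by (auto simp: nth_default_def rev_nth)
    moreover have "Polynomial.coeff (Poly (rev p)) (length p - 1) = hd p"
      using p(2) by (simp add: nth_default_def rev_nth hd_conv_nth)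
    then have "Poly (rev p) \<noteq> 0" using pp(2) by (metis coeff_0)
    ultimately show "alg_over k z" using p(3) unfolding alg_over_def coeffs_in_def ev F by blast
  qed
qed

lemma alg_over_arith:
  fixes k :: "'b::field set"
  assumes k: "subring_set k" and kinv: "\<And>x. x \<in> k \<Longrightarrow> inverse x \<in> k"
  shows "alg_over k x \<Longrightarrow> alg_over k y \<Longrightarrow> alg_over k (x + y)"
    "alg_over k x \<Longrightarrow> alg_over k y \<Longrightarrow> alg_over k (x * y)"
    "alg_over k x \<Longrightarrow> alg_over k (- x)"
    "alg_over k x \<Longrightarrow> alg_over k (inverse x)"
    "x \<in> k \<Longrightarrow> alg_over k x"
proof -
  define F where "F = (ring_of_type_algebra :: 'b ring)"
  interpret field F unfolding F_def by (rule field_from_type_algebra)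
  note alg = alg_over_iff_algebraic[OF k, folded F_def]
  have F: "carrier F = UNIV" "monoid.mult F = (*)" "add F = (+)" "\<zero>\<^bsub>F\<^esub> = 0" "\<one>\<^bsub>F\<^esub> = 1"
    by (simp_all add: F_def ring_of_type_algebra_def fun_eq_iff)
  have neg: "\<ominus>\<^bsub>F\<^esub> x = - x" for x
    by (rule sum_zero_eq_neg[symmetric]) (simp_all add: F)
  have inv: "inv\<^bsub>F\<^esub> x = inverse x" if "x \<noteq> 0" for x
    by (rule inv_unique'[symmetric]) (use that in \<open>auto simp: F\<close>)
  have "subfield k F"
    by (rule subfieldI'[OF subringI]) (use subring_setD[OF k] kinv in \<open>auto simp: F neg inv\<close>)
  from subfield_of_algebraics[OF this] have A: "subfield {x. alg_over k x} F"
    by (simp add: F alg)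
  note S = subfieldE(1)[OF A]
  show "alg_over k x \<Longrightarrow> alg_over k y \<Longrightarrow> alg_over k (x + y)"
    using subringE(7)[OF S, of x y] by (simp add: F)
  show "alg_over k x \<Longrightarrow> alg_over k y \<Longrightarrow> alg_over k (x * y)"
    using subringE(6)[OF S, of x y] by (simp add: F)
  show "alg_over k x \<Longrightarrow> alg_over k (- x)"
    using subringE(5)[OF S, of x] by (simp add: F neg)
  show mem: "x \<in> k \<Longrightarrow> alg_over k x" for x
    unfolding alg_over_def using subring_setD[OF k]
    by (intro exI[of _ "[:-x, 1:]"]) (auto simp: coeffs_in_def coeff_pCons split: nat.split)
  show "alg_over k x \<Longrightarrow> alg_over k (inverse x)"
  proof (cases "x = 0")
    case True
    then show ?thesis using mem[of 0] subring_setD(1)[OF k] by simp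
  next
    case False
    assume "alg_over k x"
    then show ?thesis using subfield_m_inv(1)[OF A, of x] False by (simp add: F inv)
  qed
qed

text \<open>
  A polynomial whose values at more than \<open>degree p\<close> points of a subfield lie in this subfield has all
  its coefficients there: split off the linear factor of one point at a time.
\<close>
lemma coeffs_of_values:
  fixes p :: "'b::field poly"
  assumes A: "subring_set A" "\<And>x. x \<in> A \<Longrightarrow> inverse x \<in> A"
    and Z: "finite Z" "Z \<subseteq> A" "degree p < card Z" "\<And>x. x \<in> Z \<Longrightarrow> poly p x \<in> A"
  shows "coeffs_in A p"
  using Z
proof (induction "card Z" arbitrary: Z p)
  case (Suc n)
  then obtain a Y where aY: "Z = insert a Y" "a \<notin> Y" "card Y = n" "finite Y" by (metis card_Suc_eq finite_insert)
  note s = subring_setD[OF A(1)]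
  have a: "a \<in> A" "poly p a \<in> A" using Suc.prems aY by auto
  have "[:-a, 1:] dvd p - [:poly p a:]" by (simp add: poly_eq_0_iff_dvd[symmetric])
  then obtain q where q: "p - [:poly p a:] = [:-a, 1:] * q" by (elim dvdE)
  then have p: "p = [:poly p a:] + [:-a, 1:] * q" by (simp add: algebra_simps)
  show ?case
  proof (cases "q = 0")
    case True
    then have "p = [:poly p a:]" using p by simp
    then show ?thesis using a coeffs_in(9)[OF A(1)] by metis
  next
    case False
    have "degree ([:-a, 1:] * q) = Suc (degree q)" using False by (subst degree_mult_eq) auto
    then have "degree (p - [:poly p a:]) = Suc (degree q)" using q by simp
    moreover have "degree (p - [:poly p a:]) \<le> degree p"
      by (rule degree_diff_le) auto
    ultimately have "degree q < card Y" using Suc aY by simp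
    moreover have "poly q y \<in> A" if "y \<in> Y" for y
    proof -
      have ya: "y \<noteq> a" "y \<in> A" "poly p y \<in> A" using that aY Suc.prems by auto
      have "poly p y - poly p a = (y - a) * poly q y"
        using arg_cong[OF q, of "\<lambda>r. poly r y"] by (simp add: algebra_simps)
      then have "poly q y = (poly p y - poly p a) * inverse (y - a)" using ya by simp
      then show ?thesis using ya a A(2) s by metis
    qed
    ultimately have "coeffs_in A q"
      using Suc.hyps(1)[of Y q] aY Suc.prems by auto
    then show ?thesis
      by (subst p) (use a s(1-3) in \<open>intro coeffs_in(1,3,6,10)[OF A(1)]; simp\<close>)
  qed
qed simp

lemma card_roots_separable:
  fixes p :: "'b::alg_closed_field poly"
  assumes p: "p \<noteq> 0" "\<And>x. poly p x = 0 \<Longrightarrow> poly (pderiv p) x \<noteq> 0"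
  shows "card {x. poly p x = 0} = degree p"
  using p
proof (induction "degree p" arbitrary: p)
  case 0
  then have "degree p = 0" by simp
  then obtain c where "p = [:c:]" by (rule degree_eq_zeroE)
  then show ?case using 0 by auto
next
  case (Suc n)
  then obtain a where a: "poly p a = 0" using alg_closed_imp_poly_has_root[of p] by auto
  then obtain q where q: "p = [:-a, 1:] * q" by (meson dvdE poly_eq_0_iff_dvd)
  have q0: "q \<noteq> 0" using q Suc.prems by auto
  have d: "degree q = n" using Suc.hyps(2) q0 unfolding q by (subst (asm) degree_mult_eq) auto
  have pd: "poly (pderiv p) x = poly q x + (x - a) * poly (pderiv q) x" for x
    unfolding q pderiv_mult by (simp add: pderiv_pCons algebra_simps)
  have qa: "poly q a \<noteq> 0" using Suc.prems(2)[OF a] pd[of a] by simp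
  have "card {x. poly q x = 0} = n"
    using Suc.hyps(1)[of q] d q0 Suc.prems(2) pd qa q by force
  moreover have "{x. poly p x = 0} = insert a {x. poly q x = 0}" unfolding q by auto
  ultimately show ?case using qa Suc.hyps(2) poly_roots_finite[OF q0] by simp
qed

section \<open>Roots modulo a deformation\<close>

lemma fps_X_power_dvd_iff: "fps_X ^ n dvd (f :: 'r::comm_ring_1 fps) \<longleftrightarrow> (\<forall>i<n. fps_nth f i = 0)"
proof
  assume "\<forall>i<n. fps_nth f i = 0"
  then have "f = fps_X ^ n * fps_shift n f"
    by (intro fps_ext) (simp add: fps_X_power_mult_nth)
  then show "fps_X ^ n dvd f" by (rule dvdI)
qed (auto simp: fps_X_power_mult_nth elim!: dvdE)

text \<open>
  A map that improves every approximation by one order in \<open>s\<close> has a fixed point.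
\<close>
lemma fps_fixed_point:
  fixes T :: "'r::comm_ring_1 fps \<Rightarrow> 'r fps"
  assumes inv: "\<And>a. fps_X ^ k dvd a \<Longrightarrow> fps_X ^ k dvd T a"
    and contr: "\<And>n a b. fps_X ^ k dvd a \<Longrightarrow> fps_X ^ k dvd b \<Longrightarrow> fps_X ^ n dvd a - b \<Longrightarrow> fps_X ^ Suc n dvd T a - T b"
  obtains a where "fps_X ^ k dvd a" "T a = a"
proof -
  define s where "s n = (T ^^ n) 0" for n
  have sS: "s (Suc n) = T (s n)" for n by (simp add: s_def)
  have sk: "fps_X ^ k dvd s n" for n by (induction n) (auto simp: sS inv, simp add: s_def)
  have step: "fps_X ^ n dvd s (Suc n) - s n" for n
  proof (induction n)
    case (Suc n)
    then show ?case using contr[OF sk sk Suc] by (simp only: sS)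
  qed simp
  have stab: "fps_nth (s m) i = fps_nth (s n) i" if "i < n" "n \<le> m" for i n m
    using that(2)
  proof (induction m rule: dec_induct)
    case (step m)
    then have "fps_nth (s (Suc m) - s m) i = 0"
      using \<open>fps_X ^ m dvd s (Suc m) - s m\<close>[unfolded fps_X_power_dvd_iff] that(1) by auto
    then show ?case using step by simp
  qed simp
  define a where "a = Abs_fps (\<lambda>i. fps_nth (s (Suc i)) i)"
  have as: "fps_X ^ n dvd a - s n" for n
    unfolding fps_X_power_dvd_iff
  proof (intro allI impI)
    fix i assume "i < n"
    then show "fps_nth (a - s n) i = 0" using stab[of i "Suc i" n] by (simp add: a_def)
  qed
  have ak: "fps_X ^ k dvd a"
    using sk unfolding fps_X_power_dvd_iff by (simp add: a_def)
  have "fps_nth (T a) i = fps_nth a i" for i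
  proof -
    have "fps_X ^ Suc i dvd T a - s (Suc i)" unfolding sS by (rule contr[OF ak sk as])
    then have "fps_nth (T a) i = fps_nth (s (Suc i)) i" unfolding fps_X_power_dvd_iff by auto
    then show ?thesis by (simp add: a_def)
  qed
  then have "T a = a" by (rule fps_ext)
  then show ?thesis using that ak by blast
qed

lemma hom_const_const: "hom_on UNIV (\<lambda>c :: 'a::field. fps_const [:c:])"
  by (simp add: hom_on_def one_pCons flip: fps_const_1_eq_1)

text \<open>
  Here and below \<open>fps_const [:0, 1:]\<close> is the variable \<open>X\<close>, and the ground ring is \<open>K[X][[s]]\<close>, so
  that congruences modulo \<open>h = f - s^m X\<close> become equations.  Put \<open>A = X + lam v\<close> and \<open>C = 1 - kap v\<close>.
  By the Bezout relation, the terms of \<open>F(A) - h C\<close> that are linear in \<open>v\<close> and free of \<open>s\<close> add up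
  to \<open>v\<close>, and the equation takes the form \<open>v = T v\<close> for a contraction \<open>T\<close> on the series divisible by \<open>s\<close>.
\<close>
lemma root_modulo_deformation:
  fixes f :: "'a::field poly"
  assumes m: "m > 0" and bez: "kap * f + lam * pderiv f = 1"
  defines "F \<equiv> map_poly (\<lambda>c. fps_const [:c:]) f"
    and "h \<equiv> fps_const f - fps_X ^ m * fps_const [:0, 1:]"
  obtains A C where "poly F A = h * C"
proof -
  let ?x = "fps_const [:0, 1:] :: 'a poly fps"
  let ?l = "fps_const lam" and ?k = "fps_const kap"
  have ev: "poly (map_poly (\<lambda>c. fps_const [:c:]) q) ?x = fps_const q" for q :: "'a poly"
    by (induction q) (simp_all add: map_poly_pCons fps_const_mult flip: fps_const_add)
  obtain H where H: "pcompose F [:?x, 1:] = [:poly F ?x, 1 * poly (pderiv F) ?x:] + Polynomial.smult (1\<^sup>2) (monom 1 2 * H)"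
    using pcompose_linear_taylor by blast
  have taylor: "poly F (?x + w) = fps_const f + fps_const (pderiv f) * w + w\<^sup>2 * poly H w" for w
    using arg_cong[OF H, of "\<lambda>p. poly p w"]
    by (simp add: poly_pcompose F_def pderiv_map_poly_hom[OF hom_const_const] ev poly_monom mult_ac)
  define T where "T v = - ((?l * v)\<^sup>2 * poly H (?l * v)) - fps_X ^ m * ?x * (1 - ?k * v)" for v
  have Xm: "fps_X dvd (fps_X ^ m :: 'a poly fps)" using m by (simp add: dvd_power)
  obtain v where v: "T v = v"
  proof (rule fps_fixed_point[of 1 T])
    fix a :: "'a poly fps" assume "fps_X ^ 1 dvd a"
    then show "fps_X ^ 1 dvd T a"
      unfolding T_def using Xm by (auto intro!: dvd_diff simp: power2_eq_square)
  next
    fix n and a b :: "'a poly fps" assume ab: "fps_X ^ 1 dvd a" "fps_X ^ 1 dvd b" "fps_X ^ n dvd a - b"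
    let ?a = "?l * a" and ?b = "?l * b"
    have 1: "fps_X dvd ?a" "fps_X dvd ?b" using ab by auto
    have 2: "fps_X ^ n dvd ?a - ?b" using ab(3) by (simp flip: right_diff_distrib)
    have "fps_X ^ n dvd poly H ?a - poly H ?b" using 2 poly_diff_dvd dvd_trans by blast
    then have "fps_X * fps_X ^ n dvd (?a * ?a) * (poly H ?a - poly H ?b)"
      using 1 by (intro mult_dvd_mono) auto
    moreover have "fps_X * fps_X ^ n dvd ((?a + ?b) * (?a - ?b)) * poly H ?b"
      by (rule dvd_mult2[OF mult_dvd_mono[OF dvd_add[OF 1] 2]])
    moreover have "fps_X * fps_X ^ n dvd fps_X ^ m * (?x * ?k * (a - b))"
      using Xm ab(3) by (intro mult_dvd_mono) auto
    moreover have "T a - T b = - ((?a * ?a) * (poly H ?a - poly H ?b)) - ((?a + ?b) * (?a - ?b)) * poly H ?b + fps_X ^ m * (?x * ?k * (a - b))"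
      by (simp add: T_def power2_eq_square algebra_simps)
    ultimately show "fps_X ^ Suc n dvd T a - T b"
      by (simp only: power_Suc dvd_add dvd_diff dvd_minus_iff)
  qed blast
  have e: "?k * fps_const f + ?l * fps_const (pderiv f) = 1"
    using bez by (simp add: fps_const_mult flip: fps_const_add fps_const_1_eq_1)
  have "poly F (?x + ?l * v) = fps_const f + fps_const (pderiv f) * (?l * v) - (v + fps_X ^ m * ?x * (1 - ?k * v))"
    unfolding taylor using v by (simp add: T_def algebra_simps)
  also have "\<dots> = fps_const f - (?k * fps_const f + ?l * fps_const (pderiv f)) * v + fps_const (pderiv f) * (?l * v) - fps_X ^ m * ?x * (1 - ?k * v)"
    unfolding e by (simp add: algebra_simps)
  also have "\<dots> = h * (1 - ?k * v)" by (simp add: h_def algebra_simps del: fps_const_mult)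
  finally show ?thesis by (rule that)
qed

text \<open>
  Division by \<open>h\<close> in \<open>K[X][[s]]\<close>: modulo \<open>s\<close> it is division by \<open>f\<close>, and the quotient is corrected by
  successive approximation.
\<close>
lemma remainder_modulo_deformation:
  fixes f :: "'a::field poly"
  assumes m: "m > 0" and deg: "degree f > 0"
  defines "h \<equiv> fps_const f - fps_X ^ m * fps_const [:0, 1:]"
  obtains Q where "\<And>n. degree (fps_nth (A - h * Q) n) < degree f"
proof -
  define D where "D v = Abs_fps (\<lambda>n. fps_nth v n div f)" for v
  let ?g = "fps_X ^ m * fps_const [:0, 1:] :: 'a poly fps"
  define T where "T Q = D (A + ?g * Q)" for Q
  have Xm: "fps_X dvd (fps_X ^ m :: 'a poly fps)" using m by (simp add: dvd_power)
  obtain Q where Q: "T Q = Q"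
  proof (rule fps_fixed_point[of 0 T])
    fix n and a b :: "'a poly fps" assume "fps_X ^ n dvd a - b"
    then have "fps_X * fps_X ^ n dvd fps_X ^ m * (fps_const [:0, 1:] * (a - b))"
      using Xm by (intro mult_dvd_mono) auto
    then have "fps_X ^ Suc n dvd (A + ?g * a) - (A + ?g * b)" by (simp add: algebra_simps)
    then show "fps_X ^ Suc n dvd T a - T b"
      unfolding fps_X_power_dvd_iff by (simp add: T_def D_def)
  qed auto
  have "fps_nth (A - h * Q) n = fps_nth (A + ?g * Q) n mod f" for n
  proof -
    have "fps_nth Q n = fps_nth (A + ?g * Q) n div f" by (subst Q[symmetric]) (simp add: T_def D_def)
    moreover have e: "A - h * Q = (A + ?g * Q) - fps_const f * Q" by (simp add: h_def algebra_simps)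
    have "fps_nth (A - h * Q) n = fps_nth (A + ?g * Q) n - f * fps_nth Q n"
      unfolding e by simp
    ultimately show ?thesis by (simp only: minus_mult_div_eq_mod)
  qed
  moreover have "degree (q mod f) < degree f" for q
    using degree_mod_less[of f q] deg by (cases "q mod f = 0"; cases "f = 0") auto
  ultimately show ?thesis using that[of Q] by simp
qed

text \<open>
  The degree in \<open>X\<close> has to stay bounded for all powers of \<open>s\<close>, so that finitely many power series
  over \<open>K\<close> encode an element of \<open>K[X][[s]]\<close>.
\<close>
definition deg_le :: "nat \<Rightarrow> 'a::field poly fps \<Rightarrow> bool" where
  "deg_le k v \<longleftrightarrow> (\<forall>n. degree (fps_nth v n) \<le> k)"

lemma deg_le_mult: "deg_le k v \<Longrightarrow> deg_le l w \<Longrightarrow> deg_le (k + l) (v * w)"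
  unfolding deg_le_def fps_mult_nth
  by (intro allI degree_sum_le) (auto intro: order_trans[OF degree_mult_le] add_mono)

lemma deg_le_add: "deg_le k v \<Longrightarrow> deg_le k w \<Longrightarrow> deg_le k (v + w)"
  unfolding deg_le_def by (auto intro: degree_add_le)

lemma deg_le_poly:
  fixes f :: "'a::field poly"
  assumes "deg_le k A"
  shows "deg_le (degree f * k) (poly (map_poly (\<lambda>c. fps_const [:c:]) f) A)"
proof -
  have pw: "deg_le (i * k) (A ^ i)" for i
  proof (induction i)
    case (Suc i)
    then show ?case using deg_le_mult[OF assms Suc] by simp
  qed (simp add: deg_le_def)
  have "deg_le (degree f * k) (fps_const [:coeff f i:] * A ^ i)" if "i \<le> degree f" for i
  proof -
    have "deg_le (0 + i * k) (fps_const [:coeff f i:] * A ^ i)"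
      by (rule deg_le_mult[OF _ pw]) (auto simp: deg_le_def)
    moreover have "0 + i * k \<le> degree f * k" using that by simp
    ultimately show ?thesis unfolding deg_le_def by (meson order_trans)
  qed
  note t = this
  have "deg_le (degree f * k) (\<Sum>i\<in>J. fps_const [:coeff f i:] * A ^ i)"
    if "finite J" "J \<subseteq> {..degree f}" for J
    using that
  proof (induction J rule: finite_induct)
    case (insert i J)
    then show ?case by (simp add: deg_le_add t)
  qed (simp add: deg_le_def)
  then show ?thesis by (subst poly_map_poly_sum) auto
qed

lemma deg_le_quotient:
  fixes f :: "'a::field poly"
  assumes m: "m > 0" and deg: "degree f > 0"
    and C: "deg_le k ((fps_const f - fps_X ^ m * fps_const [:0, 1:]) * C)"
  shows "deg_le k C"
  unfolding deg_le_def
proof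
  fix n
  show "degree (fps_nth C n) \<le> k"
  proof (induction n rule: less_induct)
    case (less n)
    let ?v = "(fps_const f - fps_X ^ m * fps_const [:0, 1:]) * C"
    have v: "?v = fps_const f * C - fps_X ^ m * (fps_const [:0, 1:] * C)"
      by (simp add: algebra_simps)
    have "f * fps_nth C n = fps_nth ?v n + (if n < m then 0 else [:0, 1:] * fps_nth C (n - m))"
      unfolding v by (simp add: fps_X_power_mult_nth)
    moreover have "degree ([:0, 1:] * fps_nth C (n - m)) \<le> 1 + k" if "\<not> n < m"
      using less[of "n - m"] m that degree_mult_le[of "[:0, 1:]" "fps_nth C (n - m)"] by simp
    moreover have "degree (fps_nth ?v n) \<le> 1 + k" using C unfolding deg_le_def by (metis le_SucI plus_1_eq_Suc)
    ultimately have "degree (f * fps_nth C n) \<le> 1 + k"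
      by (auto intro: degree_add_le)
    moreover have "f \<noteq> 0" using deg by auto
    ultimately show ?case using deg
      by (cases "fps_nth C n = 0") (auto simp: degree_mult_eq)
  qed
qed

definition fps_at :: "'a::field \<Rightarrow> 'a poly fps \<Rightarrow> 'a fps" where
  "fps_at x v = Abs_fps (\<lambda>n. poly (fps_nth v n) x)"

lemma hom_fps_at: "hom_on UNIV (fps_at x)"
  unfolding hom_on_def
  by (auto intro!: fps_ext simp: fps_at_def fps_mult_nth poly_sum)

definition fps_coord :: "nat \<Rightarrow> 'a::field poly fps \<Rightarrow> 'a fps" where
  "fps_coord j v = Abs_fps (\<lambda>n. coeff (fps_nth v n) j)"

lemma fps_at_coord: "deg_le k v \<Longrightarrow> fps_at x v = (\<Sum>j<Suc k. fps_coord j v * fps_const (x ^ j))"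
proof (rule fps_ext)
  fix n assume "deg_le k v"
  then have "degree (fps_nth v n) \<le> k" by (simp add: deg_le_def)
  then have "poly (fps_nth v n) x = (\<Sum>j\<le>k. coeff (fps_nth v n) j * x ^ j)"
    unfolding poly_altdef by (intro sum.mono_neutral_left) (auto simp: coeff_eq_0)
  then show "fps_nth (fps_at x v) n = fps_nth (\<Sum>j<Suc k. fps_coord j v * fps_const (x ^ j)) n"
    by (simp add: fps_at_def fps_coord_def fps_sum_nth lessThan_Suc_atMost del: fps_const_power sum.lessThan_Suc)
qed

text \<open>
  A root \<open>u\<close> of \<open>f\<close> modulo \<open>f - s^m X\<close>, with the quotient \<open>c\<close>, in terms of their coefficients in \<open>K[[s]]\<close>.
  The identity is only recorded at \<open>X = x\<close> in \<open>K\<close>; in this form it passes to \<open>K\<close> and is first-order.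
\<close>
lemma series_root_certificate:
  fixes f :: "'a::field poly"
  assumes m: "m > 0" and deg: "degree f > 0" and bez: "kap * f + lam * pderiv f = 1"
  defines "d \<equiv> degree f"
  obtains u c :: "nat \<Rightarrow> 'a fps" where
    "\<And>x. poly (map_poly fps_const f) (\<Sum>j<d. u j * fps_const (x ^ j)) =
      (fps_const (poly f x) - fps_X ^ m * fps_const x) * (\<Sum>j<Suc (d * d). c j * fps_const (x ^ j))"
proof -
  let ?F = "map_poly (\<lambda>c. fps_const [:c:]) f"
  let ?h = "fps_const f - fps_X ^ m * fps_const [:0, 1:]"
  obtain A C where AC: "poly ?F A = ?h * C" using root_modulo_deformation[OF m bez] by blast
  obtain Q where Q: "\<And>n. degree (fps_nth (A - ?h * Q) n) < d"
    using remainder_modulo_deformation[OF m deg, of A] unfolding d_def by blast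
  define B where "B = A - ?h * Q"
  have Bd: "deg_le (d - 1) B"
    unfolding deg_le_def
  proof
    fix n show "degree (fps_nth B n) \<le> d - 1" using Q[of n] by (simp add: B_def)
  qed
  have "B - A dvd poly ?F B - poly ?F A" by (rule poly_diff_dvd)
  moreover have "?h dvd B - A" by (simp add: B_def)
  ultimately have "?h dvd poly ?F B - poly ?F A" by (rule dvd_trans[rotated])
  then have "?h dvd poly ?F B" using AC by (metis dvd_triv_left dvd_diff_left_iff)
  then obtain C' where C': "poly ?F B = ?h * C'" by (elim dvdE)
  have "deg_le (d * (d - 1)) (?h * C')" unfolding C'[symmetric] d_def by (rule deg_le_poly) (use Bd d_def in simp)
  then have "deg_le (d * (d - 1)) C'" by (rule deg_le_quotient[OF m deg])
  then have C'd: "deg_le (d * d) C'" unfolding deg_le_def by (meson diff_le_self le_trans mult_le_mono2)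
  have "poly (map_poly fps_const f) (\<Sum>j<d. fps_coord j B * fps_const (x ^ j)) =
      (fps_const (poly f x) - fps_X ^ m * fps_const x) * (\<Sum>j<Suc (d * d). fps_coord j C' * fps_const (x ^ j))" for x
  proof -
    note h = hom_onD[OF hom_fps_at[of x] subring_set_UNIV]
    have "d = Suc (d - 1)" using deg by (simp add: d_def)
    then have B: "fps_at x B = (\<Sum>j<d. fps_coord j B * fps_const (x ^ j))"
      using fps_at_coord[OF Bd, of x] by metis
    have c: "fps_at x (fps_const q) = fps_const (poly q x)" for q
      by (rule fps_ext) (simp add: fps_at_def fps_nth_fps_const)
    have X: "fps_at x fps_X = fps_X" by (rule fps_ext) (simp add: fps_at_def fps_X_def)
    have "fps_at x (poly ?F B) = poly (map_poly fps_const f) (fps_at x B)"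
      by (subst hom_on_poly[OF hom_fps_at subring_set_UNIV])
        (auto simp: map_poly_map_poly o_def c h)
    moreover have "fps_at x (?h * C') = (fps_const (poly f x) - fps_X ^ m * fps_const x) * fps_at x C'"
      by (simp add: h c X)
    ultimately show ?thesis
      unfolding B[symmetric] fps_at_coord[OF C'd, symmetric] C' by simp
  qed
  then show ?thesis by (rule that)
qed

lemma series_fixed_root:
  fixes f :: "'a::field poly"
  assumes m: "m > 0"
  obtains v where "v = fps_X ^ m * poly (map_poly fps_const f) v"
proof -
  let ?T = "\<lambda>v. fps_X ^ m * poly (map_poly fps_const f) v"
  have Xm: "fps_X dvd (fps_X ^ m :: 'a fps)" using m by (simp add: dvd_power)
  obtain v where "?T v = v"
  proof (rule fps_fixed_point[of 0 ?T])
    fix n and a b :: "'a fps" assume "fps_X ^ n dvd a - b"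
    then have "fps_X ^ n dvd poly (map_poly fps_const f) a - poly (map_poly fps_const f) b"
      using poly_diff_dvd dvd_trans by blast
    then have "fps_X * fps_X ^ n dvd fps_X ^ m * (poly (map_poly fps_const f) a - poly (map_poly fps_const f) b)"
      using Xm by (rule mult_dvd_mono[rotated])
    then show "fps_X ^ Suc n dvd ?T a - ?T b" by (simp add: right_diff_distrib)
  qed auto
  then show ?thesis using that by metis
qed

section \<open>Algebraicity of the power series roots\<close>

text \<open>
  The roots of \<open>f - s^m X\<close> are found in an algebraic closure of the field of Laurent series.
\<close>
definition emb :: "'a::field fps \<Rightarrow> 'a fls alg_closure" where
  "emb v = to_ac (fps_to_fls v)"

lemma hom_emb: "hom_on UNIV emb"
  by (simp add: hom_on_def emb_def fls_times_fps_to_fls fps_to_fls_plus)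

lemmas emb_simps = hom_onD[OF hom_emb subring_set_UNIV]

lemma emb_eq_0_iff [simp]: "emb v = 0 \<longleftrightarrow> v = 0"
  by (simp add: emb_def)

lemma emb_eq_iff [simp]: "emb v = emb w \<longleftrightarrow> v = w"
  using emb_eq_0_iff[of "v - w"] by (simp add: emb_simps)

definition rat_fun :: "'a::field fls alg_closure set" where
  "rat_fun = {x. \<exists>a\<in>polys_in_fps. \<exists>b\<in>polys_in_fps. b \<noteq> 0 \<and> x * emb b = emb a}"

lemma rat_funI: "x * emb b = emb a \<Longrightarrow> a \<in> polys_in_fps \<Longrightarrow> b \<in> polys_in_fps \<Longrightarrow> b \<noteq> 0 \<Longrightarrow> x \<in> rat_fun"
  unfolding rat_fun_def by blast

lemma rat_funE:
  assumes "x \<in> rat_fun"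
  obtains a b where "x * emb b = emb a" "a \<in> polys_in_fps" "b \<in> polys_in_fps" "b \<noteq> 0"
  using assms unfolding rat_fun_def by blast

lemma emb_rat_fun: "a \<in> polys_in_fps \<Longrightarrow> emb a \<in> rat_fun"
  using subring_setD(2)[OF subring_polys] by (intro rat_funI[of _ 1]) (simp_all add: emb_simps)

lemma subring_rat_fun: "subring_set rat_fun"
  unfolding subring_set_def
proof (intro conjI ballI)
  note s = subring_setD[OF subring_polys]
  show "1 \<in> rat_fun" using emb_rat_fun[OF s(2)] by (simp add: emb_simps)
  fix x :: "'a fls alg_closure" assume "x \<in> rat_fun"
  then obtain a b where x: "x * emb b = emb a" "a \<in> polys_in_fps" "b \<in> polys_in_fps" "b \<noteq> 0" by (rule rat_funE)
  show "- x \<in> rat_fun"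
    by (rule rat_funI[of _ b "- a"]) (use x s(3)[of a] in \<open>simp_all add: emb_simps\<close>)
  fix y :: "'a fls alg_closure" assume "y \<in> rat_fun"
  then obtain c d where y: "y * emb d = emb c" "c \<in> polys_in_fps" "d \<in> polys_in_fps" "d \<noteq> 0" by (rule rat_funE)
  have "(x + y) * emb (b * d) = (x * emb b) * emb d + (y * emb d) * emb b" by (simp add: emb_simps algebra_simps)
  also have "\<dots> = emb (a * d + c * b)" unfolding x y by (simp add: emb_simps)
  finally show "x + y \<in> rat_fun"
    by (rule rat_funI) (use x y s(4)[OF s(5)[OF x(2) y(3)] s(5)[OF y(2) x(3)]] s(5)[OF x(3) y(3)] in \<open>simp_all\<close>)
  have "(x * y) * emb (b * d) = (x * emb b) * (y * emb d)" by (simp add: emb_simps algebra_simps)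
  also have "\<dots> = emb (a * c)" unfolding x y by (simp add: emb_simps)
  finally show "x * y \<in> rat_fun"
    by (rule rat_funI) (use x y s(5)[OF x(2) y(2)] s(5)[OF x(3) y(3)] in \<open>simp_all\<close>)
qed

lemma rat_fun_inverse:
  assumes "x \<in> rat_fun"
  shows "inverse x \<in> rat_fun"
proof (cases "x = 0")
  case True
  then show ?thesis using subring_setD(1)[OF subring_rat_fun] by simp
next
  case False
  obtain a b where x: "x * emb b = emb a" "a \<in> polys_in_fps" "b \<in> polys_in_fps" "b \<noteq> 0" using assms by (rule rat_funE)
  then have "emb a \<noteq> 0" using False by (metis emb_eq_0_iff mult_eq_0_iff)
  then have "a \<noteq> 0" by simp
  moreover have "inverse x * emb a = emb b" using x(1)[symmetric] False by simp
  ultimately show ?thesis using x by (intro rat_funI[of _ a b])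
qed

lemma common_denominator:
  assumes "finite J" "\<And>i. i \<in> J \<Longrightarrow> x i \<in> rat_fun"
  shows "\<exists>b\<in>polys_in_fps. b \<noteq> 0 \<and> (\<forall>i\<in>J. \<exists>a\<in>polys_in_fps. x i * emb b = emb a)"
  using assms
proof (induction J rule: finite_induct)
  case empty
  then show ?case using subring_setD(2)[OF subring_polys] by (intro bexI[of _ 1]) auto
next
  case (insert j J)
  note s = subring_setD[OF subring_polys]
  obtain b where b: "b \<in> polys_in_fps" "b \<noteq> 0" "\<And>i. i \<in> J \<Longrightarrow> \<exists>a\<in>polys_in_fps. x i * emb b = emb a"
    using insert by blast
  obtain c d where c: "x j * emb d = emb c" "c \<in> polys_in_fps" "d \<in> polys_in_fps" "d \<noteq> 0"
    using insert.prems[of j] by (auto elim: rat_funE)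
  have "\<exists>a\<in>polys_in_fps. x i * emb (b * d) = emb a" if i: "i \<in> insert j J" for i
  proof (cases "i = j")
    case True
    have "x i * emb (b * d) = emb (c * b)" using c(1) True by (simp add: emb_simps mult_ac)
    then show ?thesis using s(5)[OF c(2) b(1)] by blast
  next
    case False
    then obtain a where a: "a \<in> polys_in_fps" "x i * emb b = emb a" using b(3) i by blast
    have "x i * emb (b * d) = (x i * emb b) * emb d" by (simp add: emb_simps mult_ac)
    then have "x i * emb (b * d) = emb (a * d)" unfolding a by (simp add: emb_simps)
    then show ?thesis using s(5)[OF a(1) c(3)] by blast
  qed
  then show ?case using s(5)[OF b(1) c(3)] b(2) c(4) by (intro bexI[of _ "b * d"]) auto
qed

lemma poly_emb: "emb (poly p u) = poly (map_poly emb p) (emb u)"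
  by (rule hom_on_poly[OF hom_emb subring_set_UNIV]) auto

lemma alg_over_emb:
  assumes "alg_over rat_fun (emb u)"
  shows "alg_over polys_in_fps u"
proof -
  obtain p where p: "p \<noteq> 0" "coeffs_in rat_fun p" "poly p (emb u) = 0"
    using assms by (auto simp: alg_over_def)
  obtain b where b: "b \<in> polys_in_fps" "b \<noteq> 0"
    "\<And>i. i \<le> degree p \<Longrightarrow> \<exists>a\<in>polys_in_fps. coeff p i * emb b = emb a"
    using common_denominator[of "{..degree p}" "coeff p"] coeffs_in_coeff[OF p(2)]
    by (metis atMost_iff finite_atMost)
  then obtain a where a: "\<And>i. i \<le> degree p \<Longrightarrow> a i \<in> polys_in_fps"
    "\<And>i. i \<le> degree p \<Longrightarrow> coeff p i * emb b = emb (a i)" by metis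
  define q where "q = (\<Sum>i\<le>degree p. monom (a i) i)"
  have q: "coeff q i = (if i \<le> degree p then a i else 0)" for i
    by (simp add: q_def coeff_sum)
  have eq: "map_poly emb q = Polynomial.smult (emb b) p"
    by (rule poly_eqI) (auto simp: coeff_map_poly emb_simps q a(2)[symmetric] coeff_eq_0 mult.commute)
  have "q \<noteq> 0"
  proof
    assume "q = 0"
    then have "Polynomial.smult (emb b) p = 0" using eq by simp
    then show False using p(1) b(2) by simp
  qed
  moreover have "coeffs_in polys_in_fps q"
    using a(1) subring_setD(1)[OF subring_polys] by (auto simp: coeffs_in_def q)
  moreover have "emb (poly q u) = 0" unfolding poly_emb eq using p(3) by simp
  then have "poly q u = 0" by simp
  ultimately show ?thesis unfolding alg_over_def by blast
qed

definition emb_const :: "'a::field \<Rightarrow> 'a fls alg_closure" where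
  "emb_const c = emb (fps_const c)"

lemma hom_emb_const: "hom_on UNIV emb_const"
  using hom_on_comp[OF hom_fps_const _ hom_emb] unfolding emb_const_def[abs_def] by simp

lemmas emb_const_simps = hom_onD[OF hom_emb_const subring_set_UNIV]

lemma emb_const_eq_iff [simp]: "emb_const a = emb_const b \<longleftrightarrow> a = b"
  by (simp add: emb_const_def)

lemma emb_const_eq_0_iff [simp]: "emb_const a = 0 \<longleftrightarrow> a = 0"
  by (simp add: emb_const_def)

lemma subring_emb_const: "subring_set (range emb_const)"
  unfolding subring_set_def
proof (intro conjI ballI; (elim imageE)?; hypsubst?)
  show "1 \<in> range emb_const" by (rule range_eqI[of _ _ 1]) (simp only: emb_const_simps)
  fix a b :: 'a
  show "- emb_const a \<in> range emb_const" "emb_const a + emb_const b \<in> range emb_const"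
    "emb_const a * emb_const b \<in> range emb_const"
    by (simp_all only: emb_const_simps[symmetric] UNIV_I rangeI)
qed

lemma emb_const_rat_fun: "emb_const c \<in> rat_fun"
  unfolding emb_const_def by (rule emb_rat_fun) (auto intro: range_eqI[of _ _ "[:c:]"] simp: fps_of_poly_const)

lemma variable_transcendental:
  assumes m: "m > 0" and alg: "alg_over (range emb_const) (emb (fps_X ^ m) :: 'a::field fls alg_closure)"
  shows False
proof -
  obtain p where p: "p \<noteq> 0" "coeffs_in (range emb_const) p" "poly p (emb (fps_X ^ m :: 'a fps)) = 0"
    using alg by (auto simp: alg_over_def)
  have "\<forall>i. \<exists>c :: 'a. coeff p i = emb_const c" using p(2) by (auto simp: coeffs_in_def)
  then obtain c :: "nat \<Rightarrow> 'a" where c: "\<And>i. coeff p i = emb_const (c i)" by metis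
  let ?s = "\<Sum>i\<le>degree p. fps_const (c i) * fps_X ^ (m * i)"
  have "emb ?s = poly p (emb (fps_X ^ m))"
    by (simp add: hom_on_sum[OF hom_emb subring_set_UNIV] poly_altdef emb_simps c emb_const_def power_mult)
  then have s0: "?s = 0" using p(3) by (metis emb_eq_0_iff)
  have "c j = 0" if j: "j \<le> degree p" for j
  proof -
    have "fps_nth ?s (m * j) = (\<Sum>i\<le>degree p. if i = j then c i else 0)"
      unfolding fps_sum_nth using m by (intro sum.cong refl) (simp add: fps_X_power_nth)
    then show ?thesis using s0 j by simp
  qed
  then have "lead_coeff p = 0" using c by (simp add: emb_const_simps)
  then show False using p(1) by simp
qed

lemma poly_eq_if_infinite:
  fixes p q :: "'b::idom poly"
  assumes "infinite Z" "\<And>z. z \<in> Z \<Longrightarrow> poly p z = poly q z"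
  shows "p = q"
proof (rule ccontr)
  assume "p \<noteq> q"
  then have "finite {z. poly (p - q) z = 0}" by (intro poly_roots_finite) simp
  moreover have "Z \<subseteq> {z. poly (p - q) z = 0}" using assms by auto
  ultimately show False using assms(1) finite_subset by blast
qed

text \<open>
  At the \<open>d\<close> roots of \<open>H = f - s^m X\<close>, which are algebraic over \<open>K(s)\<close>, the polynomial with the
  coefficients \<open>u j\<close> takes values among the roots of \<open>f\<close>, which are also algebraic.  Interpolation shows
  that the \<open>u j\<close> are algebraic.  The \<open>c j\<close> follow by interpolation at points of \<open>K\<close>, where \<open>H\<close> does not
  vanish.
\<close>
lemma certificate_algebraic:
  fixes f :: "'a::field poly" and u c :: "nat \<Rightarrow> 'a fps"
  assumes inf: "infinite (UNIV :: 'a set)" and m: "m > 0"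
  defines "d \<equiv> degree f"
  assumes d: "d \<ge> 2" and noroot: "\<And>x. poly f x \<noteq> 0"
    and id: "\<And>x. poly (map_poly fps_const f) (\<Sum>j<d. u j * fps_const (x ^ j)) =
      (fps_const (poly f x) - fps_X ^ m * fps_const x) * (\<Sum>j<n. c j * fps_const (x ^ j))"
  shows "\<And>j. j < d \<Longrightarrow> alg_over polys_in_fps (u j)" "\<And>j. j < n \<Longrightarrow> alg_over polys_in_fps (c j)"
proof -
  define A where "A = {z :: 'a fls alg_closure. alg_over rat_fun z}"
  note arith = alg_over_arith[OF subring_rat_fun rat_fun_inverse]
  have A: "subring_set A" "\<And>x. x \<in> A \<Longrightarrow> inverse x \<in> A"
    unfolding subring_set_def A_def using arith subring_setD(2)[OF subring_rat_fun] by auto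
  note s = subring_setD[OF A(1)]
  define F where "F = map_poly emb_const f"
  define U where "U = (\<Sum>j<d. monom (emb (u j)) j)"
  define V where "V = (\<Sum>j<n. monom (emb (c j)) j)"
  define H where "H = F - monom (emb (fps_X ^ m)) 1"
  have f0: "f \<noteq> 0" using d by (auto simp: d_def)
  have coF: "coeff F i = emb_const (coeff f i)" for i
    by (simp add: F_def coeff_map_poly emb_const_simps)
  have F0: "F \<noteq> 0" using f0 by (metis coF coeff_0 emb_const_eq_0_iff poly_eqI)
  have degF: "degree F = d" unfolding F_def d_def by (rule degree_map_poly) simp
  have degH: "degree H = d"
  proof -
    have "degree (monom (emb (fps_X ^ m)) 1) < degree F"
      using degree_monom_le[of "emb (fps_X ^ m)" 1] degF d by (meson less_le_trans le_less_trans one_less_numeral_iff semiring_norm(76))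
    then show ?thesis
      using degree_add_eq_left[of "- monom (emb (fps_X ^ m)) 1" F] degF by (simp add: H_def)
  qed
  then have H0: "H \<noteq> 0" using d by auto
  have rU: "poly U (emb_const x) = emb (\<Sum>j<d. u j * fps_const (x ^ j))"
    and rV: "poly V (emb_const x) = emb (\<Sum>j<n. c j * fps_const (x ^ j))" for x
    by (simp_all add: U_def V_def poly_sum poly_monom hom_on_sum[OF hom_emb subring_set_UNIV] emb_simps
        emb_const_def fps_const_power[symmetric] del: fps_const_power)
  have rF: "poly F (emb v) = emb (poly (map_poly fps_const f) v)" for v
    by (simp add: F_def poly_emb map_poly_map_poly o_def emb_const_def[abs_def] emb_simps)
  have rFc: "poly F (emb_const x) = emb (fps_const (poly f x))" for x
    unfolding F_def emb_const_def[symmetric]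
    by (rule hom_on_poly[OF hom_emb_const subring_set_UNIV, symmetric]) auto
  have rH: "poly H (emb_const x) = emb (fps_const (poly f x) - fps_X ^ m * fps_const x)" for x
    by (simp add: H_def poly_monom rFc[unfolded emb_const_def] emb_simps(4,6) emb_const_def)
  have infc: "infinite (range (emb_const :: 'a \<Rightarrow> _))"
    using inf by (simp add: finite_image_iff inj_def)
  have eqn: "pcompose F U = H * V"
  proof (rule poly_eq_if_infinite[OF infc])
    fix z :: "'a fls alg_closure" assume "z \<in> range emb_const"
    then obtain x where z: "z = emb_const x" by blast
    show "poly (pcompose F U) z = poly (H * V) z"
      unfolding z poly_pcompose rU poly_mult rH rV rF id by (simp only: emb_simps(4) UNIV_I)
  qed
  have cF: "coeffs_in rat_fun F" by (simp add: coeffs_in_def coF emb_const_rat_fun)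
  have Xr: "emb (fps_X ^ m) \<in> rat_fun"
    by (rule emb_rat_fun) (auto intro: range_eqI[of _ _ "monom 1 m"] simp: fps_of_poly_monom)
  have cH: "coeffs_in rat_fun H"
    unfolding H_def by (intro coeffs_in(4,8)[OF subring_rat_fun] cF Xr)
  have rootA: "z \<in> A" if "poly H z = 0" for z
    using that cH H0 unfolding A_def alg_over_def by blast
  have rootF: "z \<in> A" if "poly F z = 0" for z
    using that cF F0 unfolding A_def alg_over_def by blast
  have "card {z. poly H z = 0} = d"
    unfolding degH[symmetric]
  proof (rule card_roots_separable[OF H0], rule notI)
    fix z assume z: "poly H z = 0" "poly (pderiv H) z = 0"
    let ?k = "range (emb_const :: 'a \<Rightarrow> _)"
    have kinv: "inverse x \<in> ?k" if x: "x \<in> ?k" for x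
    proof -
      obtain a where a: "x = emb_const a" using x by blast
      have "inverse x = emb_const (inverse a)"
      proof (cases "a = 0")
        case False
        have "emb_const a * emb_const (inverse a) = 1"
          unfolding emb_const_simps(4)[of a "inverse a", simplified, symmetric] using False by (simp add: emb_const_simps(2))
        then show ?thesis unfolding a by (metis inverse_unique)
      qed (simp add: a emb_const_simps)
      then show ?thesis by blast
    qed
    note ar = alg_over_arith[OF subring_emb_const kinv]
    \<comment> \<open>At a double root \<open>s^m = f'(z)\<close> and \<open>f(z) = z f'(z)\<close>, so \<open>z\<close> and then \<open>s^m\<close> would be algebraic over \<open>K\<close>.\<close>
    have e1: "poly F z = emb (fps_X ^ m) * z" using z(1) by (simp add: H_def poly_monom)
    have e2: "poly (pderiv F) z = emb (fps_X ^ m)" using z(2) by (simp add: H_def pderiv_diff pderiv_monom poly_monom)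
    have pF: "pderiv F = map_poly emb_const (pderiv f)" by (simp add: F_def pderiv_map_poly_hom[OF hom_emb_const])
    have "alg_over ?k z"
      unfolding alg_over_def
    proof (intro exI conjI)
      let ?g = "F - pCons 0 (pderiv F)"
      show "poly ?g z = 0" using e1 e2 by simp
      have "coeff ?g 0 = emb_const (poly f 0)" by (simp add: coF poly_0_coeff_0)
      then have "coeff ?g 0 \<noteq> 0" using noroot by simp
      then show "?g \<noteq> 0" by (metis coeff_0)
      have "coeffs_in ?k F" "coeffs_in ?k (pderiv F)"
        by (simp_all add: coeffs_in_def coF pF coeff_map_poly emb_const_simps)
      then show "coeffs_in ?k ?g"
        using coeffs_in(4,10)[OF subring_emb_const] subring_setD(1)[OF subring_emb_const] by blast
    qed
    moreover have "subring_set {z. alg_over ?k z}"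
      unfolding subring_set_def mem_Collect_eq ball_simps(8)
      using ar(1-3) ar(5)[OF _ subring_setD(2)[OF subring_emb_const]] by blast
    ultimately have "poly (pderiv F) z \<in> {z. alg_over ?k z}"
      by (intro poly_in_subring) (auto simp: pF coeff_map_poly emb_const_simps intro!: ar(5))
    then show False using variable_transcendental[OF m] e2 by simp
  qed
  moreover have "degree U < d"
  proof -
    have "degree U \<le> d - 1" by (rule degree_le) (auto simp: U_def coeff_sum)
    then show ?thesis using d by linarith
  qed
  moreover have "poly U z \<in> A" if "poly H z = 0" for z
  proof (rule rootF)
    have "poly F (poly U z) = poly H z * poly V z" using arg_cong[OF eqn, of "\<lambda>p. poly p z"] by (simp add: poly_pcompose)
    then show "poly F (poly U z) = 0" using that by simp
  qed
  ultimately have cU: "coeffs_in A U"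
    using rootA poly_roots_finite[OF H0] by (intro coeffs_of_values[OF A, of "{z. poly H z = 0}"]) auto
  show u: "alg_over polys_in_fps (u j)" if "j < d" for j
  proof -
    have "coeff U j = emb (u j)" using that by (simp add: U_def coeff_sum)
    then have "emb (u j) \<in> A" using cU by (metis coeffs_in_def)
    then show ?thesis by (intro alg_over_emb) (simp add: A_def)
  qed
  have kA: "x \<in> rat_fun \<Longrightarrow> x \<in> A" for x unfolding A_def using arith(5) by blast
  obtain Z where Z: "finite Z" "degree V < card Z" "Z \<subseteq> range (emb_const :: 'a \<Rightarrow> _)"
    using infinite_arbitrarily_large[OF infc, of "Suc (degree V)"] by auto
  have "coeffs_in A V"
  proof (rule coeffs_of_values[OF A Z(1) _ Z(2)])
    show "Z \<subseteq> A" using Z(3) kA emb_const_rat_fun by blast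
    fix z assume "z \<in> Z"
    then obtain x where z: "z = emb_const x" using Z by blast
    have zA: "z \<in> A" using kA emb_const_rat_fun z by blast
    have "poly F (poly U z) = poly H z * poly V z" using arg_cong[OF eqn, of "\<lambda>p. poly p z"] by (simp add: poly_pcompose)
    moreover have "fps_nth (fps_const (poly f x) - fps_X ^ m * fps_const x) 0 = poly f x" using m by simp
    then have "poly H z \<noteq> 0" unfolding z rH emb_eq_0_iff using noroot[of x] by (metis fps_zero_nth)
    ultimately have "poly V z = poly F (poly U z) * inverse (poly H z)" by simp
    moreover have Uz: "poly U z \<in> A" by (rule poly_in_subring[OF A(1)]) (use cU zA in \<open>auto simp: coeffs_in_def\<close>)
    have "poly F (poly U z) \<in> A" by (rule poly_in_subring[OF A(1)]) (use cF kA Uz in \<open>auto simp: coeffs_in_def\<close>)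
    moreover have "poly H z \<in> A" by (rule poly_in_subring[OF A(1)]) (use cH kA zA in \<open>auto simp: coeffs_in_def\<close>)
    ultimately show "poly V z \<in> A" using A(2) s(5) by metis
  qed
  then show "alg_over polys_in_fps (c j)" if "j < n" for j
  proof -
    assume cV: "coeffs_in A V"
    have "coeff V j = emb (c j)" using that by (simp add: V_def coeff_sum)
    then have "emb (c j) \<in> A" using cV by (metis coeffs_in_def)
    then show ?thesis by (intro alg_over_emb) (simp add: A_def)
  qed
qed

lemma fixed_root_algebraic:
  fixes f :: "'a::field poly"
  assumes v: "v = fps_X ^ m * poly (map_poly fps_const f) v" and f0: "poly f 0 \<noteq> 0"
  shows "alg_over polys_in_fps v"
  unfolding alg_over_def
proof (intro exI conjI)
  let ?p = "[:0, 1:] - Polynomial.smult (fps_X ^ m) (map_poly fps_const f)"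
  show "poly ?p v = 0" using v by simp
  have "coeff ?p 0 = - (fps_X ^ m * fps_const (poly f 0))"
    by (simp add: coeff_map_poly poly_0_coeff_0)
  then have "coeff ?p 0 \<noteq> 0" using f0 by simp
  then show "?p \<noteq> 0" by (metis coeff_0)
  note c = coeffs_in[OF subring_polys]
  have "fps_X ^ m \<in> (polys_in_fps :: 'a fps set)"
    by (rule range_eqI[of _ _ "monom 1 m"]) (simp add: fps_of_poly_monom)
  moreover have "coeffs_in polys_in_fps (map_poly fps_const f)"
    unfolding coeffs_in_def by (auto simp: coeff_map_poly intro: range_eqI[of _ _ "[:_:]"] simp: fps_of_poly_const)
  ultimately show "coeffs_in polys_in_fps ?p"
    using subring_setD(1,2)[OF subring_polys] by (intro c(1,4,7,10)) auto
qed

section \<open>The unstable formula\<close>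

primrec power_term :: "rterm \<Rightarrow> nat \<Rightarrow> rterm" where
  "power_term t 0 = ROne"
| "power_term t (Suc n) = RMult (power_term t n) t"

primrec poly_term :: "nat \<Rightarrow> nat \<Rightarrow> rterm \<Rightarrow> rterm" where
  "poly_term b 0 t = RZero"
| "poly_term b (Suc n) t = RAdd (poly_term b n t) (RMult (RVar (b + n)) (power_term t n))"

primrec ex_list :: "nat list \<Rightarrow> rformula \<Rightarrow> rformula" where
  "ex_list [] \<phi> = \<phi>"
| "ex_list (v # vs) \<phi> = REx v (ex_list vs \<phi>)"

lemma field_structure_simps [simp]:
  "universe field_structure = UNIV" "szero field_structure = 0" "sone field_structure = 1"
  "sneg field_structure = uminus" "sadd field_structure = (+)" "smult field_structure = (*)"
  by (simp_all add: field_structure_def)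

lemma term_val_power: "term_val field_structure e (power_term t n) = term_val field_structure e t ^ n"
  by (induction n) (simp_all add: mult.commute)

lemma term_val_poly: "term_val field_structure e (poly_term b n t) = (\<Sum>j<n. e (b + j) * term_val field_structure e t ^ j)"
  by (induction n) (simp_all add: term_val_power)

lemma holds_ex_list:
  "holds field_structure e (ex_list vs \<phi>) \<longleftrightarrow> (\<exists>g. holds field_structure (\<lambda>v. if v \<in> set vs then g v else e v) \<phi>)"
proof (induction vs arbitrary: e)
  case (Cons v vs)
  have "holds field_structure e (ex_list (v # vs) \<phi>) \<longleftrightarrow> (\<exists>x g. holds field_structure (\<lambda>w. if w \<in> set vs then g w else (e(v := x)) w) \<phi>)"
    by (simp add: Cons)
  also have "\<dots> \<longleftrightarrow> (\<exists>g. holds field_structure (\<lambda>w. if w \<in> set (v # vs) then g w else e w) \<phi>)"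
  proof safe
    fix x g assume h: "holds field_structure (\<lambda>w. if w \<in> set vs then g w else (e(v := x)) w) \<phi>"
    have "(\<lambda>w. if w \<in> set vs then g w else (e(v := x)) w) = (\<lambda>w. if w \<in> set (v # vs) then (if w \<in> set vs then g w else x) else e w)"
      by auto
    then show "\<exists>g. holds field_structure (\<lambda>w. if w \<in> set (v # vs) then g w else e w) \<phi>"
      using h by (intro exI[of _ "\<lambda>w. if w \<in> set vs then g w else x"]) simp
  next
    fix g assume h: "holds field_structure (\<lambda>w. if w \<in> set (v # vs) then g w else e w) \<phi>"
    have "(\<lambda>w. if w \<in> set (v # vs) then g w else e w) = (\<lambda>w. if w \<in> set vs then g w else (e(v := g v)) w)"
      by auto
    then show "\<exists>x g. holds field_structure (\<lambda>w. if w \<in> set vs then g w else (e(v := x)) w) \<phi>"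
      using h by (intro exI[of _ "g v"] exI[of _ g]) (simp only:)
  qed
  finally show ?case .
qed simp

text \<open>
  The variables 0 and 1 are \<open>a\<close> and \<open>b\<close>, 2 is \<open>x\<close>, and from 3 on follow the \<open>d + 1\<close> coefficients of \<open>f\<close>, the
  \<open>d\<close> coefficients of \<open>u\<close> and the \<open>n\<close> coefficients of \<open>c\<close>.  The formula says that
  \<open>b f(u(x)) = (b f(x) - a x) c(x)\<close> for some \<open>u\<close> and \<open>c\<close> and all \<open>x\<close>.
\<close>
definition cert_formula :: "nat \<Rightarrow> nat \<Rightarrow> rformula" where
  "cert_formula d n = ex_list [4 + d ..< 4 + d + d + n] (RNot (REx 2 (RNot (REq
     (RMult (RVar 1) (poly_term 3 (Suc d) (poly_term (4 + d) d (RVar 2))))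
     (RMult (RAdd (RMult (RVar 1) (poly_term 3 (Suc d) (RVar 2))) (RNeg (RMult (RVar 0) (RVar 2))))
        (poly_term (4 + d + d) n (RVar 2)))))))"

lemma holds_cert_formula:
  fixes f :: "'a::field poly"
  assumes d: "degree f = d"
    and e: "\<And>j. j \<le> d \<Longrightarrow> e (3 + j) = coeff f j" "e 0 = a" "e 1 = b"
  shows "holds field_structure e (cert_formula d n) \<longleftrightarrow>
    (\<exists>u c. \<forall>x. b * poly f (\<Sum>j<d. u j * x ^ j) = (b * poly f x - a * x) * (\<Sum>j<n. c j * x ^ j))"
proof -
  let ?vs = "[4 + d ..< 4 + d + d + n]"
  let ?e = "\<lambda>g v. if v \<in> set ?vs then g v else e v"
  have f: "(\<Sum>j<Suc d. ((?e g)(2 := x)) (3 + j) * y ^ j) = poly f y" for g x y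
    unfolding poly_altdef d lessThan_Suc_atMost using e by (intro sum.cong) auto
  have u: "(\<Sum>j<d. ((?e g)(2 := x)) (4 + d + j) * y ^ j) = (\<Sum>j<d. g (4 + d + j) * y ^ j)" for g x y
    by (intro sum.cong) auto
  have c: "(\<Sum>j<n. ((?e g)(2 := x)) (4 + d + d + j) * y ^ j) = (\<Sum>j<n. g (4 + d + d + j) * y ^ j)" for g x y
    by (intro sum.cong) auto
  have "holds field_structure e (cert_formula d n) \<longleftrightarrow> (\<exists>g. \<forall>x. b * poly f (\<Sum>j<d. g (4 + d + j) * x ^ j) =
      (b * poly f x - a * x) * (\<Sum>j<n. g (4 + d + d + j) * x ^ j))"
    unfolding cert_formula_def holds_ex_list holds.simps term_val.simps term_val_poly f u c field_structure_simps
    using e(2,3) by simp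
  also have "\<dots> \<longleftrightarrow> (\<exists>u c. \<forall>x. b * poly f (\<Sum>j<d. u j * x ^ j) = (b * poly f x - a * x) * (\<Sum>j<n. c j * x ^ j))"
  proof safe
    fix g assume "\<forall>x. b * poly f (\<Sum>j<d. g (4 + d + j) * x ^ j) =
      (b * poly f x - a * x) * (\<Sum>j<n. g (4 + d + d + j) * x ^ j)"
    then show "\<exists>u c. \<forall>x. b * poly f (\<Sum>j<d. u j * x ^ j) = (b * poly f x - a * x) * (\<Sum>j<n. c j * x ^ j)"
      by (rule_tac exI[of _ "\<lambda>j. g (4 + d + j)"], rule_tac exI[of _ "\<lambda>j. g (4 + d + d + j)"])
  next
    fix u c assume "\<forall>x. b * poly f (\<Sum>j<d. u j * x ^ j) = (b * poly f x - a * x) * (\<Sum>j<n. c j * x ^ j)"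
    then show "\<exists>g. \<forall>x. b * poly f (\<Sum>j<d. g (4 + d + j) * x ^ j) =
      (b * poly f x - a * x) * (\<Sum>j<n. g (4 + d + d + j) * x ^ j)"
      by (intro exI[of _ "\<lambda>v. if v < 4 + d + d then u (v - (4 + d)) else c (v - (4 + d + d))"]) simp
  qed
  finally show ?thesis .
qed

section \<open>A separable polynomial without a root\<close>

lemma irreducible_bezout:
  fixes f g :: "'a::field poly"
  assumes f: "irreducible f" and g: "\<not> f dvd g"
  shows "\<exists>a b. a * f + b * g = 1"
proof -
  let ?I = "\<lambda>p. p \<noteq> 0 \<and> (\<exists>a b. p = a * f + b * g)"
  have "f \<noteq> 0" using f by auto
  then have "?I f" by (intro conjI, simp, rule_tac exI[of _ 1], rule_tac exI[of _ 0]) simp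
  from ex_has_least_nat[of ?I, OF this, of degree] obtain p a b where
    p: "p \<noteq> 0" "p = a * f + b * g" and min: "\<And>q. ?I q \<Longrightarrow> degree p \<le> degree q" by blast
  have dvd: "p dvd q" if q: "q = a' * f + b' * g" for q a' b'
  proof (rule ccontr)
    assume "\<not> p dvd q"
    then have r: "q mod p \<noteq> 0" by (simp add: dvd_eq_mod_eq_0)
    have "q mod p = (a' - q div p * a) * f + (b' - q div p * b) * g"
      unfolding minus_div_mult_eq_mod[symmetric] by (subst (2) p(2), subst q) (simp add: algebra_simps)
    then have "?I (q mod p)" using r by blast
    then have "degree p \<le> degree (q mod p)" by (rule min)
    then show False using degree_mod_less[OF p(1), of q] r by simp
  qed
  have "p dvd f" by (rule dvd[of _ 1 0]) simp
  moreover have "p dvd g" by (rule dvd[of _ 0 1]) simp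
  ultimately have "is_unit p" using f g by (meson dvd_trans irreducibleD')
  then obtain c where "p * c = 1" by (elim dvdE) metis
  then have "(c * a) * f + (c * b) * g = 1" unfolding p(2) by (simp add: algebra_simps)
  then show ?thesis by blast
qed

lemma separable_pderiv_nonzero:
  fixes p :: "'a::field poly"
  assumes sq: "rsquarefree (map_poly to_ac p)" and x: "poly (map_poly to_ac p) x = 0"
  shows "pderiv p \<noteq> 0"
proof
  let ?P = "map_poly to_ac p"
  assume "pderiv p = 0"
  then have P': "pderiv ?P = 0" by (simp add: pderiv_map_poly_hom[OF hom_to_ac])
  have P0: "?P \<noteq> 0" using sq by (simp add: rsquarefree_def)
  obtain q where q: "?P = [:-x, 1:] * q" using x by (meson dvdE poly_eq_0_iff_dvd)
  have "poly (pderiv ?P) x = poly q x" unfolding q pderiv_mult by (simp add: pderiv_pCons)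
  then have "poly q x = 0" using P' by simp
  then obtain r where "q = [:-x, 1:] * r" by (meson dvdE poly_eq_0_iff_dvd)
  then have "?P = [:-x, 1:] ^ 2 * r" using q by (simp only: power2_eq_square mult.assoc)
  then have "[:-x, 1:] ^ 2 dvd ?P" by (rule dvdI)
  then have "2 \<le> order x ?P" using P0 order_divides by blast
  then show False using rsquarefree_root_order[OF sq x P0] by simp
qed

lemma nonrational_separable_element:
  fixes x :: "'a::field alg_closure"
  assumes "separable_element x" "x \<notin> range to_ac"
  obtains f kap lam where "degree (f :: 'a poly) \<ge> 2" "\<And>y. poly f y \<noteq> 0" "kap * f + lam * pderiv f = 1"
proof -
  obtain f :: "'a poly" where f: "irreducible f" "poly (map_poly to_ac f) x = 0" "rsquarefree (map_poly to_ac f)"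
    using assms(1) by (auto simp: separable_element_def)
  have f0: "f \<noteq> 0" using f(1) by auto
  have deg: "degree f \<ge> 2"
  proof (rule ccontr)
    assume "\<not> degree f \<ge> 2"
    then have "degree f \<le> 1" by simp
    then obtain a b where ab: "f = [:a, b:]" by (metis degree1_coeffs degree_0_id le_neq_implies_less less_one pCons_0_0 degree_eq_zeroE)
    have "to_ac a + x * to_ac b = 0" using f(2) unfolding ab by (simp add: map_poly_pCons)
    moreover have "b \<noteq> 0"
    proof
      assume "b = 0"
      then have "to_ac a = 0" using \<open>to_ac a + x * to_ac b = 0\<close> by simp
      then show False using f0 ab \<open>b = 0\<close> by simp
    qed
    ultimately have "x = to_ac (- a / b)" by (simp add: field_simps add_eq_0_iff)
    then show False using assms(2) by blast
  qed
  have noroot: "poly f y \<noteq> 0" for y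
  proof
    assume "poly f y = 0"
    then obtain g where g: "f = [:-y, 1:] * g" by (meson dvdE poly_eq_0_iff_dvd)
    then have "is_unit [:-y, 1:] \<or> is_unit g" using f(1) irreducibleD by blast
    moreover have "g \<noteq> 0" using f0 g by auto
    ultimately have "degree g = 0" "g \<noteq> 0" by (auto simp: is_unit_iff_degree)
    then have "degree f = 1" unfolding g by (subst degree_mult_eq) auto
    then show False using deg by simp
  qed
  have "degree (pderiv f) \<le> degree f - 1"
    by (rule degree_le) (auto simp: coeff_pderiv coeff_eq_0 simp del: of_nat_Suc)
  then have "\<not> f dvd pderiv f"
    using separable_pderiv_nonzero[OF f(3,2)] deg dvd_imp_degree_le[of f "pderiv f"] by auto
  from irreducible_bezout[OF f(1) this] show ?thesis using that deg noroot by blast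
qed

section \<open>Ladders in large fields\<close>

text \<open>
  Such an \<open>s\<close> behaves like an infinitely small element with respect to the two conditions: \<open>f\<close> has a root
  modulo \<open>f - s^m X\<close>, and \<open>f(x) = s^(-m) x\<close> has a solution.
\<close>
lemma large_small_elements:
  fixes f :: "'a::field poly"
  assumes inf: "infinite (UNIV :: 'a set)" and large: "large_field TYPE('a)"
    and f: "degree f \<ge> 2" "\<And>y. poly f y \<noteq> 0" "kap * f + lam * pderiv f = 1"
  defines "d \<equiv> degree f"
  obtains s where "s \<noteq> 0"
    "\<And>m. 0 < m \<Longrightarrow> m \<le> k \<Longrightarrow> \<exists>u c. \<forall>x. poly f (\<Sum>j<d. u j * x ^ j) =
       (poly f x - s ^ m * x) * (\<Sum>j<Suc (d * d). c j * x ^ j)"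
    "\<And>m. 0 < m \<Longrightarrow> m \<le> k \<Longrightarrow> \<exists>x. x = s ^ m * poly f x"
proof -
  let ?n = "Suc (d * d)" and ?F = "map_poly fps_const f"
  have d0: "degree f > 0" using f(1) by simp
  define solves :: "nat \<Rightarrow> (nat \<Rightarrow> 'a fps) \<Rightarrow> (nat \<Rightarrow> 'a fps) \<Rightarrow> 'a fps \<Rightarrow> bool" where
    "solves m u c v \<longleftrightarrow> (\<forall>x. poly ?F (\<Sum>j<d. u j * fps_const (x ^ j)) =
        (fps_const (poly f x) - fps_X ^ m * fps_const x) * (\<Sum>j<?n. c j * fps_const (x ^ j))) \<and>
      v = fps_X ^ m * poly ?F v" for m u c v
  have "\<exists>u c v. solves m u c v" if m: "m > 0" for m
  proof -
    obtain u c where uc: "\<And>x. poly ?F (\<Sum>j<d. u j * fps_const (x ^ j)) =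
        (fps_const (poly f x) - fps_X ^ m * fps_const x) * (\<Sum>j<?n. c j * fps_const (x ^ j))"
      by (rule series_root_certificate[OF m d0 f(3), folded d_def]) (rule that)
    obtain v where v: "v = fps_X ^ m * poly ?F v" using series_fixed_root[OF m] by blast
    show ?thesis
      unfolding solves_def by (intro exI conjI allI, rule uc, rule v)
  qed
  then obtain u c v where w: "\<And>m. m > 0 \<Longrightarrow> solves m (u m) (c m) (v m)" by metis
  have uc: "poly ?F (\<Sum>j<d. u m j * fps_const (x ^ j)) =
        (fps_const (poly f x) - fps_X ^ m * fps_const x) * (\<Sum>j<?n. c m j * fps_const (x ^ j))"
    and v: "v m = fps_X ^ m * poly ?F (v m)" if "m > 0" for m x
    using w[OF that] unfolding solves_def by blast+
  define G where "G = (\<Union>m\<in>{1..k}. u m ` {..<d} \<union> c m ` {..<?n} \<union> {v m})"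
  have "alg_over polys_in_fps g" if "g \<in> G" for g
  proof -
    from that obtain m where "m \<in> {1..k}" and g: "g \<in> u m ` {..<d} \<union> c m ` {..<?n} \<union> {v m}"
      unfolding G_def by blast
    then have m: "m > 0" by simp
    show ?thesis
      using g certificate_algebraic[OF inf m f(1,2), folded d_def, OF uc[OF m]]
        fixed_root_algebraic[OF v[OF m] f(2)] by auto
  qed
  moreover have "finite G" by (simp add: G_def)
  ultimately obtain R and \<phi> :: "'a fps \<Rightarrow> 'a" where R: "subring_set R" "G \<subseteq> R" "\<And>c. fps_const c \<in> R" "fps_X \<in> R"
    and phi: "hom_on R \<phi>" "\<And>c. \<phi> (fps_const c) = c" "\<phi> fps_X \<noteq> 0"
    using algebraic_series_specialise[OF inf large] by metis
  note r = subring_setD[OF R(1)] and h = hom_onD[OF phi(1) R(1)]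
  have Fp: "poly ?F y \<in> R" "\<phi> (poly ?F y) = poly f (\<phi> y)" if "y \<in> R" for y
  proof -
    show "poly ?F y \<in> R" using that by (intro poly_in_subring[OF R(1)]) (auto simp: coeff_map_poly R)
    show "\<phi> (poly ?F y) = poly f (\<phi> y)"
      using that by (subst hom_on_poly[OF phi(1) R(1)]) (auto simp: coeff_map_poly R map_poly_map_poly h(1) o_def phi(2))
  qed
  have sums: "(\<Sum>j<l. y j * fps_const (x ^ j)) \<in> R"
    "\<phi> (\<Sum>j<l. y j * fps_const (x ^ j)) = (\<Sum>j<l. \<phi> (y j) * x ^ j)" if "\<And>j. j < l \<Longrightarrow> y j \<in> R" for l y x
  proof -
    have t: "y j * fps_const (x ^ j) \<in> R" if "j < l" for j
      using r(5)[OF \<open>\<And>j. j < l \<Longrightarrow> y j \<in> R\<close>[OF that] R(3)] .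
    then show "(\<Sum>j<l. y j * fps_const (x ^ j)) \<in> R" by (intro subring_set_sum[OF R(1)]) auto
    show "\<phi> (\<Sum>j<l. y j * fps_const (x ^ j)) = (\<Sum>j<l. \<phi> (y j) * x ^ j)"
      using t that R(3) by (subst hom_on_sum[OF phi(1) R(1)]) (auto simp: h(4) phi(2) simp del: fps_const_power intro!: sum.cong)
  qed
  show ?thesis
  proof (rule that[OF phi(3)])
    fix m :: nat assume m: "0 < m" "m \<le> k"
    have uR: "u m j \<in> R" if "j < d" for j using R(2) that m unfolding G_def by fastforce
    have cR: "c m j \<in> R" if "j < ?n" for j using R(2) that m unfolding G_def by fastforce
    have vR: "v m \<in> R" using R(2) m unfolding G_def by fastforce
    have XR: "fps_X ^ m \<in> R" using r(7)[OF R(4)] .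
    have "poly f (\<Sum>j<d. \<phi> (u m j) * x ^ j) = (poly f x - \<phi> fps_X ^ m * x) * (\<Sum>j<?n. \<phi> (c m j) * x ^ j)" for x
    proof -
      have "\<phi> (poly ?F (\<Sum>j<d. u m j * fps_const (x ^ j))) =
        \<phi> ((fps_const (poly f x) - fps_X ^ m * fps_const x) * (\<Sum>j<?n. c m j * fps_const (x ^ j)))"
        by (simp only: uc[OF m(1)])
      moreover have "fps_X ^ m * fps_const x \<in> R" using r(5)[OF XR R(3)] .
      ultimately show ?thesis
        using sums[OF uR, of d] sums[OF cR, of ?n] R(3)
        by (simp only: Fp h(4) h(6)[OF R(3)] h(7)[OF R(4)] phi(2) XR r(6)[OF R(3)])
    qed
    then show "\<exists>u c. \<forall>x. poly f (\<Sum>j<d. u j * x ^ j) =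
       (poly f x - \<phi> fps_X ^ m * x) * (\<Sum>j<?n. c j * x ^ j)"
      by (intro exI allI)
    have "\<phi> (v m) = \<phi> fps_X ^ m * poly f (\<phi> (v m))"
      using arg_cong[OF v[OF m(1)], of \<phi>] by (simp only: h(4)[OF XR Fp(1)[OF vR]] h(7)[OF R(4)] Fp(2)[OF vR])
    then show "\<exists>x. x = \<phi> fps_X ^ m * poly f x" by blast
  qed
qed

text \<open>
  The exponents are chosen such that \<open>a i / b j = s^(2 (j - i) - 1)\<close>.  They are odd, so that the case
  \<open>a i = b j\<close>, about which nothing is known, does not arise; they are positive if and only if \<open>i < j\<close>.
\<close>
lemma large_ladder:
  fixes f :: "'a::field poly"
  assumes inf: "infinite (UNIV :: 'a set)" and large: "large_field TYPE('a)"
    and f: "degree f \<ge> 2" "\<And>y. poly f y \<noteq> 0" "kap * f + lam * pderiv f = 1"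
  defines "d \<equiv> degree f"
  shows "has_ladder (field_structure :: 'a ring_structure) 1 (cert_formula d (Suc (d * d))) k"
proof -
  let ?n = "Suc (d * d)"
  obtain s where s: "s \<noteq> 0"
    and U: "\<And>m. 0 < m \<Longrightarrow> m \<le> 2 * k \<Longrightarrow> \<exists>u c. \<forall>x. poly f (\<Sum>j<d. u j * x ^ j) =
       (poly f x - s ^ m * x) * (\<Sum>j<?n. c j * x ^ j)"
    and V: "\<And>m. 0 < m \<Longrightarrow> m \<le> 2 * k \<Longrightarrow> \<exists>x. x = s ^ m * poly f x"
    using large_small_elements[OF inf large f, of "2 * k"] unfolding d_def by blast
  define a where "a i = s ^ (2 * (k - i))" for i
  define b where "b j = s ^ (2 * (k - j) + 1)" for j
  let ?b = "\<lambda>j v. if v = 1 then b j else coeff f (v - 3)"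
  have "holds field_structure (\<lambda>v. if v < 1 then a i else ?b j v) (cert_formula d ?n) \<longleftrightarrow> i < j" if ij: "i < k" "j < k" for i j
  proof -
    have "holds field_structure (\<lambda>v. if v < 1 then a i else ?b j v) (cert_formula d ?n) \<longleftrightarrow>
      (\<exists>u c. \<forall>x. b j * poly f (\<Sum>l<d. u l * x ^ l) = (b j * poly f x - a i * x) * (\<Sum>l<?n. c l * x ^ l))"
      by (rule holds_cert_formula) (auto simp: d_def)
    also have "\<dots> \<longleftrightarrow> i < j"
    proof
      assume lt: "i < j"
      define m where "m = 2 * (j - i) - 1"
      have m: "0 < m" "m \<le> 2 * k" "2 * (k - i) = m + (2 * (k - j) + 1)" using lt ij by (auto simp: m_def)
      have am: "a i = s ^ m * b j" unfolding a_def b_def m(3) by (simp only: power_add)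
      obtain u c where uc: "\<And>x. poly f (\<Sum>l<d. u l * x ^ l) = (poly f x - s ^ m * x) * (\<Sum>l<?n. c l * x ^ l)"
        using U[OF m(1,2)] by blast
      have "b j * poly f (\<Sum>l<d. u l * x ^ l) = (b j * poly f x - a i * x) * (\<Sum>l<?n. c l * x ^ l)" for x
        unfolding uc am by (simp only: algebra_simps)
      then show "\<exists>u c. \<forall>x. b j * poly f (\<Sum>l<d. u l * x ^ l) = (b j * poly f x - a i * x) * (\<Sum>l<?n. c l * x ^ l)"
        by blast
    next
      assume "\<exists>u c. \<forall>x. b j * poly f (\<Sum>l<d. u l * x ^ l) = (b j * poly f x - a i * x) * (\<Sum>l<?n. c l * x ^ l)"
      then obtain u c where uc: "\<And>x. b j * poly f (\<Sum>l<d. u l * x ^ l) = (b j * poly f x - a i * x) * (\<Sum>l<?n. c l * x ^ l)"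
        by blast
      show "i < j"
      proof (rule ccontr)
        assume ge: "\<not> i < j"
        define m where "m = 2 * (i - j) + 1"
        have m: "0 < m" "m \<le> 2 * k" "2 * (k - j) + 1 = m + 2 * (k - i)" using ge ij by (auto simp: m_def)
        have bm: "b j = a i * s ^ m" unfolding a_def b_def m(3) by (simp only: power_add mult.commute)
        obtain x where x: "x = s ^ m * poly f x" using V[OF m(1,2)] by blast
        have "b j * poly f x = a i * (s ^ m * poly f x)" unfolding bm by (simp only: mult.assoc)
        then have "b j * poly f x - a i * x = 0" using x by simp
        then have "b j * poly f (\<Sum>l<d. u l * x ^ l) = 0" using uc[of x] by simp
        then show False using f(2) s by (simp add: b_def)
      qed
    qed
    finally show ?thesis .
  qed
  then show ?thesis
    unfolding has_ladder_def
    by - (rule exI[of _ "\<lambda>i v. a i"], rule exI[of _ ?b], simp)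
qed

theorem theoremD:
  assumes "infinite (UNIV :: 'a::field set)"
    and "large_field TYPE('a)"
    and "stable_field TYPE('a)"
  shows "separably_closed_field TYPE('a)"
  unfolding separably_closed_field_def
proof (intro allI impI, rule ccontr)
  fix x :: "'a alg_closure"
  assume x: "separable_element x" "x \<notin> range to_ac"
  obtain f :: "'a poly" and kap lam where f: "degree f \<ge> 2" "\<And>y. poly f y \<noteq> 0" "kap * f + lam * pderiv f = 1"
    using nonrational_separable_element[OF x] by blast
  define d where "d = degree f"
  let ?M = "field_structure :: 'a ring_structure"
  have "is_model ?M (complete_theory ?M)"
    by (auto simp: is_model_def is_structure_def complete_theory_def)
  moreover have "has_ladder ?M 1 (cert_formula d (Suc (d * d))) k" for k
    unfolding d_def by (rule large_ladder[OF assms(1,2) f])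
  ultimately have "order_property TYPE('a) (complete_theory ?M) 1 (cert_formula d (Suc (d * d)))"
    unfolding order_property_def by blast
  then show False using assms(3) unfolding stable_field_def stable_theory_def by blast
qed

end
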